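(* Let $\varOmega\Subset T^*\mathbb C^n$ (conically) be an open conic subset, let $z=(z_1,\dots,z_n)$ and $w=(w_1,\dots,w_n)$ be local coordinates on a neighborhood of $\operatorname{Cl}\pi(\varOmega)$ with corresponding coordinates $(z;\zeta)$, $(w;\lambda)$ of the cotangent bundle near $\operatorname{Cl}\varOmega$, and let $z=\varPhi(w)$ be the coordinate transformation. For $P(t;z,\zeta,\eta)=\sum_\nu t^\nu P_\nu(z,\zeta,\eta)\in\widehat{\mathfrak S}_{\rm cl}(\varOmega;S)$ with respect to $(z;\zeta)$ set $$\varPhi^*P(t;w,\lambda,\eta)=e^{t\langle\partial_{\zeta'},\partial_{z'}\rangle}P\bigl(t;\varPhi(w),\zeta'+{}^{\mathsf t}\!J^*_\varPhi(\varPhi(w)+z',\varPhi(w))\lambda,\eta\bigr)\Big|_{z'=0,\ \zeta'=0},$$ i.e. $\varPhi^*P=\sum_\nu t^\nu(\varPhi^*P)_\nu$ with $$(\varPhi^*P)_\nu(w,\lambda,\eta)=\sum_{k+|\alpha|=\nu}\frac1{\alpha!}\partial_{\zeta'}^\alpha\partial_{z'}^\alpha P_k\bigl(\varPhi(w),\zeta'+{}^{\mathsf t}\!J^*_\varPhi(\varPhi(w)+z',\varPhi(w))\lambda,\eta\bigr)\Big|_{z'=0,\ \zeta'=0}.$$ Then: (1) $\varPhi^*P(t;w,\lambda,\eta)$ defines an element of $\widehat{\mathfrak S}_{\rm cl}(\varOmega;S)$ with respect to $(w;\lambda)$. Moreover, if $P(t;z,\zeta,\eta)\in\widehat{\mathfrak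 N}_{\rm cl}(\varOmega;S)$, then $\varPhi^*P(t;w,\lambda,\eta)\in\widehat{\mathfrak N}_{\rm cl}(\varOmega;S)$. (2) $\mathbf 1^*$ is the identity, and if $z=\varPhi(w)$ and $w=\varPsi(v)$ are complex coordinate transformations, then $\varPsi^*\varPhi^*=(\varPhi\varPsi)^*$.
   Context: $\|z\|=\max_i|z_i|$; $\pi:T^*X\to X$ is the projection; $\operatorname{Cl}$ is closure; $\mathbf 1$ is the identity transformation. $V\Subset U$ conically means that $V$ is generated by a relatively compact subset of $U$ (contained in $\mathbb R_{>0}K$ with $K\subset U$ compact). $J^*_\varPhi(z',z)$ is a holomorphic $n\times n$ matrix, defined for $z'$ near $z$, with $\varPhi^{-1}(z')-\varPhi^{-1}(z)=J^*_\varPhi(z',z)(z'-z)$; thus ${}^{\mathsf t}\!J^*_\varPhi(z,z)\lambda={}^{\mathsf t}[\partial w/\partial z(z)]\lambda=\zeta$ is the relation between the fiber coordinates $\lambda$ and $\zeta$. For an open conic $\varOmega$ (in given coordinates $(z;\zeta)$) and $\rho\ge0$, $\varOmega_\rho=\operatorname{Cl}\bigcup_{(z;\zeta)\in\varOmega}\{(z+z';\zeta+\zeta');\ \|z'\|\le\rho,\ \|\zeta'\|\le\rho\|\zeta\|\}$, $V[d]=\{(z;\zeta)\in V;\ \|\zeta\|\ge d\}$, $d_\rho=d(1-\rho)$. $S=\{\eta\in\mathbb C;\ 0<|\eta|<r,\ |\arg\eta|<\theta/4\}$ with $r,\theta\in]0,\frac12[$. Functions on $\varOmega_\rho[d_\rho]\times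 S$ are understood to be holomorphic on a neighborhood of it; $t$ is an indeterminate. $\widehat{\mathfrak N}_{\rm cl}(\varOmega;S)$: formal series $P=\sum_{\nu\ge0}t^\nu P_\nu(z,\zeta,\eta)$ such that, for some $d>0$, $\rho\in]0,1[$, all $P_\nu$ are holomorphic on $\varOmega_\rho[d_\rho]\times S$, and there is $A>0$ such that for every $Z\Subset S$, $h>0$ there is $C_{h,Z}>0$ with $\bigl|\sum_{\nu=0}^{m-1}P_\nu\bigr|\le C_{h,Z}\,m!\,A^me^{h\|\zeta\|}/\|\eta\zeta\|^m$ for all $m\in\mathbb N$ on $\varOmega_\rho[d_\rho]\times Z$. $\widehat{\mathfrak S}_{\rm cl}(\varOmega;S)$: formal series $P=\sum t^\nu P_\nu$ such that, for some $d>0$, $\rho\in]0,1[$, all $P_\nu$ are holomorphic on $\varOmega_\rho[d_\rho]\times S$; there is $A>0$ such that for every $Z\Subset S$, $h>0$ there is $C_{h,Z}>0$ with $|P_\nu|\le C_{h,Z}\,\nu!\,A^\nu e^{h\|\zeta\|}/\|\eta\zeta\|^\nu$ for all $\nu\ge0$ on $\varOmega_\rho[d_\rho]\times Z$; and $\partial_\eta P\in\widehat{\mathfrak N}_{\rm cl}(\varOmega;S)$. "With respect to $(w;\lambda)$" means that $\varOmega$ is expressed in the coordinates $(w;\lambda)$ and these definitions are applied in those coordinates. *)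

theory Defs
  imports "HOL-Analysis.Analysis"
begin

section \<open>Holomorphic maps of several complex variables\<close>

class cvector = real_normed_vector +
  fixes scaleC :: "complex \<Rightarrow> 'a \<Rightarrow> 'a"  (infixr \<open>*\<^sub>C\<close> 75)
  assumes scaleC_of_real: "of_real r *\<^sub>C x = r *\<^sub>R x"
    and scaleC_add_left: "(a + b) *\<^sub>C x = a *\<^sub>C x + b *\<^sub>C x"
    and scaleC_add_right: "a *\<^sub>C (x + y) = a *\<^sub>C x + a *\<^sub>C y"
    and scaleC_scaleC: "a *\<^sub>C (b *\<^sub>C x) = (a * b) *\<^sub>C x"

instantiation complex :: cvector
begin
definition scaleC_complex :: "complex \<Rightarrow> complex \<Rightarrow> complex"
  where "scaleC_complex c x = c * x"
instance
  by standard (auto simp: scaleC_complex_def scaleR_conv_of_real algebra_simps)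
end

instantiation vec :: (cvector, finite) cvector
begin
definition scaleC_vec :: "complex \<Rightarrow> 'a ^ 'b \<Rightarrow> 'a ^ 'b"
  where "scaleC_vec c x = (\<chi> i. c *\<^sub>C (x $ i))"
instance
  by standard
    (auto simp: scaleC_vec_def vec_eq_iff scaleC_of_real scaleC_add_left scaleC_add_right scaleC_scaleC)
end

instantiation prod :: (cvector, cvector) cvector
begin
definition scaleC_prod :: "complex \<Rightarrow> 'a \<times> 'b \<Rightarrow> 'a \<times> 'b"
  where "scaleC_prod c x = (c *\<^sub>C fst x, c *\<^sub>C snd x)"
instance
  by standard
    (auto simp: scaleC_prod_def prod_eq_iff scaleC_of_real scaleC_add_left scaleC_add_right scaleC_scaleC)
end

definition holo_on :: "('a::cvector \<Rightarrow> 'b::cvector) \<Rightarrow> 'a set \<Rightarrow> bool"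
  where "holo_on f W \<longleftrightarrow> open W \<and>
    (\<forall>x\<in>W. \<exists>D. (f has_derivative D) (at x) \<and> (\<forall>c v. D (c *\<^sub>C v) = c *\<^sub>C D v))"

definition holo_near :: "('a::cvector \<Rightarrow> 'b::cvector) \<Rightarrow> 'a set \<Rightarrow> bool"
  where "holo_near f V \<longleftrightarrow> (\<exists>W. V \<subseteq> W \<and> holo_on f W)"


section \<open>Iterated partial derivatives\<close>

definition partial_deriv :: "'n \<Rightarrow> (complex ^ 'n \<Rightarrow> complex) \<Rightarrow> complex ^ 'n \<Rightarrow> complex"
  where "partial_deriv i f x = deriv (\<lambda>s. f (x + axis i s)) 0"

text \<open>Some enumeration of the index type. It only fixes the order of differentiation
  in \<open>multi_deriv\<close>, which is immaterial for holomorphic functions.\<close>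

definition index_list :: "'n::finite list"
  where "index_list = (SOME is. distinct is \<and> set is = UNIV)"

definition multi_deriv ::
    "('n::finite \<Rightarrow> nat) \<Rightarrow> (complex ^ 'n \<Rightarrow> complex) \<Rightarrow> complex ^ 'n \<Rightarrow> complex"
  where "multi_deriv \<alpha> = fold (\<lambda>i. partial_deriv i ^^ \<alpha> i) index_list"


section \<open>Cotangent vectors and coordinates\<close>

text \<open>A point of $T^*\mathbb{C}^n$ is a pair \<open>(x, \<xi>)\<close>, standing for the covector
  $\sum_i \xi_i\,dx_i$ at $x$.\<close>

type_synonym 'n cotangent = "(complex ^ 'n) \<times> (complex ^ 'n)"

definition fiber_conic :: "'n::finite cotangent set \<Rightarrow> bool"
  where "fiber_conic V \<longleftrightarrow> (\<forall>x \<xi>. \<forall>t>0. (x, \<xi>) \<in> V \<longrightarrow> (x, t *\<^sub>R \<xi>) \<in> V)"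

definition conically_compact_in :: "'n::finite cotangent set \<Rightarrow> 'n cotangent set \<Rightarrow> bool"
  where "conically_compact_in V U \<longleftrightarrow>
    (\<exists>K. compact K \<and> K \<subseteq> U \<and> V \<subseteq> {(x, t *\<^sub>R \<xi>) |x \<xi> t. 0 < t \<and> (x, \<xi>) \<in> K})"

definition coordinates_on :: "(complex ^ 'n \<Rightarrow> complex ^ 'n) \<Rightarrow> (complex ^ 'n::finite) set \<Rightarrow> bool"
  where "coordinates_on c U \<longleftrightarrow>
    inj_on c U \<and> holo_on c U \<and> holo_on (inv_into U c) (c ` U)"

text \<open>The covector $\xi$ at $x$ has fiber coordinates $\zeta$ with respect to $z = c(x)$ iff
  $\sum_j \zeta_j\,dz_j = \sum_i \xi_i\,dx_i$, i.e. $\xi = {}^t[\partial z/\partial x]\,\zeta$.\<close>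

definition in_coordinates ::
    "(complex ^ 'n \<Rightarrow> complex ^ 'n) \<Rightarrow> (complex ^ 'n) set \<Rightarrow> 'n::finite cotangent set \<Rightarrow> 'n cotangent set"
  where "in_coordinates c U V =
    {(c x, \<zeta>) |x \<zeta>. x \<in> U \<and> (x, transpose (jacobian c (at x)) *v \<zeta>) \<in> V}"


section \<open>Classical formal symbols with apparent parameter\<close>

definition maxnorm :: "complex ^ 'n::finite \<Rightarrow> real"
  where "maxnorm z = Max (range (\<lambda>i. cmod (z $ i)))"

definition fatten :: "real \<Rightarrow> 'n::finite cotangent set \<Rightarrow> 'n cotangent set"
  where "fatten \<rho> V = closure (\<Union>(z, \<zeta>)\<in>V.
    {(z + z', \<zeta> + \<zeta>') |z' \<zeta>'. maxnorm z' \<le> \<rho> \<and> maxnorm \<zeta>' \<le> \<rho> * maxnorm \<zeta>})"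

definition truncated :: "'n::finite cotangent set \<Rightarrow> real \<Rightarrow> 'n cotangent set"
  where "truncated V d = {(z, \<zeta>). (z, \<zeta>) \<in> V \<and> d \<le> maxnorm \<zeta>}"

definition symbol_domain :: "'n::finite cotangent set \<Rightarrow> real \<Rightarrow> real \<Rightarrow> 'n cotangent set"
  where "symbol_domain V d \<rho> = truncated (fatten \<rho> V) (d * (1 - \<rho>))"

definition sector :: "real \<Rightarrow> real \<Rightarrow> complex set"
  where "sector r \<theta> = {\<eta>. 0 < cmod \<eta> \<and> cmod \<eta> < r \<and> \<bar>Arg \<eta>\<bar> < \<theta> / 4}"

definition relatively_compact_in :: "complex set \<Rightarrow> complex set \<Rightarrow> bool"
  where "relatively_compact_in Z S \<longleftrightarrow> compact (closure Z) \<and> closure Z \<subseteq> S"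

text \<open>\<open>P \<nu> z \<zeta> \<eta>\<close> is the coefficient $P_\nu(z,\zeta,\eta)$ of $t^\nu$. The coefficients are total
  functions; only their values near \<open>symbol_domain V d \<rho> \<times> S\<close>, for some \<open>d\<close> and \<open>\<rho>\<close>, matter.\<close>

type_synonym 'n formal_symbol =
  "nat \<Rightarrow> complex ^ 'n \<Rightarrow> complex ^ 'n \<Rightarrow> complex \<Rightarrow> complex"

definition coefficients_holo ::
    "'n::finite cotangent set \<Rightarrow> complex set \<Rightarrow> real \<Rightarrow> real \<Rightarrow> 'n formal_symbol \<Rightarrow> bool"
  where "coefficients_holo V S d \<rho> P \<longleftrightarrow>
    (\<forall>\<nu>. holo_near (\<lambda>((z, \<zeta>), \<eta>). P \<nu> z \<zeta> \<eta>) (symbol_domain V d \<rho> \<times> S))"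

definition N_cl :: "'n::finite cotangent set \<Rightarrow> complex set \<Rightarrow> 'n formal_symbol set"
  where "N_cl V S = {P. \<exists>d>0. \<exists>\<rho>\<in>{0<..<1}. coefficients_holo V S d \<rho> P \<and>
    (\<exists>A>0. \<forall>Z h. relatively_compact_in Z S \<and> 0 < h \<longrightarrow>
      (\<exists>C>0. \<forall>m. \<forall>(z, \<zeta>) \<in> symbol_domain V d \<rho>. \<forall>\<eta>\<in>Z.
        cmod (\<Sum>\<nu><m. P \<nu> z \<zeta> \<eta>)
          \<le> C * fact m * A ^ m * exp (h * maxnorm \<zeta>) / maxnorm (\<eta> *s \<zeta>) ^ m))}"

definition S_cl :: "'n::finite cotangent set \<Rightarrow> complex set \<Rightarrow> 'n formal_symbol set"
  where "S_cl V S = {P. (\<exists>d>0. \<exists>\<rho>\<in>{0<..<1}. coefficients_holo V S d \<rho> P \<and>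
    (\<exists>A>0. \<forall>Z h. relatively_compact_in Z S \<and> 0 < h \<longrightarrow>
      (\<exists>C>0. \<forall>\<nu>. \<forall>(z, \<zeta>) \<in> symbol_domain V d \<rho>. \<forall>\<eta>\<in>Z.
        cmod (P \<nu> z \<zeta> \<eta>)
          \<le> C * fact \<nu> * A ^ \<nu> * exp (h * maxnorm \<zeta>) / maxnorm (\<eta> *s \<zeta>) ^ \<nu>))) \<and>
    (\<lambda>\<nu> z \<zeta>. deriv (P \<nu> z \<zeta>)) \<in> N_cl V S}"

text \<open>Equality of formal symbols. An element of \<open>S_cl V S\<close> lives on \<open>symbol_domain V d \<rho> \<times> S\<close>
  for some \<open>d\<close> and \<open>\<rho>\<close>; these domains shrink as \<open>d\<close> grows and \<open>\<rho>\<close> decreases, and an element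
  is identified with its restrictions.\<close>

definition symbol_eq ::
    "'n::finite cotangent set \<Rightarrow> complex set \<Rightarrow> 'n formal_symbol \<Rightarrow> 'n formal_symbol \<Rightarrow> bool"
  where "symbol_eq V S P Q \<longleftrightarrow> (\<exists>d>0. \<exists>\<rho>\<in>{0<..<1}.
    \<forall>\<nu>. \<forall>(z, \<zeta>) \<in> symbol_domain V d \<rho>. \<forall>\<eta>\<in>S. P \<nu> z \<zeta> \<eta> = Q \<nu> z \<zeta> \<eta>)"


section \<open>Coordinate transformation of symbols\<close>

text \<open>\<open>J\<close> is a choice of the matrix $J^*_\Phi(z',z)$ for the coordinate transformation
  $\Phi$ defined on \<open>D\<close>. For $n \ge 2$ the defining relation does not determine it.\<close>

definition is_Jstar ::
    "(complex ^ 'n \<Rightarrow> complex ^ 'n) \<Rightarrow> (complex ^ 'n) set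
      \<Rightarrow> (complex ^ 'n \<Rightarrow> complex ^ 'n \<Rightarrow> complex ^ 'n ^ 'n::finite) \<Rightarrow> bool"
  where "is_Jstar \<Phi> D J \<longleftrightarrow> (\<exists>N \<subseteq> \<Phi> ` D \<times> \<Phi> ` D.
    (\<forall>z \<in> \<Phi> ` D. (z, z) \<in> N) \<and> holo_on (\<lambda>(z', z). J z' z) N \<and>
    (\<forall>(z', z) \<in> N. inv_into D \<Phi> z' - inv_into D \<Phi> z = J z' z *v (z' - z)))"

definition pullback ::
    "(complex ^ 'n \<Rightarrow> complex ^ 'n) \<Rightarrow> (complex ^ 'n \<Rightarrow> complex ^ 'n \<Rightarrow> complex ^ 'n ^ 'n)
      \<Rightarrow> 'n::finite formal_symbol \<Rightarrow> 'n formal_symbol"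
  where "pullback \<Phi> J P \<nu> w lam \<eta> =
    (\<Sum>(k, \<alpha>) \<in> {(k, \<alpha> :: 'n \<Rightarrow> nat). k + (\<Sum>i\<in>UNIV. \<alpha> i) = \<nu>}.
      1 / (\<Prod>i\<in>UNIV. fact (\<alpha> i)) *
      multi_deriv \<alpha> (\<lambda>\<zeta>'. multi_deriv \<alpha>
        (\<lambda>z'. P k (\<Phi> w) (\<zeta>' + transpose (J (\<Phi> w + z') (\<Phi> w)) *v lam) \<eta>) 0) 0)"

lemma finite_pullback_indices:
  "finite {(k, \<alpha> :: 'n::finite \<Rightarrow> nat). k + (\<Sum>i\<in>UNIV. \<alpha> i) = \<nu>}"
proof (rule finite_subset)
  show "{(k, \<alpha> :: 'n \<Rightarrow> nat). k + (\<Sum>i\<in>UNIV. \<alpha> i) = \<nu>} \<subseteq> {..\<nu>} \<times> (UNIV \<rightarrow>\<^sub>E {..\<nu>})"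
    by (auto simp: PiE_def extensional_def member_le_sum intro: trans_le_add2)
  show "finite ({..\<nu>} \<times> ((UNIV :: 'n set) \<rightarrow>\<^sub>E {..\<nu>}))"
    by (intro finite_cartesian_product finite_PiE) auto
qed

end

theory Submission
  imports Defs "HOL-Complex_Analysis.Cauchy_Integral_Formula"
begin

text \<open>
  Fix a point \<open>w\<close>, put \<open>z = \<Phi> w\<close>, and write \<open>M z' = J (z + z') z\<close> for the matrix valued germ at
  \<open>z' = 0\<close>. Sorted by powers of \<open>t\<close>, the pullback is \<open>(\<Phi>\<^sup>*P)\<^sub>\<nu> = \<Sum>k\<le>\<nu>. T\<^sub>M\<^bsup>\<nu>-k\<^esup> P\<^sub>k\<close>, where
  \<open>T\<^sub>M\<^bsup>m\<^esup> p (\<lambda>) = \<Sum>\<bar>\<alpha>\<bar>=m. 1/\<alpha>! \<partial>\<^sub>\<zeta>\<^bsup>\<alpha>\<^esup> \<partial>\<^sub>z\<^bsup>\<alpha>\<^esup> p (\<zeta> + M(z)\<^sup>t \<lambda>)\<close> at \<open>z = \<zeta> = 0\<close> acts in the fibre variable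
  only (\<open>transform\<close>).

  Estimates. Let \<open>(w, \<lambda>)\<close> run through a slightly smaller symbol domain. A single compactness argument
  on the set of pairs \<open>(w, \<lambda>)\<close> with \<open>\<bar>\<lambda>\<bar> = 1\<close>, extended by homogeneity, shows that the substituted
  covector stays in the given domain for \<open>\<bar>z'\<bar> \<le> \<delta>\<close> and \<open>\<bar>\<zeta>'\<bar> \<le> \<delta> \<bar>\<lambda>\<bar>\<close> and has length comparable to
  \<open>\<bar>\<lambda>\<bar>\<close> (\<open>compact_control\<close>, \<open>symbol_control\<close>). The Cauchy estimate then costs
  \<open>\<alpha>! / (\<delta>\<^sup>2 \<bar>\<lambda>\<bar>)\<^bsup>\<bar>\<alpha>\<bar>\<^esup>\<close> for each \<open>\<alpha>\<close>, which is of the type allowed by the symbol classes because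
  \<open>\<alpha>! k! \<le> \<nu>!\<close> and \<open>\<bar>\<eta>\<bar> \<le> 1\<close> (\<open>pullback_bound\<close>). The null class is defined by partial sums, and the
  pullback commutes with them (\<open>pullback_partial_sums\<close>), so it is covered by the same bound; the
  condition on the derivative in \<open>\<eta>\<close> follows since that derivative commutes with the pullback
  (\<open>pullback_deriv\<close>).

  Functoriality. On an exponential \<open>p \<zeta> = exp \<langle>a, \<zeta>\<rangle>\<close> the operator is explicit: \<open>T\<^sub>M\<^bsup>m\<^esup> p (\<lambda>)\<close> is the
  coefficient of \<open>s\<^bsup>m\<^esup>\<close> in \<open>exp \<langle>M(s a) a, \<lambda>\<rangle>\<close> (\<open>transform_exp\<close>), and it depends on \<open>M\<close> only through
  \<open>x \<mapsto> M(x) x\<close>. For the matrices of two coordinate changes and of their composite,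
  \<open>K (J(x) x) (J(x) x) = L(x) x\<close>, since both sides are differences of the coordinates \<open>v\<close>; hence
  \<open>\<Sum>j\<le>m. T\<^sub>K\<^bsup>m-j\<^esup> T\<^sub>J\<^bsup>j\<^esup> = T\<^sub>L\<^bsup>m\<^esup>\<close> on exponentials. Both sides are differential operators of finite order,
  so at a given point they depend on a finite jet of \<open>p\<close>, and every finite jet is that of a linear
  combination of exponentials (\<open>jet_principle\<close>). This gives \<open>transform_compose\<close>, and from it, with
  \<open>K = L = 1\<close>, the statement about the identity transformation for every admissible choice of the
  matrix.

  The facts needed about holomorphic functions of several variables are reduced to one variable:
  a locally bounded function that is holomorphic on complex lines is holomorphic, its directional
  derivatives are again of this kind, and they commute.
\<close>

section \<open>Holomorphy along complex lines\<close>

text \<open>Complex scalar multiplication on \<open>cvector\<close> is only tied to the real structure. Compatibility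
  with the norm makes it a bounded bilinear map; complex numbers, vectors and pairs have it.\<close>

class cnormed = cvector +
  assumes norm_scaleC: "norm (c *\<^sub>C x) = cmod c * norm x"

instance complex :: cnormed
  by standard (simp add: scaleC_complex_def norm_mult)

instance vec :: (cnormed, finite) cnormed
proof
  fix c :: complex and x :: "'a ^ 'b"
  have "norm (c *\<^sub>C x) = L2_set (\<lambda>i. cmod c * norm (x $ i)) UNIV"
    by (simp add: norm_vec_def scaleC_vec_def norm_scaleC)
  also have "\<dots> = cmod c * norm x"
    by (simp add: norm_vec_def L2_set_right_distrib)
  finally show "norm (c *\<^sub>C x) = cmod c * norm x" .
qed

instance prod :: (cnormed, cnormed) cnormed
proof
  fix c :: complex and x :: "'a \<times> 'b"
  have "(cmod c * norm (fst x))\<^sup>2 + (cmod c * norm (snd x))\<^sup>2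
      = (cmod c)\<^sup>2 * ((norm (fst x))\<^sup>2 + (norm (snd x))\<^sup>2)"
    by (simp add: power_mult_distrib algebra_simps)
  then show "norm (c *\<^sub>C x) = cmod c * norm x"
    by (simp add: norm_prod_def scaleC_prod_def norm_scaleC real_sqrt_mult)
qed

lemma bounded_bilinear_scaleC: "bounded_bilinear (\<lambda>c (x::'a::cnormed). c *\<^sub>C x)"
proof
  fix a b c :: complex and x y :: 'a and r :: real
  show "(a + b) *\<^sub>C x = a *\<^sub>C x + b *\<^sub>C x" by (rule scaleC_add_left)
  show "a *\<^sub>C (x + y) = a *\<^sub>C x + a *\<^sub>C y" by (rule scaleC_add_right)
  show "(r *\<^sub>R a) *\<^sub>C x = r *\<^sub>R a *\<^sub>C x"
    by (simp add: scaleC_of_real [symmetric] scaleC_scaleC scaleR_conv_of_real scaleC_complex_def)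
  show "a *\<^sub>C r *\<^sub>R x = r *\<^sub>R a *\<^sub>C x"
    by (simp add: scaleC_of_real [symmetric] scaleC_scaleC scaleR_conv_of_real mult.commute)
  show "\<exists>K. \<forall>a b. norm (a *\<^sub>C b :: 'a) \<le> norm a * norm b * K"
    by (rule exI [of _ 1]) (simp add: norm_scaleC)
qed

interpretation scaleC: bounded_bilinear "\<lambda>c (x::'a::cnormed). c *\<^sub>C x"
  by (rule bounded_bilinear_scaleC)

declare scaleC.zero_left [simp] scaleC.zero_right [simp]

lemma scaleC_one [simp]: "1 *\<^sub>C (x::'a::cvector) = x"
  using scaleC_of_real [of 1 x] by simp

lemma axis_scaleC: "axis i s = s *\<^sub>C axis i (1::complex)"
  by (simp add: vec_eq_iff axis_def scaleC_vec_def scaleC_complex_def)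

lemma Pair_scaleC: "c *\<^sub>C (x, y) = (c *\<^sub>C x, c *\<^sub>C y)"
  by (simp add: scaleC_prod_def)

lemma scaleC_vec_nth [simp]: "(c *\<^sub>C x) $ i = c *\<^sub>C (x $ i)"
  by (simp add: scaleC_vec_def)

lemma scaleC_complex [simp]: "c *\<^sub>C x = c * (x::complex)"
  by (simp add: scaleC_complex_def)

text \<open>One complex variable: the Taylor remainder, with a constant depending only on the sup norm. This
  uniformity is what the several-variable arguments below use.\<close>

lemma taylor_remainder_bound:
  assumes hol: "\<phi> holomorphic_on ball 0 R" and R: "0 < R"
    and M: "\<And>s. s \<in> ball 0 R \<Longrightarrow> cmod (\<phi> s) \<le> M" and s: "cmod s \<le> R / 4"
  shows "cmod (\<phi> s - (\<Sum>k<N. (deriv ^^ k) \<phi> 0 / fact k * s ^ k)) \<le> 2 * M * (2 * cmod s / R) ^ N"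
proof -
  define c where "c k = (deriv ^^ k) \<phi> 0 / fact k" for k
  define q where "q = 2 * cmod s / R"
  have q: "0 \<le> q" "q \<le> 1/2" using s R by (auto simp: q_def field_simps)
  have M0: "0 \<le> M" using M [of 0] R by (meson centre_in_ball norm_ge_zero order_trans)
  have cb: "cmod (c k) \<le> M / (R/2)^k" for k
  proof -
    have "cmod ((deriv ^^ k) \<phi> 0) \<le> fact k * M / (R/2)^k"
    proof (rule Cauchy_inequality)
      show "\<phi> holomorphic_on ball 0 (R/2)"
        using hol by (rule holomorphic_on_subset) (use R in auto)
      show "continuous_on (cball 0 (R/2)) \<phi>"
        using holomorphic_on_imp_continuous_on [OF hol] by (rule continuous_on_subset) (use R in auto)
    qed (use R M in auto)
    then have "cmod ((deriv ^^ k) \<phi> 0) / fact k \<le> (fact k * M / (R/2)^k) / fact k"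
      by (rule divide_right_mono) simp
    then show ?thesis by (simp add: c_def norm_divide)
  qed
  have tb: "cmod (c k * s ^ k) \<le> M * q ^ k" for k
  proof -
    have "cmod (c k * s ^ k) \<le> M / (R/2)^k * cmod s ^ k"
      using mult_right_mono [OF cb, of "cmod s ^ k"] by (simp add: norm_mult norm_power)
    also have "\<dots> = M * q ^ k" by (simp add: q_def power_divide power_mult_distrib)
    finally show ?thesis .
  qed
  have sums: "(\<lambda>k. c k * s ^ k) sums \<phi> s"
    using holomorphic_power_series [OF hol, of s] s R by (simp add: c_def)
  then have tail: "(\<lambda>k. c (k + N) * s ^ (k + N)) sums (\<phi> s - (\<Sum>k<N. c k * s ^ k))"
    by (subst sums_iff_shift) simp
  have geo: "(\<lambda>k. M * q ^ N * q ^ k) sums (M * q ^ N * (1 / (1 - q)))"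
    by (intro sums_mult geometric_sums) (use q in auto)
  have "cmod (\<phi> s - (\<Sum>k<N. c k * s ^ k)) \<le> M * q ^ N * (1 / (1 - q))"
  proof (rule norm_sums_le [OF tail geo])
    show "norm (c (n + N) * s ^ (n + N)) \<le> M * q ^ N * q ^ n" for n
      using tb [of "n + N"] by (simp add: power_add mult_ac)
  qed
  also have "\<dots> \<le> M * q ^ N * 2"
    using q M0 by (intro mult_left_mono) (auto simp: field_simps)
  finally show ?thesis by (simp add: c_def q_def mult_ac)
qed

lemma cauchy_bound:
  assumes hol: "\<phi> holomorphic_on S" and S: "open S" "cball 0 R \<subseteq> S" and R: "0 < R"
    and M: "\<And>s. cmod s \<le> R \<Longrightarrow> cmod (\<phi> s) \<le> M"
  shows "cmod ((deriv ^^ k) \<phi> 0) \<le> fact k * M / R ^ k"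
proof (rule Cauchy_inequality)
  show "\<phi> holomorphic_on ball 0 R"
    using hol by (rule holomorphic_on_subset) (use S ball_subset_cball in blast)
  show "continuous_on (cball 0 R) \<phi>"
    using holomorphic_on_imp_continuous_on [OF hol] by (rule continuous_on_subset) (use S in auto)
qed (use R M in auto)

text \<open>The derivative in the complex direction \<open>v\<close>.\<close>

definition dir_deriv :: "'a::cvector \<Rightarrow> ('a \<Rightarrow> complex) \<Rightarrow> 'a \<Rightarrow> complex"
  where "dir_deriv v f x = deriv (\<lambda>s. f (x + s *\<^sub>C v)) 0"

text \<open>Locally bounded functions whose restrictions to complex lines are holomorphic. By
  \<open>line_holo_iff_holo\<close> these are the holomorphic functions; the definition makes closure under
  directional derivatives accessible by arguments in one variable.\<close>

definition line_holo :: "('a::cnormed \<Rightarrow> complex) \<Rightarrow> 'a set \<Rightarrow> bool"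
  where "line_holo f W \<longleftrightarrow> open W \<and>
    (\<forall>x\<in>W. \<exists>e>0. \<exists>M. ball x e \<subseteq> W \<and> (\<forall>y\<in>ball x e. cmod (f y) \<le> M)) \<and>
    (\<forall>x\<in>W. \<forall>v. (\<lambda>s. f (x + s *\<^sub>C v)) field_differentiable at 0)"

lemma line_holo_open: "line_holo f W \<Longrightarrow> open W"
  by (simp add: line_holo_def)

lemma line_holo_bdd:
  assumes "line_holo f W" "x \<in> W"
  obtains e M where "e > 0" "ball x e \<subseteq> W" "\<And>y. y \<in> ball x e \<Longrightarrow> cmod (f y) \<le> M"
  using assms unfolding line_holo_def by metis

lemma open_line: "open W \<Longrightarrow> open {s. x + s *\<^sub>C (v::'a::cnormed) \<in> W}"
  by (rule open_vimage [of W "\<lambda>s. x + s *\<^sub>C v", unfolded vimage_def]) (auto intro!: continuous_intros scaleC.continuous_on)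

lemma line_holo_line:
  assumes "line_holo f W"
  shows "(\<lambda>s. f (x + s *\<^sub>C v)) holomorphic_on {s. x + s *\<^sub>C v \<in> W}"
proof -
  have "(\<lambda>s. f (x + s *\<^sub>C v)) field_differentiable at s" if "x + s *\<^sub>C v \<in> W" for s
  proof -
    have "(\<lambda>t. f ((x + s *\<^sub>C v) + t *\<^sub>C v)) field_differentiable at 0"
      using assms that by (auto simp: line_holo_def)
    then obtain D where "((\<lambda>t. f ((x + s *\<^sub>C v) + t *\<^sub>C v)) has_field_derivative D) (at 0)"
      by (auto simp: field_differentiable_def)
    then have "((\<lambda>t. f (x + (t + s) *\<^sub>C v)) has_field_derivative D) (at 0)"
      by (simp add: scaleC_add_left add_ac)
    then have "((\<lambda>t. f (x + t *\<^sub>C v)) has_field_derivative D) (at (0 + s))"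
      by (subst DERIV_shift) simp
    then show ?thesis by (auto simp: field_differentiable_def)
  qed
  then show ?thesis
    by (auto simp: holomorphic_on_def intro: field_differentiable_at_within)
qed

lemma ball_half_subset: "y \<in> ball x (e/2) \<Longrightarrow> ball y (e/2) \<subseteq> ball (x::'a::metric_space) e"
proof
  fix z assume "y \<in> ball x (e/2)" "z \<in> ball y (e/2)"
  then show "z \<in> ball x e" using dist_triangle [of x z y] by simp
qed

lemma line_in_ball:
  assumes "cmod s < e / (norm v + 1)"
  shows "y + s *\<^sub>C (v::'a::cnormed) \<in> ball y e"
proof -
  have "cmod s * (norm v + 1) < e" using assms by (simp add: pos_less_divide_eq add_nonneg_pos)
  moreover have "cmod s * norm v \<le> cmod s * (norm v + 1)" by (simp add: mult_left_mono)
  ultimately show ?thesis by (simp add: dist_norm norm_scaleC)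
qed

text \<open>The difference quotient converges to the directional derivative at a rate that depends only on
  a bound for \<open>f\<close> near \<open>y\<close>, hence locally uniformly in \<open>y\<close>.\<close>

lemma line_holo_quotient:
  assumes f: "line_holo f W" and b: "ball y e \<subseteq> W" "0 < e"
    and M: "\<And>z. z \<in> ball y e \<Longrightarrow> cmod (f z) \<le> M"
    and t: "cmod t \<le> e / (norm v + 1) / 4"
  shows "cmod (f (y + t *\<^sub>C v) - f y - t * dir_deriv v f y) \<le> 2 * M * (2 * cmod t / (e / (norm v + 1)))\<^sup>2"
proof -
  let ?R = "e / (norm v + 1)"
  have R: "0 < ?R" using b by (simp add: add_nonneg_pos)
  have hol: "(\<lambda>s. f (y + s *\<^sub>C v)) holomorphic_on ball 0 ?R"
    by (rule holomorphic_on_subset [OF line_holo_line [OF f]]) (use line_in_ball b in \<open>fastforce simp del: mem_ball\<close>)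
  have "cmod (f (y + t *\<^sub>C v) - (\<Sum>k<2. (deriv ^^ k) (\<lambda>s. f (y + s *\<^sub>C v)) 0 / fact k * t ^ k))
      \<le> 2 * M * (2 * cmod t / ?R)\<^sup>2"
    by (rule taylor_remainder_bound [OF hol R _ t]) (use line_in_ball M in \<open>fastforce simp del: mem_ball\<close>)
  moreover have "(\<Sum>k<2. (deriv ^^ k) (\<lambda>s. f (y + s *\<^sub>C v)) 0 / fact k * t ^ k) = f y + t * dir_deriv v f y"
    by (simp add: numeral_2_eq_2 dir_deriv_def mult.commute)
  ultimately show ?thesis by (simp add: algebra_simps)
qed

lemma line_holo_dir_deriv_bound:
  assumes f: "line_holo f W" and b: "ball y e \<subseteq> W" "0 < e"
    and M: "\<And>z. z \<in> ball y e \<Longrightarrow> cmod (f z) \<le> M" and h: "norm h \<le> e / 2"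
  shows "cmod (dir_deriv h f y) \<le> M * (2 * norm h / e)"
proof (cases "h = 0")
  case True
  then show ?thesis by (simp add: dir_deriv_def)
next
  case False
  define R where "R = e / (2 * norm h)"
  have R: "0 < R" using False b by (simp add: R_def)
  have inb: "y + s *\<^sub>C h \<in> ball y e" if "cmod s \<le> R" for s
  proof -
    have "cmod s * norm h \<le> R * norm h" using that by (simp add: mult_right_mono)
    also have "\<dots> = e / 2" using False by (simp add: R_def)
    finally show ?thesis using b by (simp add: dist_norm norm_scaleC)
  qed
  have "cmod ((deriv ^^ 1) (\<lambda>s. f (y + s *\<^sub>C h)) 0) \<le> fact 1 * M / R ^ 1"
    by (rule cauchy_bound [OF line_holo_line [OF f] open_line [OF line_holo_open [OF f]]])
      (use inb b M R in auto)
  then show ?thesis by (simp add: dir_deriv_def R_def)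
qed

text \<open>A directional derivative is a locally uniform limit of the holomorphic difference quotients in
  direction \<open>v\<close>. Differentiating the quotients in direction \<open>u\<close> therefore commutes with the
  limit, which yields the symmetry of mixed derivatives.\<close>

lemma line_holo_dir_deriv_line:
  assumes f: "line_holo f W" and x: "x \<in> W"
  shows line_holo_dir_deriv_differentiable: "(\<lambda>s. dir_deriv v f (x + s *\<^sub>C u)) field_differentiable at 0"
    and line_holo_dir_deriv_quotient:
      "((\<lambda>t. (dir_deriv u f (x + t *\<^sub>C v) - dir_deriv u f x) / t) \<longlongrightarrow> dir_deriv u (dir_deriv v f) x) (at 0)"
proof -
  obtain e M where e: "e > 0" "ball x e \<subseteq> W" and M: "\<And>y. y \<in> ball x e \<Longrightarrow> cmod (f y) \<le> M"
    using line_holo_bdd [OF f x] by metis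
  define r where "r = e / 4 / (norm u + 1)"
  define R where "R = e / 2 / (norm v + 1)"
  define q where "q t s = (f ((x + s *\<^sub>C u) + t *\<^sub>C v) - f (x + s *\<^sub>C u)) / t" for t s
  have pos: "0 < r" "0 < R" using e by (auto simp: r_def R_def add_nonneg_pos)
  have M0: "0 \<le> M" using M [of x] e by (meson centre_in_ball norm_ge_zero order_trans)
  have y: "ball (x + s *\<^sub>C u) (e/2) \<subseteq> ball x e" if "cmod s \<le> r" for s
  proof -
    have "cmod s < (e/2) / (norm u + 1)"
      using that e unfolding r_def
      by (elim le_less_trans) (intro divide_strict_right_mono add_nonneg_pos, auto)
    then have "x + s *\<^sub>C u \<in> ball x (e/2)" by (rule line_in_ball)
    then show ?thesis by (rule ball_half_subset)
  qed
  \<comment> \<open>The bound does not depend on \<open>s\<close>, which gives uniform convergence of the quotients.\<close>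
  have qb: "cmod (q t s - dir_deriv v f (x + s *\<^sub>C u)) \<le> cmod t * (8 * M / R\<^sup>2)"
    if "cmod s \<le> r" "t \<noteq> 0" "cmod t \<le> R / 4" for s t
  proof -
    have "cmod (f ((x + s *\<^sub>C u) + t *\<^sub>C v) - f (x + s *\<^sub>C u) - t * dir_deriv v f (x + s *\<^sub>C u))
        \<le> 2 * M * (2 * cmod t / R)\<^sup>2"
      unfolding R_def
      by (rule line_holo_quotient [OF f]) (use y [OF that(1)] e M that in \<open>auto simp: R_def\<close>)
    moreover have "t * q t s = f ((x + s *\<^sub>C u) + t *\<^sub>C v) - f (x + s *\<^sub>C u)"
      using that(2) by (simp add: q_def)
    ultimately have "cmod (t * (q t s - dir_deriv v f (x + s *\<^sub>C u))) \<le> 2 * M * (2 * cmod t / R)\<^sup>2"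
      by (simp add: right_diff_distrib)
    also have "\<dots> = cmod t * (cmod t * (8 * M / R\<^sup>2))"
      by (simp add: power2_eq_square)
    finally have "cmod t * cmod (q t s - dir_deriv v f (x + s *\<^sub>C u)) \<le> cmod t * (cmod t * (8 * M / R\<^sup>2))"
      by (simp only: norm_mult)
    then show ?thesis by (rule mult_left_le_imp_le) (use that(2) in simp)
  qed
  have ul: "uniform_limit (cball 0 r) q (\<lambda>s. dir_deriv v f (x + s *\<^sub>C u)) (at 0)"
  proof (rule uniform_limitI)
    fix \<epsilon> :: real assume \<epsilon>: "0 < \<epsilon>"
    define K where "K = 8 * M / R\<^sup>2 + 1"
    have K: "K > 0" using M0 pos by (simp add: K_def add_nonneg_pos)
    show "\<forall>\<^sub>F t in at 0. \<forall>s\<in>cball 0 r. dist (q t s) (dir_deriv v f (x + s *\<^sub>C u)) < \<epsilon>"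
      unfolding eventually_at
    proof (intro exI [of _ "min (R/4) (\<epsilon> / K)"] conjI ballI impI)
      fix t s :: complex
      assume t: "t \<noteq> 0 \<and> dist t 0 < min (R/4) (\<epsilon> / K)" and s: "s \<in> cball 0 r"
      have "cmod (q t s - dir_deriv v f (x + s *\<^sub>C u)) \<le> cmod t * (8 * M / R\<^sup>2)"
        using t s by (intro qb) auto
      also have "\<dots> \<le> cmod t * K" by (intro mult_left_mono) (auto simp: K_def)
      also have "\<dots> < \<epsilon>" using t K by (simp add: field_simps)
      finally show "dist (q t s) (dir_deriv v f (x + s *\<^sub>C u)) < \<epsilon>" by (simp add: dist_norm)
    qed (use pos \<epsilon> K in auto)
  qed
  have inW: "(x + s *\<^sub>C u) + t *\<^sub>C v \<in> W" if "cmod s \<le> r" "cmod t < R" for s t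
    using line_in_ball [of t "e/2" v "x + s *\<^sub>C u"] y [OF that(1)] that(2) e by (auto simp: R_def)
  have qholW: "q t holomorphic_on {s. (x + t *\<^sub>C v) + s *\<^sub>C u \<in> W} \<inter> {s. x + s *\<^sub>C u \<in> W}" for t
  proof -
    have "(\<lambda>s. f ((x + t *\<^sub>C v) + s *\<^sub>C u) / t - f (x + s *\<^sub>C u) / t) holomorphic_on
        {s. (x + t *\<^sub>C v) + s *\<^sub>C u \<in> W} \<inter> {s. x + s *\<^sub>C u \<in> W}"
      by (cases "t = 0"; intro holomorphic_intros holomorphic_on_subset [OF line_holo_line [OF f]]) auto
    then show ?thesis by (simp add: q_def [abs_def] diff_divide_distrib add_ac)
  qed
  have qhol: "q t holomorphic_on cball 0 r" if "cmod t < R" for t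
    by (rule holomorphic_on_subset [OF qholW]) (use inW [OF _ that] inW [of _ 0] pos in \<open>auto simp: add_ac\<close>)
  have evR: "\<forall>\<^sub>F t in at 0. cmod t < R"
    using pos by (auto simp: eventually_at intro: exI [of _ R])
  have hol: "(\<lambda>s. dir_deriv v f (x + s *\<^sub>C u)) holomorphic_on ball 0 r"
  proof (rule holomorphic_uniform_limit [OF _ ul])
    show "\<forall>\<^sub>F t in at 0. continuous_on (cball 0 r) (q t) \<and> q t holomorphic_on ball 0 r"
      using evR by eventually_elim
        (use qhol holomorphic_on_imp_continuous_on holomorphic_on_subset ball_subset_cball in blast)
  qed auto
  then show "(\<lambda>s. dir_deriv v f (x + s *\<^sub>C u)) field_differentiable at 0"
    by (rule holomorphic_on_imp_differentiable_at) (use pos in auto)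
  have "((\<lambda>t. (deriv ^^ 1) (q t) 0) \<longlongrightarrow> (deriv ^^ 1) (\<lambda>s. dir_deriv v f (x + s *\<^sub>C u)) 0) (at 0)"
  proof (rule higher_deriv_complex_uniform_limit)
    show "uniform_limit (ball 0 r) q (\<lambda>s. dir_deriv v f (x + s *\<^sub>C u)) (at 0)"
      using ul by (rule uniform_limit_on_subset) auto
    show "\<forall>\<^sub>F t in at 0. q t holomorphic_on ball 0 r"
      using evR by eventually_elim (use qhol holomorphic_on_subset ball_subset_cball in blast)
  qed (use pos in auto)
  then have "((\<lambda>t. deriv (q t) 0) \<longlongrightarrow> dir_deriv u (dir_deriv v f) x) (at 0)"
    by (simp add: dir_deriv_def)
  moreover have "\<forall>\<^sub>F t in at 0. deriv (q t) 0 = (dir_deriv u f (x + t *\<^sub>C v) - dir_deriv u f x) / t"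
    using evR
  proof eventually_elim
    case (elim t)
    have d: "(\<lambda>s. f (z + s *\<^sub>C u)) field_differentiable at 0" if "z \<in> W" for z
      using f that by (auto simp: line_holo_def)
    have 1: "((\<lambda>s. f ((x + t *\<^sub>C v) + s *\<^sub>C u)) has_field_derivative dir_deriv u f (x + t *\<^sub>C v)) (at 0)"
      unfolding dir_deriv_def using d [of "x + t *\<^sub>C v"] inW [of 0 t] elim pos
      by (auto simp: DERIV_deriv_iff_field_differentiable)
    have 2: "((\<lambda>s. f (x + s *\<^sub>C u)) has_field_derivative dir_deriv u f x) (at 0)"
      unfolding dir_deriv_def using d [OF x] by (auto simp: DERIV_deriv_iff_field_differentiable)
    have "(q t has_field_derivative (dir_deriv u f (x + t *\<^sub>C v) - dir_deriv u f x) / t) (at 0)"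
      using DERIV_cdivide [OF DERIV_diff [OF 1 2], of t] by (simp add: q_def [abs_def] add_ac)
    then show ?case by (rule DERIV_imp_deriv)
  qed
  ultimately show "((\<lambda>t. (dir_deriv u f (x + t *\<^sub>C v) - dir_deriv u f x) / t) \<longlongrightarrow> dir_deriv u (dir_deriv v f) x) (at 0)"
    using tendsto_cong by force
qed

lemma line_holo_dir_deriv:
  assumes f: "line_holo f W"
  shows "line_holo (dir_deriv v f) W"
  unfolding line_holo_def
proof (intro conjI ballI allI)
  show "open W" using f by (rule line_holo_open)
next
  fix x assume x: "x \<in> W"
  obtain e M where e: "e > 0" "ball x e \<subseteq> W" and M: "\<And>y. y \<in> ball x e \<Longrightarrow> cmod (f y) \<le> M"
    using line_holo_bdd [OF f x] by metis
  let ?R = "e / 4 / (norm v + 1)"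
  have R: "0 < ?R" using e by (simp add: add_nonneg_pos)
  have "cmod (dir_deriv v f y) \<le> M / ?R" if y: "y \<in> ball x (e/2)" for y
  proof -
    have *: "y + s *\<^sub>C v \<in> ball x e" if "cmod s \<le> ?R" for s
    proof -
      have "cmod s < (e/2) / (norm v + 1)"
        using that e
        by (elim le_less_trans) (intro divide_strict_right_mono add_nonneg_pos, auto)
      then have "y + s *\<^sub>C v \<in> ball y (e/2)" by (rule line_in_ball)
      then show ?thesis using ball_half_subset [OF y] by blast
    qed
    have "cmod ((deriv ^^ 1) (\<lambda>s. f (y + s *\<^sub>C v)) 0) \<le> fact 1 * M / ?R ^ 1"
      by (rule cauchy_bound [OF line_holo_line [OF f] open_line [OF line_holo_open [OF f]]])
        (use * e M R in auto)
    then show ?thesis by (simp add: dir_deriv_def)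
  qed
  moreover have "ball x (e/2) \<subseteq> W" using ball_half_subset [of x x e] e by auto
  ultimately show "\<exists>e>0. \<exists>M. ball x e \<subseteq> W \<and> (\<forall>y\<in>ball x e. cmod (dir_deriv v f y) \<le> M)"
    using e by (intro exI [of _ "e/2"] conjI exI [of _ "M / ?R"]) auto
next
  fix x u assume "x \<in> W"
  then show "(\<lambda>s. dir_deriv v f (x + s *\<^sub>C u)) field_differentiable at 0"
    by (rule line_holo_dir_deriv_differentiable [OF f])
qed

lemma line_holo_dir_deriv_commute:
  assumes f: "line_holo f W" and x: "x \<in> W"
  shows "dir_deriv u (dir_deriv v f) x = dir_deriv v (dir_deriv u f) x"
proof -
  have "((\<lambda>s. dir_deriv u f (x + s *\<^sub>C v)) has_field_derivative dir_deriv v (dir_deriv u f) x) (at 0)"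
    using line_holo_dir_deriv_differentiable [OF f x, of u v]
    by (simp add: DERIV_deriv_iff_field_differentiable dir_deriv_def [of v "dir_deriv u f"])
  then have "((\<lambda>t. (dir_deriv u f (x + t *\<^sub>C v) - dir_deriv u f x) / t) \<longlongrightarrow> dir_deriv v (dir_deriv u f) x) (at 0)"
    by (simp add: DERIV_def)
  with line_holo_dir_deriv_quotient [OF f x, of u v] show ?thesis
    by (rule tendsto_unique [OF at_neq_bot])
qed

lemma line_holo_dir_deriv_scaleC:
  assumes f: "line_holo f W" and x: "x \<in> W"
  shows "dir_deriv (c *\<^sub>C v) f x = c * dir_deriv v f x"
proof -
  have "(\<lambda>s. f (x + s *\<^sub>C v)) field_differentiable at 0"
    using f x by (auto simp: line_holo_def)
  then have "((\<lambda>s. f (x + s *\<^sub>C v)) has_field_derivative dir_deriv v f x) (at (c * 0))"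
    by (simp add: DERIV_deriv_iff_field_differentiable dir_deriv_def)
  moreover have "((\<lambda>s. c * s) has_field_derivative c) (at 0)"
    by (auto intro!: derivative_eq_intros)
  ultimately have "((\<lambda>s. f (x + (c * s) *\<^sub>C v)) has_field_derivative dir_deriv v f x * c) (at 0)"
    by (rule DERIV_chain2 [where f = "\<lambda>s. f (x + s *\<^sub>C v)" and g = "\<lambda>s. c * s"])
  then have "((\<lambda>s. f (x + s *\<^sub>C c *\<^sub>C v)) has_field_derivative dir_deriv v f x * c) (at 0)"
    by (simp add: scaleC_scaleC mult.commute)
  then show ?thesis by (simp add: dir_deriv_def DERIV_imp_deriv)
qed

text \<open>Additivity in the direction: compare \<open>f (x + t (u + v))\<close> with the path through \<open>x + t u\<close>, all errors
  being of second order in \<open>t\<close>.\<close>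

lemma line_holo_dir_deriv_add:
  assumes f: "line_holo f W" and x: "x \<in> W"
  shows "dir_deriv (u + v) f x = dir_deriv u f x + dir_deriv v f x"
proof -
  have b: "line_holo (\<lambda>y. dir_deriv v f y) W" by (rule line_holo_dir_deriv [OF f])
  obtain e M where e: "e > 0" "ball x e \<subseteq> W" and M: "\<And>y. y \<in> ball x e \<Longrightarrow> cmod (f y) \<le> M"
    using line_holo_bdd [OF f x] by metis
  define r where "r = e / 4 / (norm u + norm v + 1)"
  have r0: "0 < r" using e by (simp add: r_def add_nonneg_pos)
  have le: "e/4 / (norm u + norm v + 1) \<le> e / 2 / (norm w + 1) / 2" if "norm w \<le> norm u + norm v" for w :: 'a
    using e that by (simp add: frac_le add_nonneg_pos)
  define K where "K w = 2 * M * (2 / (e / 2 / (norm w + 1)))\<^sup>2" for w :: 'a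
  have quad: "cmod (f (y + t *\<^sub>C w) - f y - t * dir_deriv w f y) \<le> K w * (cmod t)\<^sup>2"
    if w: "norm w \<le> norm u + norm v" and t: "cmod t \<le> r/2" and y: "y \<in> ball x (e/2)" for w t y
  proof -
    have "ball y (e/2) \<subseteq> ball x e"
      using y by (rule ball_half_subset)
    moreover have "cmod t \<le> e / 2 / (norm w + 1) / 4"
    proof -
      have "cmod t \<le> r / 2" by (rule t)
      also have "\<dots> \<le> (e / 2 / (norm w + 1) / 2) / 2"
        using le [OF w, folded r_def] by (rule divide_right_mono) simp
      finally show ?thesis by simp
    qed
    ultimately have "cmod (f (y + t *\<^sub>C w) - f y - t * dir_deriv w f y) \<le> 2 * M * (2 * cmod t / (e/2 / (norm w + 1)))\<^sup>2"
      using e M by (intro line_holo_quotient [OF f]) auto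
    also have "\<dots> = K w * (cmod t)\<^sup>2"
      by (simp add: K_def power2_eq_square power_divide algebra_simps)
    finally show ?thesis .
  qed
  define g where "g t = dir_deriv v f (x + t *\<^sub>C u)" for t
  have g: "(g \<longlongrightarrow> g 0) (at 0)"
    using field_differentiable_imp_continuous_at [OF line_holo_dir_deriv_differentiable [OF f x, of v u]]
    by (simp add: g_def [abs_def] continuous_at)
  have "((\<lambda>t. cmod (dir_deriv (u + v) f x - dir_deriv u f x - g t)) \<longlongrightarrow> 0) (at 0)"
  proof (rule tendsto_sandwich [where f = "\<lambda>_. 0" and h = "\<lambda>t. (K u + K v + K (u + v)) * cmod t"])
    show "\<forall>\<^sub>F t in at 0. cmod (dir_deriv (u + v) f x - dir_deriv u f x - g t) \<le> (K u + K v + K (u + v)) * cmod t"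
      unfolding eventually_at
    proof (intro exI [of _ "r/2"] conjI ballI impI)
      fix t :: complex assume t: "t \<noteq> 0 \<and> dist t 0 < r/2"
      have "cmod t < (e/2) / (norm u + 1)"
      proof -
        have 1: "r/2 \<le> e/2/(norm u + 1)/2/2" using divide_right_mono [OF le [of u, folded r_def], of 2] by simp
        have quarter: "X / 2 / 2 \<le> X" if "0 \<le> X" for X :: real using that by simp
        have "cmod t < r/2" using t by simp
        also note 1
        also have "e/2/(norm u+1)/2/2 \<le> e/2/(norm u+1)" by (rule quarter) (use e in simp)
        finally show ?thesis .
      qed
      then have y: "x + t *\<^sub>C u \<in> ball x (e/2)" by (rule line_in_ball)
      have 1: "cmod (f (x + t *\<^sub>C (u + v)) - f x - t * dir_deriv (u + v) f x) \<le> K (u + v) * (cmod t)\<^sup>2"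
        by (rule quad) (use t e in \<open>auto simp: norm_triangle_ineq\<close>)
      have 2: "cmod (f (x + t *\<^sub>C u) - f x - t * dir_deriv u f x) \<le> K u * (cmod t)\<^sup>2"
        by (rule quad) (use t e in auto)
      have 3: "cmod (f (x + t *\<^sub>C u + t *\<^sub>C v) - f (x + t *\<^sub>C u) - t * dir_deriv v f (x + t *\<^sub>C u)) \<le> K v * (cmod t)\<^sup>2"
        by (rule quad) (use t y in auto)
      have "t * (dir_deriv (u + v) f x - dir_deriv u f x - g t) =
         (f (x + t *\<^sub>C u) - f x - t * dir_deriv u f x) 
       + (f (x + t *\<^sub>C u + t *\<^sub>C v) - f (x + t *\<^sub>C u) - t * dir_deriv v f (x + t *\<^sub>C u))
       - (f (x + t *\<^sub>C (u + v)) - f x - t * dir_deriv (u + v) f x)"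
        by (simp add: g_def algebra_simps scaleC_add_right)
      then have "cmod (t * (dir_deriv (u + v) f x - dir_deriv u f x - g t)) \<le> K u * (cmod t)\<^sup>2 + K v * (cmod t)\<^sup>2 + K (u + v) * (cmod t)\<^sup>2"
        using 1 2 3 by (smt (verit) norm_triangle_ineq norm_triangle_ineq4)
      then have "cmod t * cmod (dir_deriv (u + v) f x - dir_deriv u f x - g t) \<le> cmod t * ((K u + K v + K (u + v)) * cmod t)"
        unfolding norm_mult by (simp only: power2_eq_square distrib_right distrib_left mult_ac)
      then show "cmod (dir_deriv (u + v) f x - dir_deriv u f x - g t) \<le> (K u + K v + K (u + v)) * cmod t"
        using t by simp
    qed (use r0 in auto)
    show "((\<lambda>t. (K u + K v + K (u + v)) * cmod t) \<longlongrightarrow> 0) (at 0)"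
      by (auto intro!: tendsto_eq_intros)
  qed auto
  moreover have "((\<lambda>t. cmod (dir_deriv (u + v) f x - dir_deriv u f x - g t)) \<longlongrightarrow> cmod (dir_deriv (u + v) f x - dir_deriv u f x - g 0)) (at 0)"
    using g by (intro tendsto_intros)
  ultimately have "cmod (dir_deriv (u + v) f x - dir_deriv u f x - g 0) = 0"
    by (rule tendsto_unique [OF at_neq_bot, rotated])
  then show ?thesis by (simp add: g_def algebra_simps)
qed

text \<open>A Hartogs type criterion: local boundedness and holomorphy on lines give complex
  differentiability.\<close>

lemma line_holo_iff_holo: "line_holo f W \<longleftrightarrow> holo_on f W"
proof
  assume f: "line_holo f W"
  have "\<exists>D. (f has_derivative D) (at x) \<and> (\<forall>c v. D (c *\<^sub>C v) = c *\<^sub>C D v)" if x: "x \<in> W" for x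
  proof (intro exI conjI allI)
    obtain e M where e: "e > 0" "ball x e \<subseteq> W" and M: "\<And>y. y \<in> ball x e \<Longrightarrow> cmod (f y) \<le> M"
      using line_holo_bdd [OF f x] by metis
    have M0: "0 \<le> M" using M [of x] e by (meson centre_in_ball norm_ge_zero order_trans)
    let ?D = "\<lambda>v. dir_deriv v f x"
    show "?D (c *\<^sub>C v) = c *\<^sub>C ?D v" for c v
      by (simp add: line_holo_dir_deriv_scaleC [OF f x])
    have bl: "bounded_linear ?D"
    proof
      show "?D (u + v) = ?D u + ?D v" for u v by (rule line_holo_dir_deriv_add [OF f x])
      show s: "?D (r *\<^sub>R v) = r *\<^sub>R ?D v" for r v
        using line_holo_dir_deriv_scaleC [OF f x, of "of_real r" v] by (simp add: scaleC_of_real scaleR_conv_of_real)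
      show "\<exists>K. \<forall>h. norm (?D h) \<le> norm h * K"
      proof (intro exI allI)
        fix h :: 'a
        show "norm (?D h) \<le> norm h * (2 * M / e)"
        proof (cases "h = 0")
          case True then show ?thesis by (simp add: dir_deriv_def)
        next
          case False
          define c where "c = e / 2 / norm h"
          have c: "c > 0" using False e by (simp add: c_def)
          have "cmod (?D (c *\<^sub>R h)) \<le> M * (2 * norm (c *\<^sub>R h) / e)"
            by (rule line_holo_dir_deriv_bound [OF f e(2,1) M]) (use False e in \<open>auto simp: c_def\<close>)
          then have "c * cmod (?D h) \<le> c * (M * (2 * norm h / e))"
            using c by (simp add: s algebra_simps)
          then have "cmod (?D h) \<le> M * (2 * norm h / e)"
            using c by (rule mult_left_le_imp_le)
          then show ?thesis by (simp add: mult_ac)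
        qed
      qed
    qed
    show "(f has_derivative ?D) (at x)"
      unfolding has_derivative_at
    proof (intro conjI bl)
      show "(\<lambda>h. norm (f (x + h) - f x - ?D h) / norm h) \<midarrow>0\<rightarrow> 0"
      proof (rule tendsto_sandwich [where f = "\<lambda>_. 0" and h = "\<lambda>h. 2 * M * 16 * norm h / e\<^sup>2"])
        show "\<forall>\<^sub>F h in at 0. norm (f (x + h) - f x - ?D h) / norm h \<le> 2 * M * 16 * norm h / e\<^sup>2"
          unfolding eventually_at
        proof (intro exI [of _ "min 1 (e/8)"] conjI ballI impI)
          fix h :: 'a assume h: "h \<noteq> 0 \<and> dist h 0 < min 1 (e/8)"
          define c where "c = norm h"
          define k where "k = (1/c) *\<^sub>R h"
          have c: "0 < c" "c < 1" "c < e/8" using h by (auto simp: c_def)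
          have k: "of_real c *\<^sub>C k = h" "norm k = 1"
            using c by (auto simp: k_def scaleC_of_real c_def)
          have "cmod (f (x + of_real c *\<^sub>C k) - f x - of_real c * dir_deriv k f x) \<le> 2 * M * (2 * cmod (of_real c) / (e / (norm k + 1)))\<^sup>2"
            by (rule line_holo_quotient [OF f e(2,1) M]) (use c k in auto)
          moreover have "of_real c * dir_deriv k f x = ?D h"
            using line_holo_dir_deriv_scaleC [OF f x, of "of_real c" k] k by simp
          ultimately have "cmod (f (x + h) - f x - ?D h) \<le> 2 * M * (4 * c / e)\<^sup>2"
            using c k by simp
          also have "\<dots> = 2 * M * 16 * c / e\<^sup>2 * c" by (simp add: power2_eq_square)
          finally show "norm (f (x + h) - f x - ?D h) / norm h \<le> 2 * M * 16 * norm h / e\<^sup>2"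
            using c by (simp add: pos_divide_le_eq c_def [symmetric])
        qed (use e in auto)
        show "((\<lambda>h. 2 * M * 16 * norm h / e\<^sup>2) \<longlongrightarrow> 0) (at 0)"
          using e by (auto intro!: tendsto_eq_intros)
      qed auto
    qed
  qed
  then show "holo_on f W" using f by (auto simp: holo_on_def line_holo_def)
next
  assume f: "holo_on f W"
  then have op: "open W" by (simp add: holo_on_def)
  have der: "\<exists>D. (f has_derivative D) (at x) \<and> (\<forall>c v. D (c *\<^sub>C v) = c * D v)" if "x \<in> W" for x
    using f that by (auto simp: holo_on_def)
  have "\<exists>e>0. \<exists>M. ball x e \<subseteq> W \<and> (\<forall>y\<in>ball x e. cmod (f y) \<le> M)" if x: "x \<in> W" for x
  proof -
    from der [OF x] have "isCont f x" using has_derivative_continuous by blast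
    then obtain d where d: "d > 0" "\<And>y. dist y x < d \<Longrightarrow> dist (f y) (f x) < 1"
      unfolding continuous_at_eps_delta by (meson zero_less_one)
    obtain e where e: "e > 0" "ball x e \<subseteq> W" using op x openE by blast
    have "cmod (f y) \<le> cmod (f x) + 1" if "y \<in> ball x (min d e)" for y
      using d(2) [of y] that norm_triangle_ineq2 [of "f y" "f x"] by (simp add: dist_norm norm_minus_commute)
    then show ?thesis using d e by (intro exI [of _ "min d e"] conjI exI [of _ "cmod (f x) + 1"]) auto
  qed
  moreover have "(\<lambda>s. f (x + s *\<^sub>C v)) field_differentiable at 0" if x: "x \<in> W" for x v
  proof -
    obtain D where D: "(f has_derivative D) (at (x + 0 *\<^sub>C v))" "\<And>c v. D (c *\<^sub>C v) = c * D v"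
      using der [OF x] by auto
    have "((\<lambda>s. x + s *\<^sub>C v) has_derivative (\<lambda>s. s *\<^sub>C v)) (at 0)"
      by (auto intro!: derivative_eq_intros
          bounded_linear_imp_has_derivative [OF scaleC.bounded_linear_left])
    from diff_chain_at [OF this D(1)]
    have "((\<lambda>s. f (x + s *\<^sub>C v)) has_derivative (\<lambda>s. D v * s)) (at 0)"
      by (simp add: o_def D(2) mult.commute)
    then show ?thesis unfolding field_differentiable_def has_field_derivative_def by blast
  qed
  ultimately show "line_holo f W" using op by (auto simp: line_holo_def)
qed


section \<open>Calculus of holomorphic maps\<close>

lemma holo_on_open: "holo_on f W \<Longrightarrow> open W"
  by (simp add: holo_on_def)

lemma holo_on_subset: "holo_on f W \<Longrightarrow> open V \<Longrightarrow> V \<subseteq> W \<Longrightarrow> holo_on f V"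
  by (auto simp: holo_on_def)

lemma holo_on_cong:
  assumes "holo_on f W" "\<And>x. x \<in> W \<Longrightarrow> f x = g x"
  shows "holo_on g W"
proof -
  have "(g has_derivative D) (at x)" if "(f has_derivative D) (at x)" "x \<in> W" for D x
    using that(1) by (rule has_derivative_transform_within_open)
      (use that assms in \<open>auto simp: holo_on_def\<close>)
  then show ?thesis using assms unfolding holo_on_def by blast
qed

lemma holo_on_continuous: "holo_on f W \<Longrightarrow> continuous_on W f"
  by (metis continuous_at_imp_continuous_on has_derivative_continuous holo_on_def)

lemma holo_on_isCont: "holo_on f W \<Longrightarrow> x \<in> W \<Longrightarrow> isCont f x"
  by (metis has_derivative_continuous holo_on_def)

lemma holo_on_compose:
  assumes g: "holo_on g V" and f: "holo_on f W"
  shows "holo_on (\<lambda>x. g (f x)) {x \<in> W. f x \<in> V}"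
  unfolding holo_on_def
proof (intro conjI ballI)
  show "open {x \<in> W. f x \<in> V}"
    using continuous_open_preimage [OF holo_on_continuous [OF f] holo_on_open [OF f] holo_on_open [OF g]]
    by (simp add: vimage_def Int_def)
  fix x assume x: "x \<in> {x \<in> W. f x \<in> V}"
  then obtain D E where D: "(f has_derivative D) (at x)" "\<forall>c v. D (c *\<^sub>C v) = c *\<^sub>C D v"
    and E: "(g has_derivative E) (at (f x))" "\<forall>c v. E (c *\<^sub>C v) = c *\<^sub>C E v"
    using f g unfolding holo_on_def by blast
  have "((\<lambda>x. g (f x)) has_derivative (\<lambda>v. E (D v))) (at x)"
    using diff_chain_at [OF D(1) E(1)] by (simp add: o_def)
  then show "\<exists>D. ((\<lambda>x. g (f x)) has_derivative D) (at x) \<and> (\<forall>c v. D (c *\<^sub>C v) = c *\<^sub>C D v)"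
    using D(2) E(2) by (intro exI [of _ "\<lambda>v. E (D v)"]) auto
qed

lemma holo_on_compose':
  "holo_on g V \<Longrightarrow> holo_on f W \<Longrightarrow> f ` W \<subseteq> V \<Longrightarrow> holo_on (\<lambda>x. g (f x)) W"
  by (rule holo_on_subset [OF holo_on_compose]) (auto simp: holo_on_def)

lemma holo_on_const: "open W \<Longrightarrow> holo_on (\<lambda>_. c :: 'b::cnormed) W"
  by (auto simp: holo_on_def intro!: exI [of _ "\<lambda>_. 0"])

lemma holo_on_linear:
  assumes "bounded_linear L" "\<And>c v. L (c *\<^sub>C v) = c *\<^sub>C L v" "open W"
  shows "holo_on L W"
  using assms by (auto simp: holo_on_def intro!: exI [of _ L] bounded_linear_imp_has_derivative)

lemma holo_on_linear_compose:
  assumes "bounded_linear L" "\<And>c v. L (c *\<^sub>C v) = c *\<^sub>C L v" "holo_on f W"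
  shows "holo_on (\<lambda>x. L (f x)) W"
  using holo_on_compose' [OF holo_on_linear [OF assms(1,2) open_UNIV] assms(3)] by simp

lemma holo_on_ident: "open W \<Longrightarrow> holo_on (\<lambda>x. x) W"
  by (auto simp: holo_on_def intro!: exI [of _ "\<lambda>x. x"])

lemma holo_on_Pair:
  assumes "holo_on f W" "holo_on g W"
  shows "holo_on (\<lambda>x. (f x, g x)) W"
  unfolding holo_on_def
proof (intro conjI ballI)
  fix x assume "x \<in> W"
  then obtain D E where D: "(f has_derivative D) (at x)" "\<forall>c v. D (c *\<^sub>C v) = c *\<^sub>C D v"
    and E: "(g has_derivative E) (at x)" "\<forall>c v. E (c *\<^sub>C v) = c *\<^sub>C E v"
    using assms unfolding holo_on_def by blast
  then show "\<exists>D. ((\<lambda>x. (f x, g x)) has_derivative D) (at x) \<and> (\<forall>c v. D (c *\<^sub>C v) = c *\<^sub>C D v)"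
    by (intro exI [of _ "\<lambda>v. (D v, E v)"]) (auto intro: has_derivative_Pair simp: Pair_scaleC)
qed (use assms holo_on_open in auto)

lemma holo_on_fst: "holo_on f W \<Longrightarrow> holo_on (\<lambda>x. fst (f x)) W"
  by (rule holo_on_linear_compose) (auto simp: scaleC_prod_def intro: bounded_linear_fst)

lemma holo_on_snd: "holo_on f W \<Longrightarrow> holo_on (\<lambda>x. snd (f x)) W"
  by (rule holo_on_linear_compose) (auto simp: scaleC_prod_def intro: bounded_linear_snd)

lemma holo_on_nth: "holo_on f W \<Longrightarrow> holo_on (\<lambda>x. f x $ i) W"
  by (rule holo_on_linear_compose) (auto intro: bounded_linear_vec_nth)

lemma holo_on_add:
  assumes "holo_on f W" "holo_on g W"
  shows "holo_on (\<lambda>x. f x + g x :: 'b::cnormed) W"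
  unfolding holo_on_def
proof (intro conjI ballI)
  fix x assume "x \<in> W"
  then obtain D E where D: "(f has_derivative D) (at x)" "\<forall>c v. D (c *\<^sub>C v) = c *\<^sub>C D v"
    and E: "(g has_derivative E) (at x)" "\<forall>c v. E (c *\<^sub>C v) = c *\<^sub>C E v"
    using assms unfolding holo_on_def by blast
  then show "\<exists>D. ((\<lambda>x. f x + g x) has_derivative D) (at x) \<and> (\<forall>c v. D (c *\<^sub>C v) = c *\<^sub>C D v)"
    by (intro exI [of _ "\<lambda>v. D v + E v"]) (auto intro: has_derivative_add simp: scaleC_add_right)
qed (use assms holo_on_open in auto)

lemma holo_on_scaleC:
  assumes "holo_on f W" "holo_on g W"
  shows "holo_on (\<lambda>x. f x *\<^sub>C g x :: 'b::cnormed) W"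
  unfolding holo_on_def
proof (intro conjI ballI)
  fix x assume "x \<in> W"
  then obtain D E where D: "(f has_derivative D) (at x)" "\<forall>c v. D (c *\<^sub>C v) = c *\<^sub>C D v"
    and E: "(g has_derivative E) (at x)" "\<forall>c v. E (c *\<^sub>C v) = c *\<^sub>C E v"
    using assms unfolding holo_on_def by blast
  then show "\<exists>D. ((\<lambda>x. f x *\<^sub>C g x) has_derivative D) (at x) \<and> (\<forall>c v. D (c *\<^sub>C v) = c *\<^sub>C D v)"
    by (intro exI [of _ "\<lambda>v. f x *\<^sub>C E v + D v *\<^sub>C g x"] conjI allI scaleC.FDERIV)
      (auto simp: scaleC_add_right scaleC_scaleC mult.commute)
qed (use assms holo_on_open in auto)

lemma holo_on_mult: "holo_on f W \<Longrightarrow> holo_on g W \<Longrightarrow> holo_on (\<lambda>x. f x * g x :: complex) W"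
  using holo_on_scaleC [of f W g] by simp

lemma holo_on_diff:
  assumes "holo_on f W" "holo_on g W"
  shows "holo_on (\<lambda>x. f x - g x :: 'b::cnormed) W"
  using holo_on_add [OF assms(1) holo_on_scaleC [OF holo_on_const [OF holo_on_open, OF assms(1), of "-1"] assms(2)]]
  by (simp add: scaleC.minus_left)

lemma holo_on_sum:
  assumes "finite I" "open W" "\<And>i. i \<in> I \<Longrightarrow> holo_on (f i) W"
  shows "holo_on (\<lambda>x. \<Sum>i\<in>I. f i x :: 'b::cnormed) W"
  using assms by (induction I) (auto intro: holo_on_const holo_on_add)

lemma axis_sum_nth: "x = (\<Sum>i\<in>UNIV. axis i (x $ i :: 'b::real_normed_vector))"
proof -
  have "(\<Sum>i\<in>UNIV. axis i (x $ i)) $ j = (\<Sum>i\<in>UNIV. if i = j then x $ j else 0)" for j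
    unfolding sum_component by (rule sum.cong) (auto simp: axis_def)
  then show ?thesis by (simp add: vec_eq_iff)
qed

lemma bounded_linear_axis: "bounded_linear (axis i :: 'b::real_normed_vector \<Rightarrow> 'b ^ 'n::finite)"
proof (rule bounded_linear_intro [where K = 1])
  fix x :: 'b
  have "norm (axis i x :: 'b ^ 'n) \<le> (\<Sum>j\<in>UNIV. norm ((axis i x :: 'b ^ 'n) $ j))"
    unfolding norm_vec_def by (rule L2_set_le_sum) simp
  also have "\<dots> = (\<Sum>j\<in>UNIV. if j = i then norm x else 0)"
    by (rule sum.cong) (auto simp: axis_def)
  finally show "norm (axis i x :: 'b ^ 'n) \<le> norm x * 1" by simp
qed (auto simp: axis_def vec_eq_iff)

lemma holo_on_vec:
  fixes f :: "'a::cnormed \<Rightarrow> 'b::cnormed ^ 'n::finite"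
  assumes "\<And>i. holo_on (\<lambda>x. f x $ i) W"
  shows "holo_on f W"
proof -
  have op: "open W" using assms holo_on_open by blast
  have "holo_on (\<lambda>x. \<Sum>i\<in>UNIV. axis i (f x $ i)) W"
    by (intro holo_on_sum holo_on_linear_compose [OF bounded_linear_axis _ assms] op)
      (auto simp: axis_def vec_eq_iff)
  then show ?thesis by (simp add: axis_sum_nth [symmetric])
qed

lemma holo_on_matrix_vector_mult:
  fixes M :: "'a::cnormed \<Rightarrow> complex ^ 'n::finite ^ 'm::finite"
  assumes "holo_on M W" "holo_on x W"
  shows "holo_on (\<lambda>y. M y *v x y) W"
proof (rule holo_on_vec)
  fix i
  have "holo_on (\<lambda>y. \<Sum>j\<in>UNIV. M y $ i $ j * x y $ j) W"
    using assms holo_on_open by (intro holo_on_sum holo_on_mult holo_on_nth) auto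
  then show "holo_on (\<lambda>y. (M y *v x y) $ i) W"
    by (simp add: matrix_vector_mult_def)
qed

lemma holo_on_transpose:
  fixes M :: "'a::cnormed \<Rightarrow> complex ^ 'n::finite ^ 'm::finite"
  assumes "holo_on M W"
  shows "holo_on (\<lambda>y. transpose (M y)) W"
  by (intro holo_on_vec) (simp add: transpose_def, intro holo_on_nth assms)

lemma holo_on_holomorphic:
  fixes f :: "complex \<Rightarrow> complex"
  shows "holo_on f W \<longleftrightarrow> open W \<and> f holomorphic_on W"
proof
  assume f: "holo_on f W"
  have "f field_differentiable at x" if x: "x \<in> W" for x
  proof -
    obtain D where "(f has_derivative D) (at x)" "\<forall>c v. D (c *\<^sub>C v) = c *\<^sub>C D v"
      using f x unfolding holo_on_def by blast
    moreover from this(2) have "D = (\<lambda>h. D 1 * h)"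
      by (metis (no_types) mult.commute mult.right_neutral scaleC_complex ext)
    ultimately show ?thesis unfolding field_differentiable_def has_field_derivative_def by metis
  qed
  then show "open W \<and> f holomorphic_on W"
    using f by (auto simp: holomorphic_on_def holo_on_def intro: field_differentiable_at_within)
next
  assume f: "open W \<and> f holomorphic_on W"
  have "\<exists>D. (f has_derivative D) (at x) \<and> (\<forall>c v. D (c *\<^sub>C v) = c *\<^sub>C D v)" if "x \<in> W" for x
    using holomorphic_on_imp_differentiable_at [of f W x] f that
    unfolding field_differentiable_def has_field_derivative_def
    by (metis mult.left_commute scaleC_complex)
  then show "holo_on f W" using f by (simp add: holo_on_def)
qed

lemma holo_on_exp: "holo_on f W \<Longrightarrow> holo_on (\<lambda>x. exp (f x) :: complex) W"
  by (rule holo_on_compose' [where V = UNIV]) (auto simp: holo_on_holomorphic intro: holomorphic_intros)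

lemma holo_on_line:
  assumes "holo_on f W"
  shows "(\<lambda>s. f (x + s *\<^sub>C v)) holomorphic_on {s. x + s *\<^sub>C (v::'a::cnormed) \<in> W}"
  using line_holo_line assms line_holo_iff_holo by blast

lemma holo_on_line_differentiable:
  assumes "holo_on f W" "x \<in> W"
  shows "(\<lambda>s. f (x + s *\<^sub>C (v::'a::cnormed))) field_differentiable at 0"
  using assms by (simp add: line_holo_iff_holo [symmetric] line_holo_def)


section \<open>Iterated directional derivatives\<close>

lemma dir_deriv_cong:
  assumes "open W" "x \<in> W" "\<And>y. y \<in> W \<Longrightarrow> f y = g y"
  shows "dir_deriv v f x = dir_deriv (v::'a::cnormed) g x"
  unfolding dir_deriv_def
proof (rule deriv_cong_ev)
  have "\<forall>\<^sub>F s in nhds 0. s \<in> {s. x + s *\<^sub>C v \<in> W}"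
    by (rule eventually_nhds_in_open [OF open_line]) (use assms in auto)
  then show "\<forall>\<^sub>F s in nhds 0. f (x + s *\<^sub>C v) = g (x + s *\<^sub>C v)"
    by eventually_elim (use assms in auto)
qed simp

lemma fold_dir_deriv_cong:
  assumes "open W" "x \<in> W" "\<And>y. y \<in> W \<Longrightarrow> f y = g y"
  shows "fold dir_deriv vs f x = fold dir_deriv (vs::'a::cnormed list) g x"
  using assms(2,3)
proof (induction vs arbitrary: f g x)
  case (Cons v vs)
  show ?case
    unfolding fold_Cons o_apply
    by (rule Cons.IH [OF Cons.prems(1)]) (rule dir_deriv_cong [OF assms(1)], use Cons.prems in auto)
qed simp

lemma holo_on_dir_deriv: "holo_on f W \<Longrightarrow> holo_on (dir_deriv (v::'a::cnormed) f) W"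
  using line_holo_dir_deriv line_holo_iff_holo by blast

lemma holo_on_fold_dir_deriv: "holo_on f W \<Longrightarrow> holo_on (fold dir_deriv (vs::'a::cnormed list) f) W"
  by (induction vs arbitrary: f) (auto intro: holo_on_dir_deriv)

lemma dir_deriv_add_fun:
  assumes "holo_on f W" "holo_on g W" "x \<in> W"
  shows "dir_deriv (v::'a::cnormed) (\<lambda>y. f y + g y) x = dir_deriv v f x + dir_deriv v g x"
  unfolding dir_deriv_def using assms by (intro deriv_add holo_on_line_differentiable)

lemma dir_deriv_cmult_fun:
  assumes "holo_on f W" "x \<in> W"
  shows "dir_deriv (v::'a::cnormed) (\<lambda>y. c * f y) x = c * dir_deriv v f x"
  unfolding dir_deriv_def using assms by (intro deriv_cmult holo_on_line_differentiable)

lemma fold_dir_deriv_add_fun: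
  assumes "holo_on f W" "holo_on g W" "x \<in> W"
  shows "fold dir_deriv (vs::'a::cnormed list) (\<lambda>y. f y + g y) x = fold dir_deriv vs f x + fold dir_deriv vs g x"
  using assms
proof (induction vs arbitrary: f g)
  case (Cons v vs)
  have "fold dir_deriv vs (dir_deriv v (\<lambda>y. f y + g y)) x = fold dir_deriv vs (\<lambda>y. dir_deriv v f y + dir_deriv v g y) x"
    using Cons.prems by (intro fold_dir_deriv_cong [of W] dir_deriv_add_fun) (auto intro: holo_on_open)
  then show ?case using Cons by (simp add: holo_on_dir_deriv)
qed simp

lemma fold_dir_deriv_cmult_fun:
  assumes "holo_on f W" "x \<in> W"
  shows "fold dir_deriv (vs::'a::cnormed list) (\<lambda>y. c * f y) x = c * fold dir_deriv vs f x"
  using assms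
proof (induction vs arbitrary: f)
  case (Cons v vs)
  have "fold dir_deriv vs (dir_deriv v (\<lambda>y. c * f y)) x = fold dir_deriv vs (\<lambda>y. c * dir_deriv v f y) x"
    using Cons.prems by (intro fold_dir_deriv_cong [of W] dir_deriv_cmult_fun) (auto intro: holo_on_open)
  then show ?case using Cons by (simp add: holo_on_dir_deriv)
qed simp

lemma dir_deriv_commute:
  assumes "holo_on f W" "x \<in> W"
  shows "dir_deriv u (dir_deriv v f) x = dir_deriv v (dir_deriv (u::'a::cnormed) f) x"
  using line_holo_dir_deriv_commute assms line_holo_iff_holo by blast

lemma dir_deriv_fold_dir_deriv_commute:
  assumes "holo_on f W" "x \<in> W"
  shows "dir_deriv u (fold dir_deriv vs f) x = fold dir_deriv vs (dir_deriv (u::'a::cnormed) f) x"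
  using assms
proof (induction vs arbitrary: f)
  case (Cons v vs)
  have "dir_deriv u (fold dir_deriv vs (dir_deriv v f)) x = fold dir_deriv vs (dir_deriv u (dir_deriv v f)) x"
    using Cons by (simp add: holo_on_dir_deriv)
  also have "\<dots> = fold dir_deriv vs (dir_deriv v (dir_deriv u f)) x"
    using Cons.prems by (intro fold_dir_deriv_cong [of W] dir_deriv_commute) (auto intro: holo_on_open)
  finally show ?case by simp
qed simp

text \<open>Iterated derivatives of a function restricted to an affine subspace are iterated derivatives on
  the ambient space; this turns derivatives in single groups of variables into directional
  derivatives on a product.\<close>

lemma fold_dir_deriv_affine:
  assumes "\<And>x y. \<iota> (x + y) = \<iota> x + \<iota> y" "\<And>c x. \<iota> (c *\<^sub>C x) = c *\<^sub>C \<iota> x"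
  shows "fold dir_deriv vs (\<lambda>z. H (a + \<iota> z)) = (\<lambda>z. fold dir_deriv (map \<iota> vs) H (a + \<iota> z))"
proof (induction vs arbitrary: H)
  case (Cons v vs)
  have "dir_deriv v (\<lambda>z. H (a + \<iota> z)) = (\<lambda>z. dir_deriv (\<iota> v) H (a + \<iota> z))"
    by (simp add: dir_deriv_def fun_eq_iff assms add_ac)
  then show ?case using Cons by simp
qed simp

text \<open>The list of coordinate directions encoding a multi-index, in the order used by
  \<open>multi_deriv\<close>.\<close>

definition dirs :: "('n::finite \<Rightarrow> nat) \<Rightarrow> (complex ^ 'n) list"
  where "dirs \<alpha> = concat (map (\<lambda>i. replicate (\<alpha> i) (axis i 1)) index_list)"

lemma partial_deriv_eq_dir_deriv: "partial_deriv i = dir_deriv (axis i 1)"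
proof (intro ext)
  fix f :: "complex ^ 'a \<Rightarrow> complex" and x
  have "(\<lambda>s. f (x + axis i s)) = (\<lambda>s. f (x + s *\<^sub>C axis i 1))"
    by (rule ext) (subst axis_scaleC, rule refl)
  then show "partial_deriv i f x = dir_deriv (axis i 1) f x"
    by (simp add: partial_deriv_def dir_deriv_def)
qed

lemma multi_deriv_eq_fold_dir_deriv: "multi_deriv \<alpha> f = fold dir_deriv (dirs \<alpha>) f"
proof -
  have 1: "fold dir_deriv (replicate k v) = dir_deriv v ^^ k" for k and v :: "complex ^ 'n"
    by (induction k) (auto simp: funpow_swap1 fun_eq_iff)
  have "fold (\<lambda>i. partial_deriv i ^^ \<alpha> i) is f
      = fold dir_deriv (concat (map (\<lambda>i. replicate (\<alpha> i) (axis i 1)) is)) f" for "is" f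
    by (induction "is" arbitrary: f) (auto simp: 1 partial_deriv_eq_dir_deriv)
  then show ?thesis by (simp add: multi_deriv_def dirs_def)
qed

lemma index_list: "distinct (index_list :: 'n::finite list)" "set (index_list :: 'n list) = UNIV"
proof -
  have "\<exists>is. distinct is \<and> set is = (UNIV :: 'n set)"
    using finite_distinct_list [of "UNIV :: 'n set"] by auto
  then have "distinct (index_list :: 'n list) \<and> set (index_list :: 'n list) = UNIV"
    unfolding index_list_def by (rule someI_ex)
  then show "distinct (index_list :: 'n list)" "set (index_list :: 'n list) = UNIV" by auto
qed


section \<open>Cauchy estimates\<close>

lemma maxnorm_le_iff: "maxnorm z \<le> r \<longleftrightarrow> (\<forall>i. cmod (z $ i) \<le> r)"
  unfolding maxnorm_def by (subst Max_le_iff) auto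

lemma norm_nth_le_maxnorm: "cmod (z $ i) \<le> maxnorm z"
  using maxnorm_le_iff by blast

lemma maxnorm_nonneg [simp]: "0 \<le> maxnorm z"
  using norm_nth_le_maxnorm norm_ge_zero order_trans by blast

lemma maxnorm_zero [simp]: "maxnorm 0 = 0"
  by (rule antisym) (auto simp: maxnorm_le_iff)

lemma partial_deriv_funpow:
  "(partial_deriv i ^^ k) f (x + axis i t) = (deriv ^^ k) (\<lambda>s. f (x + axis i s)) t"
proof (induction k arbitrary: t)
  case (Suc k)
  have "partial_deriv i ((partial_deriv i ^^ k) f) (x + axis i t)
      = deriv (\<lambda>s. (partial_deriv i ^^ k) f (x + axis i (t + s))) 0"
  proof -
    have "x + axis i t + axis i s = x + axis i (t + s)" for s
      by (simp add: vec_eq_iff axis_def)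
    then show ?thesis by (simp only: partial_deriv_def)
  qed
  also have "\<dots> = deriv (\<lambda>s. (deriv ^^ k) (\<lambda>s. f (x + axis i s)) (t + s)) 0"
    by (simp only: Suc.IH)
  also have "\<dots> = deriv ((deriv ^^ k) (\<lambda>s. f (x + axis i s))) t"
    by (subst deriv_shift_0) (simp add: o_def)
  finally show ?case by simp
qed simp

text \<open>Cauchy estimates in one variable after another. At each stage \<open>f\<close> need only be bounded on the
  polydisc in the coordinates that remain to be differentiated.\<close>

lemma fold_partial_deriv_bound:
  fixes f :: "complex ^ 'n::finite \<Rightarrow> complex"
  assumes "distinct is" "holo_on f W" "0 < r"
    and "\<And>y. (\<forall>j. j \<notin> set is \<longrightarrow> y $ j = x $ j) \<Longrightarrow> (\<forall>j\<in>set is. cmod (y $ j - x $ j) \<le> r)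
      \<Longrightarrow> y \<in> W \<and> cmod (f y) \<le> M"
  shows "cmod (fold (\<lambda>i. partial_deriv i ^^ \<alpha> i) is f x) \<le> (\<Prod>i\<in>set is. fact (\<alpha> i) / r ^ \<alpha> i) * M"
  using assms
proof (induction "is" arbitrary: f M)
  case Nil
  then show ?case by (auto simp: vec_eq_iff)
next
  case (Cons i "is")
  let ?g = "(partial_deriv i ^^ \<alpha> i) f"
  have hol: "holo_on ?g W"
  proof -
    have "holo_on ((partial_deriv i ^^ k) f) W" for k
      using Cons.prems(2) by (induction k) (auto simp: partial_deriv_eq_dir_deriv intro: holo_on_dir_deriv)
    then show ?thesis .
  qed
  have "cmod (fold (\<lambda>i. partial_deriv i ^^ \<alpha> i) is ?g x)
      \<le> (\<Prod>i\<in>set is. fact (\<alpha> i) / r ^ \<alpha> i) * (fact (\<alpha> i) * M / r ^ \<alpha> i)"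
  proof (rule Cons.IH [OF _ hol])
    fix y :: "complex ^ 'n"
    assume y: "\<forall>j. j \<notin> set is \<longrightarrow> y $ j = x $ j" "\<forall>j\<in>set is. cmod (y $ j - x $ j) \<le> r"
    have yi: "y $ i = x $ i" using y Cons.prems(1) by auto
    have box: "y + s *\<^sub>C axis i 1 \<in> W \<and> cmod (f (y + s *\<^sub>C axis i 1)) \<le> M" if "cmod s \<le> r" for s
      by (rule Cons.prems(4)) (use y yi that in \<open>auto simp: axis_def\<close>)
    have "cmod ((deriv ^^ \<alpha> i) (\<lambda>s. f (y + s *\<^sub>C axis i 1)) 0) \<le> fact (\<alpha> i) * M / r ^ \<alpha> i"
      by (rule cauchy_bound [OF holo_on_line [OF Cons.prems(2)] open_line])
        (use box Cons.prems holo_on_open in auto)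
    moreover have "(\<lambda>s. f (y + axis i s)) = (\<lambda>s. f (y + s *\<^sub>C axis i 1))"
      by (rule ext) (subst axis_scaleC, rule refl)
    then have "?g y = (deriv ^^ \<alpha> i) (\<lambda>s. f (y + s *\<^sub>C axis i 1)) 0"
      using partial_deriv_funpow [where i = i and k = "\<alpha> i" and f = f and x = y and t = 0]
      by (simp add: axis_eq_0_iff [THEN iffD2])
    ultimately show "y \<in> W \<and> cmod (?g y) \<le> fact (\<alpha> i) * M / r ^ \<alpha> i"
      using box [of 0] Cons.prems(3) by simp
  qed (use Cons.prems in auto)
  then show ?case using Cons.prems(1) by (simp add: mult_ac)
qed

lemma multi_deriv_bound:
  assumes "holo_on f W" "0 < r" "\<And>y. maxnorm (y - x) \<le> r \<Longrightarrow> y \<in> W \<and> cmod (f y) \<le> M"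
  shows "cmod (multi_deriv \<alpha> f x) \<le> (\<Prod>i\<in>UNIV. fact (\<alpha> i)) * M / r ^ (\<Sum>i\<in>UNIV. \<alpha> i)"
proof -
  have "cmod (fold (\<lambda>i. partial_deriv i ^^ \<alpha> i) index_list f x)
      \<le> (\<Prod>i\<in>set index_list. fact (\<alpha> i) / r ^ \<alpha> i) * M"
    by (rule fold_partial_deriv_bound [OF index_list(1) assms(1,2)])
      (use assms(3) in \<open>auto simp: index_list maxnorm_le_iff\<close>)
  then show ?thesis
    by (simp add: multi_deriv_def index_list prod_dividef power_sum)
qed

text \<open>The multi-indices of degree \<open>m\<close>.\<close>

definition mindex :: "nat \<Rightarrow> ('n::finite \<Rightarrow> nat) set"
  where "mindex m = {\<alpha>. (\<Sum>i\<in>UNIV. \<alpha> i) = m}"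

lemma mindex_subset: "mindex m \<subseteq> (UNIV :: 'n::finite set) \<rightarrow>\<^sub>E {..m}"
  by (auto simp: mindex_def PiE_def extensional_def member_le_sum)

lemma finite_mindex [simp]: "finite (mindex m :: ('n::finite \<Rightarrow> nat) set)"
  by (rule finite_subset [OF mindex_subset]) (auto intro: finite_PiE)

lemma card_mindex: "card (mindex m :: ('n::finite \<Rightarrow> nat) set) \<le> (2 ^ CARD('n)) ^ m"
proof -
  have "card (mindex m :: ('n \<Rightarrow> nat) set) \<le> card ((UNIV :: 'n set) \<rightarrow>\<^sub>E {..m})"
    by (intro card_mono mindex_subset finite_PiE) auto
  also have "\<dots> = (m + 1) ^ CARD('n)" by (simp add: card_PiE)
  also have "\<dots> \<le> (2 ^ m) ^ CARD('n)"
    by (intro power_mono) (use less_exp [of m] in \<open>simp_all add: Suc_le_eq\<close>)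
  finally show ?thesis by (simp add: power_mult [symmetric] mult.commute)
qed

lemma prod_fact_le: "finite I \<Longrightarrow> (\<Prod>i\<in>I. fact (\<alpha> i) :: nat) \<le> fact (\<Sum>i\<in>I. \<alpha> i)"
proof (induction I rule: finite_induct)
  case (insert i I)
  have "fact (\<alpha> i) * (\<Prod>i\<in>I. fact (\<alpha> i) :: nat) \<le> fact (\<alpha> i) * fact (\<Sum>i\<in>I. \<alpha> i)"
    using insert.IH by simp
  also have "\<dots> \<le> fact (\<alpha> i + (\<Sum>i\<in>I. \<alpha> i))"
    by (rule dvd_imp_le [OF fact_fact_dvd_fact]) simp
  finally show ?case using insert.hyps by simp
qed simp


section \<open>The contraction of the operators in base and fibre\<close>

text \<open>The part of degree \<open>m\<close> of \<open>exp \<langle>\<partial>\<^sub>\<zeta>, \<partial>\<^sub>z\<rangle>\<close> applied to \<open>G\<close> and evaluated at the origin.\<close>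

definition contract :: "nat \<Rightarrow> (complex ^ 'n::finite \<Rightarrow> complex ^ 'n \<Rightarrow> complex) \<Rightarrow> complex"
  where "contract m G = (\<Sum>\<alpha>\<in>mindex m. 1 / (\<Prod>i\<in>UNIV. fact (\<alpha> i)) *
    multi_deriv \<alpha> (\<lambda>\<zeta>. multi_deriv \<alpha> (\<lambda>z. G z \<zeta>) 0) 0)"

text \<open>The same operator as a differential operator on the product with a parameter space. The first
  factor carries the parameters on which the contraction depends holomorphically.\<close>

definition contract_op ::
    "nat \<Rightarrow> ('e::cnormed \<times> (complex ^ 'n::finite) \<times> (complex ^ 'n) \<Rightarrow> complex) \<Rightarrow> 'e \<times> (complex ^ 'n) \<times> (complex ^ 'n) \<Rightarrow> complex"
  where "contract_op m H = (\<lambda>x. \<Sum>\<alpha>\<in>mindex m. 1 / (\<Prod>i\<in>UNIV. fact (\<alpha> i)) *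
    fold dir_deriv (map (\<lambda>v. (0, 0, v)) (dirs \<alpha>)) (fold dir_deriv (map (\<lambda>v. (0, v, 0)) (dirs \<alpha>)) H) x)"

lemma multi_deriv_slice:
  fixes H :: "'e::cnormed \<times> (complex ^ 'n::finite) \<times> (complex ^ 'n) \<Rightarrow> complex"
  shows multi_deriv_slice_snd: "multi_deriv \<alpha> (\<lambda>\<zeta>. H (y, z, \<zeta>)) \<zeta> = fold dir_deriv (map (\<lambda>v. (0, 0, v)) (dirs \<alpha>)) H (y, z, \<zeta>)"
    and multi_deriv_slice_fst: "multi_deriv \<alpha> (\<lambda>z. H (y, z, \<zeta>)) z = fold dir_deriv (map (\<lambda>v. (0, v, 0)) (dirs \<alpha>)) H (y, z, \<zeta>)"
proof -
  have "fold dir_deriv (dirs \<alpha>) (\<lambda>\<zeta>. H ((y, z, 0) + (0, 0, \<zeta>)))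
      = (\<lambda>\<zeta>. fold dir_deriv (map (\<lambda>v. (0, 0, v)) (dirs \<alpha>)) H ((y, z, 0) + (0, 0, \<zeta>)))"
    by (rule fold_dir_deriv_affine) (auto simp: Pair_scaleC)
  then show "multi_deriv \<alpha> (\<lambda>\<zeta>. H (y, z, \<zeta>)) \<zeta> = fold dir_deriv (map (\<lambda>v. (0, 0, v)) (dirs \<alpha>)) H (y, z, \<zeta>)"
    by (simp add: multi_deriv_eq_fold_dir_deriv)
  have "fold dir_deriv (dirs \<alpha>) (\<lambda>z. H ((y, 0, \<zeta>) + (0, z, 0)))
      = (\<lambda>z. fold dir_deriv (map (\<lambda>v. (0, v, 0)) (dirs \<alpha>)) H ((y, 0, \<zeta>) + (0, z, 0)))"
    by (rule fold_dir_deriv_affine) (auto simp: Pair_scaleC)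
  then show "multi_deriv \<alpha> (\<lambda>z. H (y, z, \<zeta>)) z = fold dir_deriv (map (\<lambda>v. (0, v, 0)) (dirs \<alpha>)) H (y, z, \<zeta>)"
    by (simp add: multi_deriv_eq_fold_dir_deriv)
qed

lemma contract_eq_op: "contract m (\<lambda>z \<zeta>. H (y, z, \<zeta>)) = contract_op m H (y, 0, 0)"
  by (simp add: contract_def contract_op_def multi_deriv_slice_fst)
    (simp add: multi_deriv_slice_snd)

lemma holo_on_contract_op: "holo_on H W \<Longrightarrow> holo_on (contract_op m H) W"
  unfolding contract_op_def
  by (intro holo_on_sum holo_on_mult holo_on_const holo_on_fold_dir_deriv finite_mindex)
    (auto intro: holo_on_open)

lemma dir_deriv_sum_fun:
  assumes "finite I" "\<And>i. i \<in> I \<Longrightarrow> holo_on (f i) W" "open W" "x \<in> W"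
  shows "dir_deriv (v::'a::cnormed) (\<lambda>y. \<Sum>i\<in>I. f i y) x = (\<Sum>i\<in>I. dir_deriv v (f i) x)"
  using assms(1,2)
proof (induction I rule: finite_induct)
  case empty
  then show ?case by (simp add: dir_deriv_def)
next
  case (insert i I)
  then have "dir_deriv v (\<lambda>y. f i y + (\<Sum>i\<in>I. f i y)) x = dir_deriv v (f i) x + dir_deriv v (\<lambda>y. \<Sum>i\<in>I. f i y) x"
    using assms by (intro dir_deriv_add_fun [of _ W] holo_on_sum) auto
  then show ?case using insert by simp
qed

lemma dir_deriv_contract_op:
  fixes H :: "'e::cnormed \<times> (complex ^ 'n::finite) \<times> (complex ^ 'n) \<Rightarrow> complex"
  assumes H: "holo_on H W" and x: "x \<in> W"
  shows "dir_deriv u (contract_op m H) x = contract_op m (dir_deriv u H) x"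
proof -
  let ?A = "\<lambda>\<alpha>. map (\<lambda>v. (0, 0, v)) (dirs \<alpha>)" and ?B = "\<lambda>\<alpha>. map (\<lambda>v. (0, v, 0)) (dirs \<alpha>)"
  let ?c = "\<lambda>\<alpha>. 1 / (\<Prod>i\<in>UNIV. fact (\<alpha> i))"
  have op: "open W" using H by (rule holo_on_open)
  have "dir_deriv u (\<lambda>x. ?c \<alpha> * fold dir_deriv (?A \<alpha>) (fold dir_deriv (?B \<alpha>) H) x) x
      = ?c \<alpha> * fold dir_deriv (?A \<alpha>) (fold dir_deriv (?B \<alpha>) (dir_deriv u H)) x" for \<alpha>
  proof -
    have "dir_deriv u (\<lambda>x. ?c \<alpha> * fold dir_deriv (?A \<alpha>) (fold dir_deriv (?B \<alpha>) H) x) x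
        = ?c \<alpha> * dir_deriv u (fold dir_deriv (?A \<alpha>) (fold dir_deriv (?B \<alpha>) H)) x"
      by (rule dir_deriv_cmult_fun [OF _ x]) (intro holo_on_fold_dir_deriv H)
    also have "dir_deriv u (fold dir_deriv (?A \<alpha>) (fold dir_deriv (?B \<alpha>) H)) x = fold dir_deriv (?A \<alpha>) (dir_deriv u (fold dir_deriv (?B \<alpha>) H)) x"
      by (rule dir_deriv_fold_dir_deriv_commute [OF _ x]) (intro holo_on_fold_dir_deriv H)
    also have "\<dots> = fold dir_deriv (?A \<alpha>) (fold dir_deriv (?B \<alpha>) (dir_deriv u H)) x"
      by (rule fold_dir_deriv_cong [OF op x dir_deriv_fold_dir_deriv_commute [OF H]])
    finally show ?thesis .
  qed
  moreover have "holo_on (\<lambda>x. ?c \<alpha> * fold dir_deriv (?A \<alpha>) (fold dir_deriv (?B \<alpha>) H) x) W" for \<alpha>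
    by (intro holo_on_mult holo_on_const holo_on_fold_dir_deriv H op)
  ultimately show ?thesis
    unfolding contract_op_def by (simp only: dir_deriv_sum_fun [OF finite_mindex _ op x])
qed

lemma holo_on_contract:
  fixes H :: "'e::cnormed \<times> (complex ^ 'n::finite) \<times> (complex ^ 'n) \<Rightarrow> complex"
  assumes H: "holo_on H W" and V: "open V" "\<And>y. y \<in> V \<Longrightarrow> (y, 0, 0) \<in> W"
  shows "holo_on (\<lambda>y. contract m (\<lambda>z \<zeta>. H (y, z, \<zeta>))) V"
  unfolding contract_eq_op [of m H]
  by (rule holo_on_compose' [OF holo_on_contract_op [OF H]])
    (use V in \<open>auto intro!: holo_on_Pair holo_on_ident holo_on_const\<close>)

lemma dir_deriv_contract:
  fixes H :: "'e::cnormed \<times> (complex ^ 'n::finite) \<times> (complex ^ 'n) \<Rightarrow> complex"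
  assumes H: "holo_on H W" and y: "(y, 0, 0) \<in> W"
  shows "dir_deriv u (\<lambda>y. contract m (\<lambda>z \<zeta>. H (y, z, \<zeta>))) y = contract m (\<lambda>z \<zeta>. dir_deriv (u, 0, 0) H (y, z, \<zeta>))"
proof -
  have 1: "(\<lambda>y. contract m (\<lambda>z \<zeta>. H (y, z, \<zeta>))) = (\<lambda>y. contract_op m H (y, 0, 0))"
    by (rule ext) (rule contract_eq_op)
  have 2: "dir_deriv u (\<lambda>y. contract_op m H (y, 0, 0)) y = dir_deriv (u, 0, 0) (contract_op m H) (y, 0, 0)"
    by (simp add: dir_deriv_def Pair_scaleC)
  have 3: "contract m (\<lambda>z \<zeta>. dir_deriv (u, 0, 0) H (y, z, \<zeta>)) = contract_op m (dir_deriv (u, 0, 0) H) (y, 0, 0)"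
    by (rule contract_eq_op)
  show ?thesis
    unfolding 1 2 3 by (rule dir_deriv_contract_op [OF H y])
qed

lemma contract_cong:
  assumes W: "open W" "(0, 0) \<in> W" and eq: "\<And>z \<zeta>. (z, \<zeta>) \<in> W \<Longrightarrow> G z \<zeta> = G' z \<zeta>"
  shows "contract m G = contract m G'"
proof -
  define H where "H G = (\<lambda>(y::complex, z, \<zeta>). G z \<zeta> :: complex)" for G :: "complex ^ 'a \<Rightarrow> complex ^ 'a \<Rightarrow> complex"
  have "fold dir_deriv vs (fold dir_deriv us (H G)) (0, 0, 0) = fold dir_deriv vs (fold dir_deriv us (H G')) (0, 0, 0)" for us vs
    by (rule fold_dir_deriv_cong [of "UNIV \<times> W"]; (rule fold_dir_deriv_cong [of "UNIV \<times> W"])?)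
      (use assms in \<open>auto simp: H_def intro: open_Times\<close>)
  then have "contract_op m (H G) (0, 0, 0) = contract_op m (H G') (0, 0, 0)"
    by (simp add: contract_op_def)
  then show ?thesis by (simp add: contract_eq_op [symmetric] H_def)
qed

lemma contract_linear:
  fixes G G' :: "complex ^ 'n::finite \<Rightarrow> complex ^ 'n \<Rightarrow> complex"
  assumes W: "(0, 0) \<in> W" and G: "holo_on (\<lambda>(z, \<zeta>). G z \<zeta>) W"
  shows contract_add: "holo_on (\<lambda>(z, \<zeta>). G' z \<zeta>) W \<Longrightarrow>
      contract m (\<lambda>z \<zeta>. G z \<zeta> + G' z \<zeta>) = contract m G + contract m G'"
    and contract_cmult: "contract m (\<lambda>z \<zeta>. c * G z \<zeta>) = c * contract m G"
proof -
  define H where "H G = (\<lambda>(y::complex, z, \<zeta>). G z \<zeta> :: complex)" for G :: "complex ^ 'n \<Rightarrow> complex ^ 'n \<Rightarrow> complex"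
  have hol: "holo_on (H G) (UNIV \<times> W)" if "holo_on (\<lambda>(z, \<zeta>). G z \<zeta>) W" for G
  proof -
    have "holo_on (\<lambda>x. (\<lambda>(z, \<zeta>). G z \<zeta>) (snd x)) (UNIV \<times> W :: (complex \<times> _) set)"
      by (rule holo_on_compose' [OF that]) (use holo_on_open [OF that] in \<open>auto intro!: holo_on_snd holo_on_ident open_Times\<close>)
    then show ?thesis by (rule holo_on_cong) (auto simp: H_def)
  qed
  have x: "(0, 0, 0) \<in> UNIV \<times> W" using W by simp
  have op: "open (UNIV \<times> W :: (complex \<times> _) set)" using hol [OF G] by (rule holo_on_open)
  show "contract m (\<lambda>z \<zeta>. G z \<zeta> + G' z \<zeta>) = contract m G + contract m G'" if G': "holo_on (\<lambda>(z, \<zeta>). G' z \<zeta>) W"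
  proof -
    have "fold dir_deriv vs (fold dir_deriv us (\<lambda>y. H G y + H G' y)) (0, 0, 0)
        = fold dir_deriv vs (fold dir_deriv us (H G)) (0, 0, 0) + fold dir_deriv vs (fold dir_deriv us (H G')) (0, 0, 0)" for us vs
    proof -
      have "fold dir_deriv vs (fold dir_deriv us (\<lambda>y. H G y + H G' y)) (0, 0, 0)
          = fold dir_deriv vs (\<lambda>y. fold dir_deriv us (H G) y + fold dir_deriv us (H G') y) (0, 0, 0)"
        by (rule fold_dir_deriv_cong [OF op x fold_dir_deriv_add_fun [OF hol [OF G] hol [OF G']]])
      also have "\<dots> = fold dir_deriv vs (fold dir_deriv us (H G)) (0, 0, 0) + fold dir_deriv vs (fold dir_deriv us (H G')) (0, 0, 0)"
        by (rule fold_dir_deriv_add_fun [OF _ _ x]) (intro holo_on_fold_dir_deriv hol G G')+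
      finally show ?thesis .
    qed
    then have "contract_op m (\<lambda>y. H G y + H G' y) (0, 0, 0) = contract_op m (H G) (0, 0, 0) + contract_op m (H G') (0, 0, 0)"
      by (simp add: contract_op_def sum.distrib [symmetric] distrib_left del: times_divide_eq_left)
    then show ?thesis by (simp add: contract_eq_op [symmetric] H_def)
  qed
  have "fold dir_deriv vs (fold dir_deriv us (\<lambda>y. c * H G y)) (0, 0, 0) = c * fold dir_deriv vs (fold dir_deriv us (H G)) (0, 0, 0)" for us vs
  proof -
    have "fold dir_deriv vs (fold dir_deriv us (\<lambda>y. c * H G y)) (0, 0, 0) = fold dir_deriv vs (\<lambda>y. c * fold dir_deriv us (H G) y) (0, 0, 0)"
      by (rule fold_dir_deriv_cong [OF op x fold_dir_deriv_cmult_fun [OF hol [OF G]]])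
    also have "\<dots> = c * fold dir_deriv vs (fold dir_deriv us (H G)) (0, 0, 0)"
      by (rule fold_dir_deriv_cmult_fun [OF _ x]) (intro holo_on_fold_dir_deriv hol G)
    finally show ?thesis .
  qed
  then have "contract_op m (\<lambda>y. c * H G y) (0, 0, 0) = c * contract_op m (H G) (0, 0, 0)"
    by (simp add: contract_op_def sum_distrib_left mult.left_commute del: times_divide_eq_left)
  then show "contract m (\<lambda>z \<zeta>. c * G z \<zeta>) = c * contract m G"
    by (simp add: contract_eq_op [symmetric] H_def)
qed

lemma contract_zero [simp]: "contract m (\<lambda>z \<zeta>. 0) = 0"
  using contract_cmult [of UNIV "\<lambda>_ _. 0" m 0] by (simp add: holo_on_const case_prod_unfold)

lemma contract_sum:
  assumes "finite I" "open W" "(0, 0) \<in> W" "\<And>i. i \<in> I \<Longrightarrow> holo_on (\<lambda>(z, \<zeta>). G i z \<zeta>) W"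
  shows "contract m (\<lambda>z \<zeta>. \<Sum>i\<in>I. G i z \<zeta>) = (\<Sum>i\<in>I. contract m (G i))"
  using assms(1,4)
proof (induction I rule: finite_induct)
  case (insert i I)
  have "holo_on (\<lambda>x. \<Sum>i\<in>I. (\<lambda>(z, \<zeta>). G i z \<zeta>) x) W"
    by (intro holo_on_sum) (use insert assms in auto)
  then have "holo_on (\<lambda>(z, \<zeta>). \<Sum>i\<in>I. G i z \<zeta>) W" by (simp add: case_prod_unfold)
  then have "contract m (\<lambda>z \<zeta>. G i z \<zeta> + (\<Sum>i\<in>I. G i z \<zeta>)) = contract m (G i) + contract m (\<lambda>z \<zeta>. \<Sum>i\<in>I. G i z \<zeta>)"
    using insert by (intro contract_add [OF assms(3)]) auto
  then show ?case using insert by simp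
qed simp

text \<open>The multi-index \<open>\<alpha>\<close> contributes \<open>\<alpha>!\<^sup>2 / \<alpha>! \<le> m!\<close>; the factor \<open>2\<^bsup>nm\<^esup>\<close> bounds the
  number of multi-indices.\<close>

lemma contract_bound:
  fixes G :: "complex ^ 'n::finite \<Rightarrow> complex ^ 'n \<Rightarrow> complex"
  assumes G: "holo_on (\<lambda>(z, \<zeta>). G z \<zeta>) W" and pos: "0 < \<delta>" "0 < \<epsilon>"
    and M: "\<And>z \<zeta>. maxnorm z \<le> \<delta> \<Longrightarrow> maxnorm \<zeta> \<le> \<epsilon> \<Longrightarrow> (z, \<zeta>) \<in> W \<and> cmod (G z \<zeta>) \<le> M"
  shows "cmod (contract m G) \<le> (2 ^ CARD('n)) ^ m * fact m * M / (\<delta> * \<epsilon>) ^ m"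
proof -
  have M0: "0 \<le> M"
    using M [of 0 0] pos by (auto intro: order_trans [OF norm_ge_zero])
  have op: "open W" using G by (rule holo_on_open)
  have slice: "open {z. (z, \<zeta>) \<in> W}" "open {\<zeta>. (z, \<zeta>) \<in> W}" for z \<zeta>
  proof -
    have "continuous_on UNIV (\<lambda>z. (z, \<zeta>))" "continuous_on UNIV (\<lambda>\<zeta>. (z, \<zeta>))"
      by (intro continuous_intros)+
    then show "open {z. (z, \<zeta>) \<in> W}" "open {\<zeta>. (z, \<zeta>) \<in> W}"
      using open_vimage [OF op, of "\<lambda>z. (z, \<zeta>)"] open_vimage [OF op, of "\<lambda>\<zeta>. (z, \<zeta>)"]
      by (auto simp: vimage_def)
  qed
  have inner_holo: "holo_on (\<lambda>z. G z \<zeta>) {z. (z, \<zeta>) \<in> W}" for \<zeta>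
  proof -
    have "holo_on (\<lambda>z. (z, \<zeta>)) {z. (z, \<zeta>) \<in> W}"
      by (intro holo_on_Pair holo_on_const holo_on_ident slice)
    from holo_on_compose' [OF G this] show ?thesis by auto
  qed
  have outer_holo: "holo_on (\<lambda>\<zeta>. multi_deriv \<alpha> (\<lambda>z. G z \<zeta>) 0) {\<zeta>. (0, \<zeta>) \<in> W}" for \<alpha>
  proof -
    have "fold dir_deriv (dirs \<alpha>) (\<lambda>z. (\<lambda>(z, \<zeta>). G z \<zeta>) ((0, \<zeta>) + (z, 0)))
        = (\<lambda>z. fold dir_deriv (map (\<lambda>v. (v, 0)) (dirs \<alpha>)) (\<lambda>(z, \<zeta>). G z \<zeta>) ((0, \<zeta>) + (z, 0)))" for \<zeta>
      by (rule fold_dir_deriv_affine) (auto simp: Pair_scaleC)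
    then have eq: "multi_deriv \<alpha> (\<lambda>z. G z \<zeta>) 0 = fold dir_deriv (map (\<lambda>v. (v, 0)) (dirs \<alpha>)) (\<lambda>(z, \<zeta>). G z \<zeta>) (0, \<zeta>)" for \<zeta>
      by (simp add: multi_deriv_eq_fold_dir_deriv)
    have "holo_on (\<lambda>\<zeta>. (0 :: complex ^ 'n, \<zeta>)) {\<zeta>. (0, \<zeta>) \<in> W}"
      by (intro holo_on_Pair holo_on_const holo_on_ident slice)
    from holo_on_compose' [OF holo_on_fold_dir_deriv [OF G] this] show ?thesis
      unfolding eq by (rule holo_on_cong) auto
  qed
  have "cmod (1 / (\<Prod>i\<in>UNIV. fact (\<alpha> i)) * multi_deriv \<alpha> (\<lambda>\<zeta>. multi_deriv \<alpha> (\<lambda>z. G z \<zeta>) 0) 0)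
      \<le> fact m * M / (\<delta> * \<epsilon>) ^ m" if \<alpha>: "\<alpha> \<in> mindex m" for \<alpha> :: "'n \<Rightarrow> nat"
  proof -
    define F where "F = (\<Prod>i\<in>UNIV. fact (\<alpha> i) :: real)"
    have sum: "(\<Sum>i\<in>UNIV. \<alpha> i) = m" using \<alpha> by (simp add: mindex_def)
    have F: "0 < F" "F \<le> fact m"
    proof -
      show "0 < F" by (simp add: F_def prod_pos)
      have "real (\<Prod>i\<in>UNIV. fact (\<alpha> i)) \<le> real (fact m)"
        unfolding of_nat_le_iff sum [symmetric] by (rule prod_fact_le) simp
      then show "F \<le> fact m" by (simp add: F_def)
    qed
    have inner: "cmod (multi_deriv \<alpha> (\<lambda>z. G z \<zeta>) 0) \<le> F * M / \<delta> ^ m" if "maxnorm \<zeta> \<le> \<epsilon>" for \<zeta>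
      unfolding F_def sum [symmetric]
      by (rule multi_deriv_bound [OF inner_holo [of \<zeta>] pos(1)]) (use M that in auto)
    have "cmod (multi_deriv \<alpha> (\<lambda>\<zeta>. multi_deriv \<alpha> (\<lambda>z. G z \<zeta>) 0) 0) \<le> F * (F * M / \<delta> ^ m) / \<epsilon> ^ m"
      unfolding F_def sum [symmetric]
      by (rule multi_deriv_bound [OF outer_holo pos(2)])
        (use M [of 0] pos inner in \<open>auto simp: F_def sum\<close>)
    then have "cmod (multi_deriv \<alpha> (\<lambda>\<zeta>. multi_deriv \<alpha> (\<lambda>z. G z \<zeta>) 0) 0) / F \<le> F * (F * M / \<delta> ^ m) / \<epsilon> ^ m / F"
      by (rule divide_right_mono) (use F in simp)
    also have "\<dots> = F * (M / (\<delta> * \<epsilon>) ^ m)"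
      using F by (simp add: power_mult_distrib)
    also have "\<dots> \<le> fact m * (M / (\<delta> * \<epsilon>) ^ m)"
      by (rule mult_right_mono [OF F(2)]) (use M0 pos in simp)
    finally show ?thesis
      by (simp add: norm_mult norm_divide F_def prod_norm [symmetric])
  qed
  then have "cmod (contract m G) \<le> real (card (mindex m :: ('n \<Rightarrow> nat) set)) * (fact m * M / (\<delta> * \<epsilon>) ^ m)"
    unfolding contract_def by (intro sum_norm_bound) auto
  also have "\<dots> \<le> real ((2 ^ CARD('n)) ^ m) * (fact m * M / (\<delta> * \<epsilon>) ^ m)"
  proof (rule mult_right_mono)
    show "real (card (mindex m :: ('n \<Rightarrow> nat) set)) \<le> real ((2 ^ CARD('n)) ^ m)"
      unfolding of_nat_le_iff by (rule card_mindex)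
  qed (use M0 pos in simp)
  finally show ?thesis by simp
qed


section \<open>Jets and exponentials\<close>

text \<open>Vanishing to order \<open>N\<close> at \<open>x0\<close>. The bound is stated for all radii \<open>r \<ge> \<bar>x - x0\<bar>\<close>, so that for
  \<open>N > 0\<close> it also contains \<open>f x0 = 0\<close>.\<close>

definition vanishes :: "nat \<Rightarrow> ('a::real_normed_vector \<Rightarrow> complex) \<Rightarrow> 'a \<Rightarrow> bool"
  where "vanishes N f x0 \<longleftrightarrow>
    (\<exists>C r0. 0 < r0 \<and> (\<forall>r x. 0 < r \<longrightarrow> r < r0 \<longrightarrow> norm (x - x0) \<le> r \<longrightarrow> cmod (f x) \<le> C * r ^ N))"

lemma vanishesI:
  "0 < r0 \<Longrightarrow> (\<And>r x. 0 < r \<Longrightarrow> r < r0 \<Longrightarrow> norm (x - x0) \<le> r \<Longrightarrow> cmod (f x) \<le> C * r ^ N) \<Longrightarrow> vanishes N f x0"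
  unfolding vanishes_def by blast

lemma vanishesE:
  assumes "vanishes N f x0"
  obtains C r0 where "0 < r0" "0 \<le> C" "\<And>r x. 0 < r \<Longrightarrow> r < r0 \<Longrightarrow> norm (x - x0) \<le> r \<Longrightarrow> cmod (f x) \<le> C * r ^ N"
proof -
  obtain C r0 where C: "0 < r0" "\<And>r x. 0 < r \<Longrightarrow> r < r0 \<Longrightarrow> norm (x - x0) \<le> r \<Longrightarrow> cmod (f x) \<le> C * r ^ N"
    using assms unfolding vanishes_def by blast
  have "cmod (f x) \<le> max C 0 * r ^ N" if "0 < r" "r < r0" "norm (x - x0) \<le> r" for r x
    using C(2) [OF that] mult_right_mono [of C "max C 0" "r ^ N"] that by (smt (verit) zero_le_power)
  then show ?thesis using that [of r0 "max C 0"] C(1) by auto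
qed

lemma nonpos_if_le_linear:
  fixes a :: real
  assumes "0 < r0" "\<And>r. 0 < r \<Longrightarrow> r < r0 \<Longrightarrow> a \<le> K * r"
  shows "a \<le> 0"
proof (rule tendsto_lowerbound)
  show "((\<lambda>r. K * r) \<longlongrightarrow> 0) (at_right 0)"
    by (auto intro!: tendsto_eq_intros)
  show "\<forall>\<^sub>F r in at_right 0. a \<le> K * r"
    using assms by (auto simp: eventually_at_right_field)
qed simp

lemma vanishes_zero:
  assumes "vanishes N f x0" "0 < N"
  shows "f x0 = 0"
proof -
  obtain C r0 where C: "0 < r0" "0 \<le> C" "\<And>r x. 0 < r \<Longrightarrow> r < r0 \<Longrightarrow> norm (x - x0) \<le> r \<Longrightarrow> cmod (f x) \<le> C * r ^ N"
    by (rule vanishesE [OF assms(1)]) (rule that)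
  have "cmod (f x0) \<le> C * r" if "0 < r" "r < min r0 1" for r
  proof -
    have "cmod (f x0) \<le> C * r ^ N" using that by (intro C(3)) auto
    also have "\<dots> \<le> C * r ^ 1" using that C assms(2) by (intro mult_left_mono power_decreasing) auto
    finally show ?thesis by simp
  qed
  then have "cmod (f x0) \<le> 0" by (rule nonpos_if_le_linear [of "min r0 1", rotated]) (use C(1) in auto)
  then show ?thesis by simp
qed

lemma vanishes_add:
  assumes "vanishes N f x0" "vanishes N g x0"
  shows "vanishes N (\<lambda>x. f x + g x) x0"
proof -
  obtain C r where C: "0 < r" "0 \<le> C" "\<And>s x. 0 < s \<Longrightarrow> s < r \<Longrightarrow> norm (x - x0) \<le> s \<Longrightarrow> cmod (f x) \<le> C * s ^ N"
    by (rule vanishesE [OF assms(1)]) (rule that)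
  obtain D q where D: "0 < q" "0 \<le> D" "\<And>s x. 0 < s \<Longrightarrow> s < q \<Longrightarrow> norm (x - x0) \<le> s \<Longrightarrow> cmod (g x) \<le> D * s ^ N"
    by (rule vanishesE [OF assms(2)]) (rule that)
  show ?thesis
  proof (rule vanishesI [of "min r q"])
    fix s x assume s: "0 < s" "s < min r q" "norm (x - x0) \<le> s"
    have "cmod (f x + g x) \<le> C * s ^ N + D * s ^ N"
      using s by (intro norm_triangle_mono C(3) D(3)) auto
    then show "cmod (f x + g x) \<le> (C + D) * s ^ N" by (simp add: distrib_right)
  qed (use C D in auto)
qed

lemma vanishes_mult:
  assumes "vanishes N f x0" "vanishes N' g x0"
  shows "vanishes (N + N') (\<lambda>x. f x * g x) x0"
proof -
  obtain C r where C: "0 < r" "0 \<le> C" "\<And>s x. 0 < s \<Longrightarrow> s < r \<Longrightarrow> norm (x - x0) \<le> s \<Longrightarrow> cmod (f x) \<le> C * s ^ N"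
    by (rule vanishesE [OF assms(1)]) (rule that)
  obtain D q where D: "0 < q" "0 \<le> D" "\<And>s x. 0 < s \<Longrightarrow> s < q \<Longrightarrow> norm (x - x0) \<le> s \<Longrightarrow> cmod (g x) \<le> D * s ^ N'"
    by (rule vanishesE [OF assms(2)]) (rule that)
  show ?thesis
  proof (rule vanishesI [of "min r q"])
    fix s x assume s: "0 < s" "s < min r q" "norm (x - x0) \<le> s"
    have "cmod (f x * g x) \<le> (C * s ^ N) * (D * s ^ N')"
      unfolding norm_mult using s C(2) by (intro mult_mono C(3) D(3)) auto
    then show "cmod (f x * g x) \<le> (C * D) * s ^ (N + N')" by (simp add: power_add mult_ac)
  qed (use C D in auto)
qed

lemma vanishes_mono:
  assumes "vanishes N f x0" "N' \<le> N"
  shows "vanishes N' f x0"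
proof -
  obtain C r where C: "0 < r" "0 \<le> C" "\<And>s x. 0 < s \<Longrightarrow> s < r \<Longrightarrow> norm (x - x0) \<le> s \<Longrightarrow> cmod (f x) \<le> C * s ^ N"
    by (rule vanishesE [OF assms(1)]) (rule that)
  show ?thesis
  proof (rule vanishesI [of "min r 1"])
    fix s x assume s: "0 < s" "s < min r 1" "norm (x - x0) \<le> s"
    have "cmod (f x) \<le> C * s ^ N" using s by (intro C(3)) auto
    also have "\<dots> \<le> C * s ^ N'" using s C assms(2) by (intro mult_left_mono power_decreasing) auto
    finally show "cmod (f x) \<le> C * s ^ N'" .
  qed (use C in auto)
qed

lemma isCont_vanishes_0:
  assumes "isCont f x0"
  shows "vanishes 0 f x0"
proof -
  obtain d where d: "d > 0" "\<And>y. dist y x0 < d \<Longrightarrow> dist (f y) (f x0) < 1"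
    using assms unfolding continuous_at_eps_delta by (meson zero_less_one)
  show ?thesis
  proof (rule vanishesI [OF d(1)])
    fix r x assume "0 < r" "r < d" "norm (x - x0) \<le> r"
    then show "cmod (f x) \<le> (cmod (f x0) + 1) * r ^ 0"
      using d(2) [of x] norm_triangle_ineq2 [of "f x" "f x0"] by (simp add: dist_norm)
  qed
qed

text \<open>The complex bilinear pairing, without conjugation.\<close>

definition cdot :: "complex ^ 'n::finite \<Rightarrow> complex ^ 'n \<Rightarrow> complex"
  where "cdot a x = (\<Sum>i\<in>UNIV. a $ i * x $ i)"

lemma cdot_simps [simp]:
  "cdot a (x + y) = cdot a x + cdot a y" "cdot (a + b) x = cdot a x + cdot b x"
  "cdot a (c *\<^sub>C x) = c * cdot a x" "cdot (c *\<^sub>C a) x = c * cdot a x"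
  "cdot a 0 = 0" "cdot 0 x = 0"
  by (auto simp: cdot_def algebra_simps sum.distrib sum_distrib_left)

lemma cdot_commute: "cdot a b = cdot b a"
  by (simp add: cdot_def mult.commute)

lemma cdot_axis [simp]: "cdot a (axis i 1) = a $ i" "cdot (axis i 1) a = a $ i"
proof -
  have "cdot a (axis i 1) = (\<Sum>j\<in>UNIV. if j = i then a $ j else 0)"
    unfolding cdot_def by (rule sum.cong) (auto simp: axis_def)
  then show "cdot a (axis i 1) = a $ i" by simp
  then show "cdot (axis i 1) a = a $ i" by (simp add: cdot_commute)
qed

lemma cdot_transpose: "cdot a (transpose A *v x) = cdot (A *v a) x"
proof -
  have "cdot a (transpose A *v x) = (\<Sum>i\<in>UNIV. \<Sum>j\<in>UNIV. a $ i * (A $ j $ i * x $ j))"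
    by (simp add: cdot_def matrix_vector_mult_def transpose_def sum_distrib_left)
  also have "\<dots> = (\<Sum>j\<in>UNIV. \<Sum>i\<in>UNIV. a $ i * (A $ j $ i * x $ j))" by (rule sum.swap)
  also have "\<dots> = cdot (A *v a) x"
    by (simp add: cdot_def matrix_vector_mult_def sum_distrib_left sum_distrib_right mult_ac)
  finally show ?thesis .
qed

lemma holo_on_cdot:
  assumes "holo_on f W" "holo_on g W"
  shows "holo_on (\<lambda>x. cdot (f x) (g x)) W"
  unfolding cdot_def using assms holo_on_open by (intro holo_on_sum holo_on_mult holo_on_nth) auto

text \<open>Finite linear combinations of exponentials of linear forms.\<close>

inductive expoly :: "(complex ^ 'n::finite \<Rightarrow> complex) \<Rightarrow> bool" where
  expoly_exp: "expoly (\<lambda>x. exp (cdot a x))"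
| expoly_add: "expoly f \<Longrightarrow> expoly g \<Longrightarrow> expoly (\<lambda>x. f x + g x)"
| expoly_cmult: "expoly f \<Longrightarrow> expoly (\<lambda>x. c * f x)"

lemma expoly_const: "expoly (\<lambda>_. c)"
  using expoly_cmult [OF expoly_exp [of 0], of c] by simp

lemma expoly_mult:
  assumes "expoly f" "expoly g"
  shows "expoly (\<lambda>x. f x * g x)"
  using assms(1)
proof induction
  case (expoly_exp a)
  from assms(2) show ?case
  proof induction
    case (expoly_exp b)
    have "expoly (\<lambda>x. exp (cdot (a + b) x))" by (rule expoly.expoly_exp)
    then show ?case by (simp add: exp_add)
  next
    case (expoly_add f g)
    then show ?case using expoly.expoly_add by (simp add: distrib_left)
  next
    case (expoly_cmult f c)
    then show ?case using expoly.expoly_cmult [OF expoly_cmult.IH, of c] by (simp add: mult_ac)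
  qed
next
  case (expoly_add f g)
  then show ?case using expoly.expoly_add by (simp add: distrib_right)
next
  case (expoly_cmult f c)
  then show ?case using expoly.expoly_cmult [OF expoly_cmult.IH, of c] by (simp add: mult_ac)
qed

lemma expoly_power: "expoly f \<Longrightarrow> expoly (\<lambda>x. f x ^ k)"
  by (induction k) (auto intro: expoly_const expoly_mult)

lemma expoly_sum: "finite I \<Longrightarrow> (\<And>i. i \<in> I \<Longrightarrow> expoly (f i)) \<Longrightarrow> expoly (\<lambda>x. \<Sum>i\<in>I. f i x)"
  by (induction I rule: finite_induct) (auto intro: expoly_const expoly_add)

lemma holo_on_expoly: "expoly f \<Longrightarrow> open W \<Longrightarrow> holo_on f W"
  by (induction rule: expoly.induct)
    (auto intro!: holo_on_exp holo_on_cdot holo_on_const holo_on_ident holo_on_add holo_on_mult)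

lemma vanishes_expoly: "expoly f \<Longrightarrow> vanishes 0 f x0"
  by (rule isCont_vanishes_0, rule holo_on_isCont [OF holo_on_expoly [OF _ open_UNIV]]) auto

text \<open>The \<open>N\<close>-jet of \<open>f\<close> at \<open>x0\<close> is that of a combination of exponentials.\<close>

definition jet :: "nat \<Rightarrow> complex ^ 'n::finite \<Rightarrow> (complex ^ 'n \<Rightarrow> complex) \<Rightarrow> bool"
  where "jet N x0 f \<longleftrightarrow> (\<exists>q. expoly q \<and> vanishes N (\<lambda>x. f x - q x) x0)"

lemma jet_bounded:
  assumes "jet N x0 f"
  shows "vanishes 0 f x0"
proof -
  obtain q where q: "expoly q" "vanishes N (\<lambda>x. f x - q x) x0"
    using assms by (auto simp: jet_def)
  have "vanishes 0 (\<lambda>x. (f x - q x) + q x) x0"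
    by (intro vanishes_add vanishes_mono [OF q(2)] vanishes_expoly q) simp
  then show ?thesis by simp
qed

lemma jet_expoly: "expoly q \<Longrightarrow> jet N x0 q"
  unfolding jet_def by (intro exI [of _ q]) (auto intro: vanishesI [of 1 _ _ 0])

lemma jet_add:
  assumes "jet N x0 f" "jet N x0 g"
  shows "jet N x0 (\<lambda>x. f x + g x)"
proof -
  obtain q p where q: "expoly q" "vanishes N (\<lambda>x. f x - q x) x0" and p: "expoly p" "vanishes N (\<lambda>x. g x - p x) x0"
    using assms by (auto simp: jet_def)
  have "vanishes N (\<lambda>x. (f x - q x) + (g x - p x)) x0" by (intro vanishes_add q p)
  then show ?thesis
    unfolding jet_def by (intro exI [of _ "\<lambda>x. q x + p x"]) (auto intro: expoly_add q p simp: algebra_simps)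
qed

lemma jet_mult:
  assumes "jet N x0 f" "jet N x0 g"
  shows "jet N x0 (\<lambda>x. f x * g x)"
proof -
  obtain q p where q: "expoly q" "vanishes N (\<lambda>x. f x - q x) x0" and p: "expoly p" "vanishes N (\<lambda>x. g x - p x) x0"
    using assms by (auto simp: jet_def)
  have "vanishes (0 + N) (\<lambda>x. f x * (g x - p x)) x0"
    by (intro vanishes_mult jet_bounded [OF assms(1)] p)
  moreover have "vanishes (0 + N) (\<lambda>x. p x * (f x - q x)) x0"
    by (intro vanishes_mult vanishes_expoly p q)
  ultimately have "vanishes N (\<lambda>x. f x * (g x - p x) + p x * (f x - q x)) x0"
    by (intro vanishes_add) auto
  then show ?thesis
    unfolding jet_def
    by (intro exI [of _ "\<lambda>x. q x * p x"]) (auto intro: expoly_mult q p simp: algebra_simps)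
qed

lemma jet_sum: "finite I \<Longrightarrow> (\<And>i. i \<in> I \<Longrightarrow> jet N x0 (f i)) \<Longrightarrow> jet N x0 (\<lambda>x. \<Sum>i\<in>I. f i x)"
  by (induction I rule: finite_induct) (auto intro: jet_add jet_expoly expoly_const)

text \<open>Coordinates: with \<open>u = exp (x - x0)\<^sub>i - 1\<close>, itself a combination of exponentials, one has
  \<open>(x - x0)\<^sub>i = Ln (1 + u)\<close>, and a Taylor polynomial of the logarithm in \<open>u\<close> has the same jet.\<close>

lemma jet_nth: "jet N x0 (\<lambda>x. (x - x0) $ i)"
proof -
  define L where "L u = Ln (1 + u)" for u
  define c where "c k = (deriv ^^ k) L 0 / fact k" for k
  define q where "q x = exp (- x0 $ i) * exp (cdot (axis i 1) x) - 1" for x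
  have q: "expoly q"
    using expoly_add [OF expoly_cmult [OF expoly_exp [of "axis i 1"], of "exp (- x0 $ i)"] expoly_const [of "-1"]]
    by (simp add: q_def [abs_def])
  have hol: "L holomorphic_on ball 0 1"
  proof -
    have "1 + u \<notin> \<real>\<^sub>\<le>\<^sub>0" if "cmod u < 1" for u
    proof
      assume "1 + u \<in> \<real>\<^sub>\<le>\<^sub>0"
      then have "Re u \<le> -1" by (auto simp: complex_nonpos_Reals_iff)
      then show False using abs_Re_le_cmod [of u] that by linarith
    qed
    then show ?thesis unfolding L_def by (intro holomorphic_intros) auto
  qed
  have "compact (L ` cball 0 (1/2))"
    by (intro compact_continuous_image continuous_on_subset [OF holomorphic_on_imp_continuous_on [OF hol]]) auto
  then obtain M where M: "\<And>u. u \<in> cball 0 (1/2) \<Longrightarrow> cmod (L u) \<le> M"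
    using compact_imp_bounded bounded_iff by (metis imageI)
  have Lt: "cmod (L u - (\<Sum>k<N. c k * u ^ k)) \<le> 2 * M * (4 * cmod u) ^ N" if "cmod u \<le> 1/8" for u
    using taylor_remainder_bound [of L "1/2" M u N] that M holomorphic_on_subset [OF hol subset_ball [of "1/2" 1]]
    by (auto simp: c_def)
  have M0: "0 \<le> M" using M [of 0] by (auto intro: order_trans [OF norm_ge_zero])
  have et: "cmod (exp s - 1) \<le> exp 4 * cmod s" if "cmod s \<le> 1" for s :: complex
  proof -
    have "cmod (exp s - (\<Sum>k<1. (deriv ^^ k) exp 0 / fact k * s ^ k)) \<le> 2 * exp 4 * (2 * cmod s / 4) ^ 1"
    proof (rule taylor_remainder_bound)
      show "cmod (exp z) \<le> exp 4" if "z \<in> ball 0 4" for z :: complex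
        using that complex_Re_le_cmod [of z] by simp
    qed (use that in \<open>auto intro: holomorphic_intros\<close>)
    then show ?thesis by simp
  qed
  have qx: "q x = exp ((x - x0) $ i) - 1" for x
    by (simp add: q_def exp_diff exp_minus field_simps)
  define r0 where "r0 = 1 / (8 * exp (4::real))"
  have r0: "0 < r0" "r0 \<le> 1/8" by (auto simp: r0_def divide_simps)
  have "vanishes N (\<lambda>x. (x - x0) $ i - (\<Sum>k<N. c k * q x ^ k)) x0"
  proof (rule vanishesI [OF r0(1)])
    fix r x assume r: "0 < r" "r < r0" "norm (x - x0) \<le> r"
    let ?s = "(x - x0) $ i"
    have s: "cmod ?s \<le> r" using r(3) component_le_norm_cart order_trans Finite_Cartesian_Product.norm_nth_le by blast
    have "cmod (q x) \<le> exp 4 * cmod ?s"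
      unfolding qx by (rule et) (use s r r0 in linarith)
    also have "\<dots> \<le> exp 4 * r" by (rule mult_left_mono [OF s]) simp
    finally have u: "cmod (q x) \<le> exp 4 * r" .
    have "exp 4 * r \<le> exp 4 * r0" using r by (intro mult_left_mono) auto
    then have u8: "cmod (q x) \<le> 1/8" using u by (simp add: r0_def)
    have "L (q x) = ?s"
      unfolding L_def qx using s r r0 abs_Im_le_cmod [of ?s] pi_gt3
      by (simp add: Ln_exp)
    then have "cmod (?s - (\<Sum>k<N. c k * q x ^ k)) \<le> 2 * M * (4 * cmod (q x)) ^ N"
      using Lt [OF u8] by simp
    also have "\<dots> \<le> 2 * M * (4 * (exp 4 * r)) ^ N"
      using u M0 by (intro mult_left_mono power_mono) auto
    also have "\<dots> = (2 * M * (4 * exp 4) ^ N) * r ^ N"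
      by (simp add: power_mult_distrib)
    finally show "cmod (?s - (\<Sum>k<N. c k * q x ^ k)) \<le> (2 * M * (4 * exp 4) ^ N) * r ^ N" .
  qed
  then show ?thesis
    unfolding jet_def
    by (intro exI [of _ "\<lambda>x. \<Sum>k<N. c k * q x ^ k"] conjI expoly_sum expoly_cmult expoly_power q) auto
qed

lemma dir_deriv_cdot:
  fixes f :: "complex ^ 'n::finite \<Rightarrow> complex"
  assumes f: "holo_on f W" and x: "x \<in> W"
  shows "dir_deriv v f x = (\<Sum>i\<in>UNIV. v $ i * dir_deriv (axis i 1) f x)"
proof -
  have l: "line_holo f W" using f by (simp add: line_holo_iff_holo)
  have "dir_deriv (\<Sum>i\<in>I. u i) f x = (\<Sum>i\<in>I. dir_deriv (u i) f x)" if "finite I" for I and u :: "'n \<Rightarrow> complex ^ 'n"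
    using that by (induction I rule: finite_induct) (auto simp: line_holo_dir_deriv_add [OF l x], simp add: dir_deriv_def)
  from this [of UNIV "\<lambda>i. v $ i *\<^sub>C axis i 1"]
  have "dir_deriv (\<Sum>i\<in>UNIV. v $ i *\<^sub>C axis i 1) f x = (\<Sum>i\<in>UNIV. v $ i * dir_deriv (axis i 1) f x)"
    by (simp add: line_holo_dir_deriv_scaleC [OF l x])
  moreover have "(\<Sum>i\<in>UNIV. v $ i *\<^sub>C axis i 1) = v"
    by (subst (2) axis_sum_nth [of v]) (rule sum.cong, simp, rule axis_scaleC [symmetric])
  ultimately show ?thesis by simp
qed

lemma deriv_funpow_line:
  "(deriv ^^ k) (\<lambda>s. f (x + s *\<^sub>C v)) t = fold dir_deriv (replicate k v) f (x + t *\<^sub>C v)"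
proof (induction k arbitrary: f)
  case (Suc k)
  have "deriv (\<lambda>s. f (x + s *\<^sub>C v)) = (\<lambda>s. dir_deriv v f (x + s *\<^sub>C v))"
  proof
    fix t
    have "deriv (\<lambda>s. f (x + s *\<^sub>C v)) t = deriv (\<lambda>s. f (x + (t + s) *\<^sub>C v)) 0"
      by (subst deriv_shift_0) (simp add: o_def)
    then show "deriv (\<lambda>s. f (x + s *\<^sub>C v)) t = dir_deriv v f (x + t *\<^sub>C v)"
      by (simp add: dir_deriv_def scaleC_add_left add.assoc)
  qed
  then show ?case using Suc.IH [of "dir_deriv v f"] by (simp add: funpow_swap1)
qed simp

lemma fold_dir_deriv_replicate_Suc: "fold dir_deriv (replicate (Suc k) v) f = dir_deriv v (fold dir_deriv (replicate k v) f)"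
  by (induction k arbitrary: f) auto

text \<open>The homogeneous part of degree \<open>k\<close> of the Taylor expansion at \<open>x0\<close>, up to the factor \<open>k!\<close>.\<close>

definition taylor_part :: "nat \<Rightarrow> ('a::cnormed \<Rightarrow> complex) \<Rightarrow> 'a \<Rightarrow> 'a \<Rightarrow> complex"
  where "taylor_part k f x0 x = fold dir_deriv (replicate k (x - x0)) f x0"

text \<open>By induction on the degree: the part of degree \<open>k + 1\<close> of \<open>f\<close> is
  \<open>\<Sum>i. (x - x0)\<^sub>i\<close> times the part of degree \<open>k\<close> of \<open>\<partial>\<^sub>i f\<close>.\<close>

lemma jet_taylor_part:
  assumes "holo_on f W" "x0 \<in> W"
  shows "jet N x0 (taylor_part k f x0)"
  using assms(1)
proof (induction k arbitrary: f)
  case 0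
  then show ?case by (simp add: taylor_part_def [abs_def] jet_expoly expoly_const)
next
  case (Suc k)
  have op: "open W" using Suc.prems by (rule holo_on_open)
  have sum: "fold dir_deriv vs (\<lambda>y. \<Sum>i\<in>I. v $ i * dir_deriv (axis i 1) f y) x0 = (\<Sum>i\<in>I. v $ i * fold dir_deriv vs (dir_deriv (axis i 1) f) x0)"
    if "finite I" for I :: "'a set" and vs v
    using that
  proof (induction I rule: finite_induct)
    case empty
    show ?case using fold_dir_deriv_cmult_fun [of "\<lambda>_. 0" UNIV x0 vs 0] by (simp add: holo_on_const)
  next
    case (insert i I)
    have "fold dir_deriv vs (\<lambda>y. v $ i * dir_deriv (axis i 1) f y + (\<Sum>i\<in>I. v $ i * dir_deriv (axis i 1) f y)) x0
       = fold dir_deriv vs (\<lambda>y. v $ i * dir_deriv (axis i 1) f y) x0 + fold dir_deriv vs (\<lambda>y. \<Sum>i\<in>I. v $ i * dir_deriv (axis i 1) f y) x0"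
      by (rule fold_dir_deriv_add_fun [OF _ _ assms(2)])
        (intro holo_on_sum holo_on_mult holo_on_const holo_on_dir_deriv Suc.prems op insert.hyps)+
    also have "fold dir_deriv vs (\<lambda>y. v $ i * dir_deriv (axis i 1) f y) x0 = v $ i * fold dir_deriv vs (dir_deriv (axis i 1) f) x0"
      by (rule fold_dir_deriv_cmult_fun [OF holo_on_dir_deriv [OF Suc.prems] assms(2)])
    finally show ?case using insert by simp
  qed
  have "taylor_part (Suc k) f x0 x = (\<Sum>i\<in>UNIV. (x - x0) $ i * taylor_part k (dir_deriv (axis i 1) f) x0 x)" for x
  proof -
    have "taylor_part (Suc k) f x0 x = fold dir_deriv (replicate k (x - x0)) (dir_deriv (x - x0) f) x0"
      by (simp add: taylor_part_def)
    also have "\<dots> = fold dir_deriv (replicate k (x - x0)) (\<lambda>y. \<Sum>i\<in>UNIV. (x - x0) $ i * dir_deriv (axis i 1) f y) x0"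
      by (rule fold_dir_deriv_cong [OF op assms(2) dir_deriv_cdot [OF Suc.prems]])
    also have "\<dots> = (\<Sum>i\<in>UNIV. (x - x0) $ i * fold dir_deriv (replicate k (x - x0)) (dir_deriv (axis i 1) f) x0)"
      by (rule sum) simp
    finally show ?thesis by (simp add: taylor_part_def)
  qed
  then have "taylor_part (Suc k) f x0 = (\<lambda>x. \<Sum>i\<in>UNIV. (x - x0) $ i * taylor_part k (dir_deriv (axis i 1) f) x0 x)"
    by (rule ext)
  then show ?case
    using Suc.IH [OF holo_on_dir_deriv [OF Suc.prems]] by (simp only:) (intro jet_sum jet_mult jet_nth, auto)
qed

lemma vanishes_taylor:
  fixes f :: "'a::cnormed \<Rightarrow> complex"
  assumes f: "holo_on f W" and x0: "x0 \<in> W"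
  shows "vanishes N (\<lambda>x. f x - (\<Sum>k<N. taylor_part k f x0 x / fact k)) x0"
proof -
  have "line_holo f W" using f by (simp add: line_holo_iff_holo)
  then obtain e M where e: "e > 0" "ball x0 e \<subseteq> W" and M: "\<And>y. y \<in> ball x0 e \<Longrightarrow> cmod (f y) \<le> M"
    using line_holo_bdd x0 by metis
  show ?thesis
  proof (rule vanishesI [of "e/4"])
    fix r x assume r: "0 < r" "r < e/4" "norm (x - x0) \<le> r"
    have inb: "x0 + s *\<^sub>C (x - x0) \<in> ball x0 e" if "s \<in> ball 0 (e/r)" for s
    proof -
      have "cmod s * norm (x - x0) \<le> cmod s * r" using r by (intro mult_left_mono) auto
      also have "\<dots> < e" using that r by (simp add: field_simps)
      finally show ?thesis by (simp add: dist_norm norm_scaleC)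
    qed
    have "cmod (f (x0 + 1 *\<^sub>C (x - x0)) - (\<Sum>k<N. (deriv ^^ k) (\<lambda>s. f (x0 + s *\<^sub>C (x - x0))) 0 / fact k * 1 ^ k))
       \<le> 2 * M * (2 * cmod 1 / (e/r)) ^ N"
    proof (rule taylor_remainder_bound)
      show "(\<lambda>s. f (x0 + s *\<^sub>C (x - x0))) holomorphic_on ball 0 (e/r)"
        by (rule holomorphic_on_subset [OF holo_on_line [OF f]]) (use inb e in auto)
    qed (use r e M inb in auto)
    moreover have "(deriv ^^ k) (\<lambda>s. f (x0 + s *\<^sub>C (x - x0))) 0 = taylor_part k f x0 x" for k
      by (simp add: deriv_funpow_line taylor_part_def)
    ultimately have "cmod (f x - (\<Sum>k<N. taylor_part k f x0 x / fact k)) \<le> 2 * M * (2 / (e/r)) ^ N"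
      by simp
    also have "\<dots> = 2 * M * (2 / e) ^ N * r ^ N"
      by (simp add: power_divide power_mult_distrib)
    finally show "cmod (f x - (\<Sum>k<N. taylor_part k f x0 x / fact k)) \<le> 2 * M * (2 / e) ^ N * r ^ N" .
  qed (use e in auto)
qed

lemma jet_holo:
  assumes "holo_on f W" "x0 \<in> W"
  shows "jet N x0 f"
proof -
  let ?T = "\<lambda>x. \<Sum>k<N. (1 / fact k) * taylor_part k f x0 x"
  have "jet N x0 ?T"
    by (intro jet_sum jet_mult jet_taylor_part [OF assms] jet_expoly expoly_const) auto
  then obtain q where q: "expoly q" "vanishes N (\<lambda>x. ?T x - q x) x0" by (auto simp: jet_def)
  have "vanishes N (\<lambda>x. (f x - ?T x) + (?T x - q x)) x0"
    using vanishes_taylor [OF assms, of N] by (intro vanishes_add q) simp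
  then show ?thesis using q by (auto simp: jet_def)
qed

text \<open>A linear functional that depends on a finite jet only is determined by its values on
  exponentials.\<close>

theorem jet_principle:
  fixes L :: "(complex ^ 'n::finite \<Rightarrow> complex) \<Rightarrow> complex"
  assumes W: "open W" "x0 \<in> W"
    and add: "\<And>f g. holo_on f W \<Longrightarrow> holo_on g W \<Longrightarrow> L (\<lambda>x. f x + g x) = L f + L g"
    and cmult: "\<And>c f. holo_on f W \<Longrightarrow> L (\<lambda>x. c * f x) = c * L f"
    and exp: "\<And>a. L (\<lambda>x. exp (cdot a x)) = 0"
    and van: "\<And>f. holo_on f W \<Longrightarrow> vanishes N f x0 \<Longrightarrow> L f = 0"
    and f: "holo_on f W"
  shows "L f = 0"
proof -
  obtain q where q: "expoly q" "vanishes N (\<lambda>x. f x - q x) x0"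
    using jet_holo [OF f W(2)] by (auto simp: jet_def)
  have "L q = 0"
    using q(1) by induction (simp_all add: exp add cmult holo_on_expoly W)
  moreover have "L (\<lambda>x. f x - q x) = 0"
    by (intro van q holo_on_diff f holo_on_expoly W)
  moreover have "L (\<lambda>x. (f x - q x) + q x) = L (\<lambda>x. f x - q x) + L q"
    by (intro add holo_on_diff f holo_on_expoly q W)
  ultimately show ?thesis by simp
qed

text \<open>The multinomial theorem, with functions vanishing off \<open>I\<close> as multi-indices.\<close>

lemma multinomial_fact:
  fixes x :: "'n \<Rightarrow> complex"
  assumes "finite I"
  shows "(\<Sum>\<alpha> | (\<forall>i. i \<notin> I \<longrightarrow> \<alpha> i = 0) \<and> sum \<alpha> I = m. \<Prod>i\<in>I. x i ^ \<alpha> i / fact (\<alpha> i))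
    = (\<Sum>i\<in>I. x i) ^ m / fact m"
  using assms
proof (induction I arbitrary: m rule: finite_induct)
  case empty
  have "{\<alpha> :: 'n \<Rightarrow> nat. (\<forall>i. \<alpha> i = 0) \<and> 0 = m} = (if m = 0 then {\<lambda>_. 0} else {})"
    by auto
  then show ?case by simp
next
  case (insert j I)
  let ?A = "\<lambda>I m. {\<alpha> :: 'n \<Rightarrow> nat. (\<forall>i. i \<notin> I \<longrightarrow> \<alpha> i = 0) \<and> sum \<alpha> I = m}"
  have fin: "finite (?A I m)" if "finite I" for I m
  proof (rule finite_subset)
    show "?A I m \<subseteq> {\<alpha>. \<forall>i. (i \<in> I \<longrightarrow> \<alpha> i \<in> {..m}) \<and> (i \<notin> I \<longrightarrow> \<alpha> i = 0)}"
      using that by (auto intro: member_le_sum)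
    show "finite {\<alpha> :: 'n \<Rightarrow> nat. \<forall>i. (i \<in> I \<longrightarrow> \<alpha> i \<in> {..m}) \<and> (i \<notin> I \<longrightarrow> \<alpha> i = 0)}"
      by (rule finite_set_of_finite_funs) (use that in auto)
  qed
  have upd: "(\<Sum>i\<in>I. if i = j then k else \<beta> i) = sum \<beta> I" for \<beta> :: "'n \<Rightarrow> nat" and k
    using insert.hyps by (intro sum.cong) auto
  have "(\<Sum>\<alpha>\<in>?A (insert j I) m. \<Prod>i\<in>insert j I. x i ^ \<alpha> i / fact (\<alpha> i))
      = (\<Sum>(k, \<beta>)\<in>Sigma {..m} (\<lambda>k. ?A I (m - k)). x j ^ k / fact k * (\<Prod>i\<in>I. x i ^ \<beta> i / fact (\<beta> i)))"
  proof (rule sum.reindex_bij_witness [where i = "\<lambda>(k, \<beta>). \<beta>(j := k)" and j = "\<lambda>\<alpha>. (\<alpha> j, \<alpha>(j := 0))"])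
    fix \<alpha> assume a: "\<alpha> \<in> ?A (insert j I) m"
    show "(case (\<alpha> j, \<alpha>(j := 0)) of (k, \<beta>) \<Rightarrow> \<beta>(j := k)) = \<alpha>" by simp
    show "(\<alpha> j, \<alpha>(j := 0)) \<in> Sigma {..m} (\<lambda>k. ?A I (m - k))"
      using a insert.hyps by (auto simp: upd)
    have "(\<Prod>i\<in>I. x i ^ (\<alpha>(j := 0)) i / fact ((\<alpha>(j := 0)) i)) = (\<Prod>i\<in>I. x i ^ \<alpha> i / fact (\<alpha> i))"
      using insert.hyps by (intro prod.cong) auto
    then show "(case (\<alpha> j, \<alpha>(j := 0)) of (k, \<beta>) \<Rightarrow> x j ^ k / fact k * (\<Prod>i\<in>I. x i ^ \<beta> i / fact (\<beta> i)))
        = (\<Prod>i\<in>insert j I. x i ^ \<alpha> i / fact (\<alpha> i))"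
      using insert.hyps by simp
  next
    fix p assume "p \<in> Sigma {..m} (\<lambda>k. ?A I (m - k))"
    then obtain k \<beta> where p: "p = (k, \<beta>)" "k \<le> m" "\<forall>i. i \<notin> I \<longrightarrow> \<beta> i = 0" "sum \<beta> I = m - k" by auto
    then show "((case p of (k, \<beta>) \<Rightarrow> \<beta>(j := k)) j, (case p of (k, \<beta>) \<Rightarrow> \<beta>(j := k))(j := 0)) = p"
      using insert.hyps by (auto simp: fun_eq_iff)
    show "(case p of (k, \<beta>) \<Rightarrow> \<beta>(j := k)) \<in> ?A (insert j I) m"
      using p insert.hyps by (auto simp: upd)
  qed
  also have "\<dots> = (\<Sum>k\<le>m. \<Sum>\<beta>\<in>?A I (m - k). x j ^ k / fact k * (\<Prod>i\<in>I. x i ^ \<beta> i / fact (\<beta> i)))"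
    by (rule sum.Sigma [symmetric]) (use fin insert.hyps in auto)
  also have "\<dots> = (\<Sum>k\<le>m. x j ^ k / fact k * ((\<Sum>i\<in>I. x i) ^ (m - k) / fact (m - k)))"
    by (simp only: sum_distrib_left [symmetric] insert.IH)
  also have "\<dots> = (\<Sum>k\<le>m. of_nat (m choose k) * x j ^ k * (\<Sum>i\<in>I. x i) ^ (m - k)) / fact m"
    unfolding sum_divide_distrib by (rule sum.cong) (auto simp: binomial_fact field_simps)
  also have "\<dots> = (\<Sum>i\<in>insert j I. x i) ^ m / fact m"
    using insert.hyps by (simp add: binomial_ring)
  finally show ?case .
qed

lemma norm_le_maxnorm: "norm z \<le> real CARD('n) * maxnorm (z :: complex ^ 'n::finite)"
proof -
  have "norm z \<le> (\<Sum>i\<in>UNIV. cmod (z $ i))" unfolding norm_vec_def by (rule L2_set_le_sum) simp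
  also have "\<dots> \<le> (\<Sum>i\<in>(UNIV :: 'n set). maxnorm z)" by (intro sum_mono norm_nth_le_maxnorm)
  finally show ?thesis by simp
qed

lemma maxnorm_le_norm: "maxnorm z \<le> norm z"
  by (simp add: maxnorm_le_iff Finite_Cartesian_Product.norm_nth_le)

lemma multi_deriv_vanishes:
  fixes f :: "complex ^ 'n::finite \<Rightarrow> complex"
  assumes f: "holo_on f W" and x0: "x0 \<in> W" and van: "vanishes N f x0" and N: "(\<Sum>i\<in>UNIV. \<alpha> i) < N"
  shows "multi_deriv \<alpha> f x0 = 0"
proof -
  define m where "m = (\<Sum>i\<in>UNIV. \<alpha> i)"
  define F where "F = (\<Prod>i\<in>UNIV. fact (\<alpha> i) :: real)"
  define n where "n = real CARD('n)"
  have n: "n > 0" by (simp add: n_def)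
  have F: "F > 0" by (simp add: F_def prod_pos)
  obtain C r0 where C: "0 < r0" "0 \<le> C" "\<And>s x. 0 < s \<Longrightarrow> s < r0 \<Longrightarrow> norm (x - x0) \<le> s \<Longrightarrow> cmod (f x) \<le> C * s ^ Suc m"
    by (rule vanishesE [OF vanishes_mono [OF van, of "Suc m"]]) (use N in \<open>simp add: m_def\<close>, rule that)
  obtain e where e: "0 < e" "ball x0 e \<subseteq> W" using holo_on_open [OF f] x0 openE by blast
  have "cmod (multi_deriv \<alpha> f x0) \<le> (F * C * n ^ Suc m) * r" if r: "0 < r" "r < min r0 e / n" for r
  proof -
    have nr: "n * r < r0" "n * r < e" using r n by (auto simp: pos_less_divide_eq mult.commute)
    have "cmod (multi_deriv \<alpha> f x0) \<le> F * (C * (n * r) ^ Suc m) / r ^ m"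
      unfolding F_def m_def
    proof (rule multi_deriv_bound [OF f r(1)], unfold m_def [symmetric])
      fix y assume y: "maxnorm (y - x0) \<le> r"
      have "norm (y - x0) \<le> n * r"
        using norm_le_maxnorm [of "y - x0"] y n by (simp add: n_def) (meson mult_left_mono of_nat_0_le_iff order_trans)
      then show "y \<in> W \<and> cmod (f y) \<le> C * (n * r) ^ Suc m"
        using C(3) [of "n * r" y] nr e n r by (auto simp: dist_norm norm_minus_commute)
    qed
    also have "\<dots> = (F * C * n ^ Suc m) * r"
      using r by (simp add: power_mult_distrib)
    finally show ?thesis .
  qed
  then have "cmod (multi_deriv \<alpha> f x0) \<le> 0"
    by (rule nonpos_if_le_linear [of "min r0 e / n", rotated]) (use C e n in auto)
  then show ?thesis by simp
qed

lemma fold_dir_deriv_exp: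
  "fold dir_deriv vs (\<lambda>x. exp (cdot a x)) = (\<lambda>x. prod_list (map (cdot a) vs) * exp (cdot a x))"
proof -
  have ddv: "dir_deriv v (\<lambda>x. c * exp (cdot a x)) = (\<lambda>x. (c * cdot a v) * exp (cdot a x))" for v c
  proof
    fix x
    have "((\<lambda>s. c * exp (cdot a x + s * cdot a v)) has_field_derivative c * (exp (cdot a x + 0 * cdot a v) * cdot a v)) (at 0)"
      by (auto intro!: derivative_eq_intros)
    then show "dir_deriv v (\<lambda>x. c * exp (cdot a x)) x = (c * cdot a v) * exp (cdot a x)"
      by (simp add: dir_deriv_def DERIV_imp_deriv)
  qed
  have "fold dir_deriv vs (\<lambda>x. c * exp (cdot a x)) = (\<lambda>x. c * prod_list (map (cdot a) vs) * exp (cdot a x))" for c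
  proof (induction vs arbitrary: c)
    case (Cons v vs)
    show ?case unfolding fold_Cons o_apply ddv Cons.IH by (simp add: mult_ac)
  qed simp
  from this [of 1] show ?thesis by simp
qed

lemma multi_deriv_exp: "multi_deriv \<alpha> (\<lambda>x. exp (cdot a x)) x = (\<Prod>i\<in>UNIV. (a $ i) ^ \<alpha> i) * exp (cdot a x)"
proof -
  have "distinct is \<Longrightarrow> prod_list (map (cdot a) (concat (map (\<lambda>i. replicate (\<alpha> i) (axis i 1)) is)))
      = (\<Prod>i\<in>set is. (a $ i) ^ \<alpha> i)" for "is"
    by (induction "is") (auto simp: prod_list_replicate)
  from this [OF index_list(1)] show ?thesis
    by (simp add: multi_deriv_eq_fold_dir_deriv fold_dir_deriv_exp dirs_def index_list)
qed

lemma deriv_line_vanishes: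
  assumes f: "holo_on f W" and x0: "x0 \<in> W" and van: "vanishes N f x0" and N: "m < N"
  shows "(deriv ^^ m) (\<lambda>s. f (x0 + s *\<^sub>C (a::'a::cnormed))) 0 = 0"
proof -
  define n where "n = norm a + 1"
  have n: "n > 0" by (simp add: n_def add_nonneg_pos)
  obtain C r0 where C: "0 < r0" "0 \<le> C" "\<And>s x. 0 < s \<Longrightarrow> s < r0 \<Longrightarrow> norm (x - x0) \<le> s \<Longrightarrow> cmod (f x) \<le> C * s ^ Suc m"
    by (rule vanishesE [OF vanishes_mono [OF van, of "Suc m"]]) (use N in simp, rule that)
  obtain e where e: "0 < e" "ball x0 e \<subseteq> W" using holo_on_open [OF f] x0 openE by blast
  have "cmod ((deriv ^^ m) (\<lambda>s. f (x0 + s *\<^sub>C a)) 0) \<le> (fact m * C * n ^ Suc m) * r" if r: "0 < r" "r < min r0 e / n" for r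
  proof -
    have nr: "n * r < r0" "n * r < e" using r n by (auto simp: pos_less_divide_eq mult.commute)
    have nl: "norm (s *\<^sub>C a) \<le> n * r" if "cmod s \<le> r" for s
      using mult_mono [OF that, of "norm a" n] r by (simp add: norm_scaleC n_def mult.commute)
    have "cmod ((deriv ^^ m) (\<lambda>s. f (x0 + s *\<^sub>C a)) 0) \<le> fact m * (C * (n * r) ^ Suc m) / r ^ m"
    proof (rule cauchy_bound [OF holo_on_line [OF f] open_line [OF holo_on_open [OF f]] _ r(1)])
      show "cball 0 r \<subseteq> {s. x0 + s *\<^sub>C a \<in> W}"
        using nl nr e by (fastforce simp: dist_norm)
      show "cmod (f (x0 + s *\<^sub>C a)) \<le> C * (n * r) ^ Suc m" if "cmod s \<le> r" for s
        using C(3) [of "n * r" "x0 + s *\<^sub>C a"] nl [OF that] nr n r by simp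
    qed
    also have "\<dots> = (fact m * C * n ^ Suc m) * r"
      using r by (simp add: power_mult_distrib)
    finally show ?thesis .
  qed
  then have "cmod ((deriv ^^ m) (\<lambda>s. f (x0 + s *\<^sub>C a)) 0) \<le> 0"
    by (rule nonpos_if_le_linear [of "min r0 e / n", rotated]) (use C e n in auto)
  then show ?thesis by simp
qed

text \<open>The multinomial expansion of \<open>\<langle>a, \<partial>\<rangle>\<^bsup>m\<^esup> / m!\<close>; on exponentials it is the multinomial theorem.\<close>

theorem directional_taylor:
  fixes f :: "complex ^ 'n::finite \<Rightarrow> complex"
  assumes f: "holo_on f W" and W: "0 \<in> W"
  shows "(\<Sum>\<alpha>\<in>mindex m. (\<Prod>i\<in>UNIV. (a $ i) ^ \<alpha> i) / (\<Prod>i\<in>UNIV. fact (\<alpha> i)) * multi_deriv \<alpha> f 0)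
    = (deriv ^^ m) (\<lambda>s. f (s *\<^sub>C a)) 0 / fact m"
proof -
  let ?c = "\<lambda>\<alpha>. (\<Prod>i\<in>UNIV. (a $ i) ^ \<alpha> i) / (\<Prod>i\<in>UNIV. fact (\<alpha> i))"
  define L where "L f = (\<Sum>\<alpha>\<in>mindex m. ?c \<alpha> * fold dir_deriv (dirs \<alpha>) f 0)
    - fold dir_deriv (replicate m a) f 0 / fact m" for f :: "complex ^ 'n \<Rightarrow> complex"
  have L_eq: "L f = (\<Sum>\<alpha>\<in>mindex m. ?c \<alpha> * multi_deriv \<alpha> f 0) - (deriv ^^ m) (\<lambda>s. f (0 + s *\<^sub>C a)) 0 / fact m" for f
    unfolding L_def deriv_funpow_line multi_deriv_eq_fold_dir_deriv by simp
  have "L f = 0"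
  proof (rule jet_principle [where L = L and f = f and W = W and ?x0.0 = 0 and N = "Suc m"])
    show "open W" using f by (rule holo_on_open)
    show "L (\<lambda>x. f x + g x) = L f + L g" if "holo_on f W" "holo_on g W" for f g
      unfolding L_def fold_dir_deriv_add_fun [OF that W]
      by (simp add: distrib_left sum.distrib add_divide_distrib)
    show "L (\<lambda>x. c * f x) = c * L f" if "holo_on f W" for c f
      unfolding L_def fold_dir_deriv_cmult_fun [OF that W]
      by (simp add: right_diff_distrib sum_distrib_left mult.left_commute)
    show "L f = 0" if "holo_on f W" "vanishes (Suc m) f 0" for f
      unfolding L_eq using multi_deriv_vanishes [OF that(1) W that(2)] deriv_line_vanishes [OF that(1) W that(2), of m a]
      by (auto simp: mindex_def intro!: sum.neutral)
    show "L (\<lambda>x. exp (cdot b x)) = 0" for b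
    proof -
      have "(\<Sum>\<alpha>\<in>mindex m. ?c \<alpha> * multi_deriv \<alpha> (\<lambda>x. exp (cdot b x)) 0)
          = (\<Sum>\<alpha>\<in>mindex m. \<Prod>i\<in>UNIV. (a $ i * b $ i) ^ \<alpha> i / fact (\<alpha> i))"
        by (rule sum.cong) (simp_all add: multi_deriv_exp prod_dividef power_mult_distrib prod.distrib)
      also have "\<dots> = cdot a b ^ m / fact m"
        using multinomial_fact [where I = UNIV and m = m and x = "\<lambda>i. a $ i * b $ i"] by (simp add: mindex_def cdot_def)
      also have "\<dots> = fold dir_deriv (replicate m a) (\<lambda>x. exp (cdot b x)) 0 / fact m"
        unfolding fold_dir_deriv_exp by (simp add: prod_list_replicate cdot_commute [of b a])
      finally show ?thesis by (simp add: L_def multi_deriv_eq_fold_dir_deriv)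
    qed
  qed (use W f in auto)
  then show ?thesis by (simp add: L_eq)
qed


section \<open>The transformation operator at a point\<close>

text \<open>The operator \<open>T\<^sub>M\<^bsup>m\<^esup>\<close> on functions of the fibre variable.\<close>

definition transform ::
    "(complex ^ 'n::finite \<Rightarrow> complex ^ 'n ^ 'n) \<Rightarrow> nat \<Rightarrow> (complex ^ 'n \<Rightarrow> complex) \<Rightarrow> complex ^ 'n \<Rightarrow> complex"
  where "transform M m p lam = contract m (\<lambda>z \<zeta>. p (\<zeta> + transpose (M z) *v lam))"

lemma holo_on_shift:
  fixes M :: "complex ^ 'n::finite \<Rightarrow> complex ^ 'n ^ 'n" and l :: "'e::cnormed \<Rightarrow> complex ^ 'n"
  assumes M: "holo_on M WM" and l: "holo_on l Y"
  shows "holo_on (\<lambda>x. snd (snd x) + transpose (M (fst (snd x))) *v l (fst x)) {x. fst x \<in> Y \<and> fst (snd x) \<in> WM}"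
proof -
  let ?X = "{x :: 'e \<times> (complex ^ 'n) \<times> (complex ^ 'n). fst x \<in> Y \<and> fst (snd x) \<in> WM}"
  have "?X = Y \<times> WM \<times> UNIV" by auto
  then have op: "open ?X"
    using holo_on_open [OF M] holo_on_open [OF l] by (simp add: open_Times)
  have 1: "holo_on (\<lambda>x. M (fst (snd x))) ?X"
    by (rule holo_on_compose' [OF M]) (auto intro!: holo_on_fst holo_on_snd holo_on_ident op)
  have 2: "holo_on (\<lambda>x. l (fst x)) ?X"
    by (rule holo_on_compose' [OF l]) (auto intro!: holo_on_fst holo_on_ident op)
  show ?thesis
    by (intro holo_on_add holo_on_snd holo_on_ident op holo_on_matrix_vector_mult holo_on_transpose 1 2)
qed

lemma matrix_mult_zero [simp]: "A *v (0 :: complex ^ 'n::finite) = 0"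
  by (simp add: matrix_vector_mult_def vec_eq_iff)

lemma holo_on_transform:
  fixes M :: "complex ^ 'n::finite \<Rightarrow> complex ^ 'n ^ 'n"
  assumes M: "holo_on M WM" "0 \<in> WM" and p: "holo_on p Wp"
  shows "holo_on (transform M m p) {lam. transpose (M 0) *v lam \<in> Wp}"
proof -
  let ?f = "\<lambda>x :: (complex ^ 'n) \<times> (complex ^ 'n) \<times> (complex ^ 'n). snd (snd x) + transpose (M (fst (snd x))) *v fst x"
  let ?V = "{lam. transpose (M 0) *v lam \<in> Wp}"
  have lin: "holo_on (\<lambda>lam. transpose (M 0) *v lam) UNIV"
    by (intro holo_on_matrix_vector_mult holo_on_const holo_on_ident) auto
  have op: "open ?V"
    using holo_on_open [OF holo_on_compose [OF p lin]] by simp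
  have f: "holo_on ?f {x. fst x \<in> UNIV \<and> fst (snd x) \<in> WM}"
    by (rule holo_on_shift [OF M(1) holo_on_ident [OF open_UNIV]])
  have "holo_on (\<lambda>lam. contract m (\<lambda>z \<zeta>. p (?f (lam, z, \<zeta>)))) ?V"
    by (rule holo_on_contract [OF holo_on_compose [OF p f] op]) (use M in auto)
  then show ?thesis by (simp add: transform_def [abs_def])
qed

lemma shift_domain:
  fixes M :: "complex ^ 'n::finite \<Rightarrow> complex ^ 'n ^ 'n"
  assumes M: "holo_on M WM" and p: "holo_on p Wp"
  shows "holo_on (\<lambda>(z, \<zeta>). p (\<zeta> + transpose (M z) *v lam)) {(z, \<zeta>). z \<in> WM \<and> \<zeta> + transpose (M z) *v lam \<in> Wp}"
proof -
  have f: "holo_on (\<lambda>x. snd x + transpose (M (fst x)) *v lam) (WM \<times> UNIV)"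
    by (intro holo_on_add holo_on_snd holo_on_ident holo_on_matrix_vector_mult holo_on_transpose
        holo_on_compose' [OF M] holo_on_fst holo_on_const open_Times holo_on_open [OF M] open_UNIV) auto
  have "holo_on (\<lambda>x. p (snd x + transpose (M (fst x)) *v lam)) {x \<in> WM \<times> UNIV. snd x + transpose (M (fst x)) *v lam \<in> Wp}"
    by (rule holo_on_compose [OF p f])
  moreover have "{x \<in> WM \<times> UNIV. snd x + transpose (M (fst x)) *v lam \<in> Wp}
      = {(z, \<zeta>). z \<in> WM \<and> \<zeta> + transpose (M z) *v lam \<in> Wp}" by auto
  ultimately show ?thesis by (simp add: case_prod_unfold)
qed

lemma transform_linear:
  assumes M: "holo_on M WM" "0 \<in> WM" and lam: "transpose (M 0) *v lam \<in> Wp" and p: "holo_on p Wp"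
  shows transform_add: "holo_on q Wp \<Longrightarrow> transform M m (\<lambda>x. p x + q x) lam = transform M m p lam + transform M m q lam"
    and transform_cmult: "transform M m (\<lambda>x. c * p x) lam = c * transform M m p lam"
proof -
  show "transform M m (\<lambda>x. p x + q x) lam = transform M m p lam + transform M m q lam" if "holo_on q Wp"
    unfolding transform_def
    by (rule contract_add [OF _ shift_domain [OF M(1) p] shift_domain [OF M(1) that]]) (use M lam in auto)
  show "transform M m (\<lambda>x. c * p x) lam = c * transform M m p lam"
    unfolding transform_def
    by (rule contract_cmult [OF _ shift_domain [OF M(1) p]]) (use M lam in auto)
qed

lemma transform_cong:
  assumes M: "holo_on M WM" "0 \<in> WM" and lam: "transpose (M 0) *v lam \<in> Wp" and op: "open Wp"
    and eq: "\<And>x. x \<in> Wp \<Longrightarrow> p x = q x"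
  shows "transform M m p lam = transform M m q lam"
  unfolding transform_def
proof (rule contract_cong)
  show "open {(z, \<zeta>). z \<in> WM \<and> \<zeta> + transpose (M z) *v lam \<in> Wp}"
    by (rule holo_on_open [OF shift_domain [OF M(1) holo_on_const [OF op, of "0::complex"]]])
qed (use M lam eq in auto)

lemma dir_deriv_transform:
  fixes P :: "'e::cnormed \<times> (complex ^ 'n::finite) \<Rightarrow> complex"
  assumes M: "holo_on M WM" "0 \<in> WM" and P: "holo_on P WP" and y: "(y, transpose (M 0) *v lam) \<in> WP"
  shows "dir_deriv u (\<lambda>y. transform M m (\<lambda>\<zeta>. P (y, \<zeta>)) lam) y = transform M m (\<lambda>\<zeta>. dir_deriv (u, 0) P (y, \<zeta>)) lam"
proof -
  let ?f = "\<lambda>x :: 'e \<times> (complex ^ 'n) \<times> (complex ^ 'n). (fst x, snd (snd x) + transpose (M (fst (snd x))) *v lam)"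
  have f: "holo_on ?f {x. fst x \<in> UNIV \<and> fst (snd x) \<in> WM}"
    by (intro holo_on_Pair holo_on_shift [OF M(1) holo_on_const [OF open_UNIV]] holo_on_fst holo_on_ident
        holo_on_open [OF holo_on_shift [OF M(1) holo_on_const [OF open_UNIV, of lam]]])
  have H: "holo_on (\<lambda>x. P (?f x)) {x \<in> {x. fst x \<in> UNIV \<and> fst (snd x) \<in> WM}. ?f x \<in> WP}"
    by (rule holo_on_compose [OF P f])
  have "dir_deriv u (\<lambda>y. contract m (\<lambda>z \<zeta>. P (?f (y, z, \<zeta>)))) y
      = contract m (\<lambda>z \<zeta>. dir_deriv (u, 0, 0) (\<lambda>x. P (?f x)) (y, z, \<zeta>))"
    by (rule dir_deriv_contract [OF H]) (use M y in auto)
  then show ?thesis by (simp add: transform_def dir_deriv_def Pair_scaleC)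
qed

lemma holo_on_lipschitz:
  assumes f: "holo_on f W" and x: "x \<in> W"
  obtains B d where "0 < B" "0 < d" "\<And>y. norm (y - x) < d \<Longrightarrow> y \<in> W \<and> norm (f y - f x) \<le> B * norm (y - x)"
proof -
  obtain D where D: "(f has_derivative D) (at x)" using f x by (auto simp: holo_on_def)
  then have bl: "bounded_linear D" by (rule has_derivative_bounded_linear)
  obtain K where K: "K > 0" "\<And>h. norm (D h) \<le> norm h * K" using bounded_linear.pos_bounded [OF bl] by blast
  obtain d where d: "d > 0" "\<And>y. norm (y - x) < d \<Longrightarrow> norm (f y - f x - D (y - x)) \<le> 1 * norm (y - x)"
    using D unfolding has_derivative_at_alt by (metis zero_less_one)
  obtain e where e: "e > 0" "ball x e \<subseteq> W" using holo_on_open [OF f] x openE by blast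
  show ?thesis
  proof (rule that [of "K + 1" "min d e"])
    fix y assume y: "norm (y - x) < min d e"
    have "norm (f y - f x) \<le> norm (f y - f x - D (y - x)) + norm (D (y - x))"
      using norm_triangle_ineq [of "f y - f x - D (y - x)" "D (y - x)"] by simp
    also have "\<dots> \<le> 1 * norm (y - x) + norm (y - x) * K"
      using y by (intro add_mono d K) auto
    finally show "y \<in> W \<and> norm (f y - f x) \<le> (K + 1) * norm (y - x)"
      using y e by (auto simp: algebra_simps dist_norm norm_minus_commute subset_iff)
  qed (use K d e in auto)
qed

text \<open>The operator has order \<open>2 m\<close>: by the Cauchy estimate on polydiscs of radius \<open>r\<close> in both groups
  of variables, it lowers the order of vanishing by at most \<open>2 m\<close>.\<close>

lemma vanishes_transform:
  fixes M :: "complex ^ 'n::finite \<Rightarrow> complex ^ 'n ^ 'n"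
  assumes M: "holo_on M WM" "0 \<in> WM" and p: "holo_on p Wp" and lam: "transpose (M 0) *v lam0 \<in> Wp"
    and van: "vanishes (N + 2 * m) p (transpose (M 0) *v lam0)"
  shows "vanishes N (transform M m p) lam0"
proof -
  define \<zeta>0 where "\<zeta>0 = transpose (M 0) *v lam0"
  let ?f = "\<lambda>x :: (complex ^ 'n) \<times> (complex ^ 'n) \<times> (complex ^ 'n). snd (snd x) + transpose (M (fst (snd x))) *v fst x"
  have f: "holo_on ?f {x. fst x \<in> UNIV \<and> fst (snd x) \<in> WM}"
    by (rule holo_on_shift [OF M(1) holo_on_ident [OF open_UNIV]])
  have f0: "?f (lam0, 0, 0) = \<zeta>0" by (simp add: \<zeta>0_def)
  obtain B d where B: "0 < B" "0 < d"
    "\<And>x. norm (x - (lam0, 0, 0)) < d \<Longrightarrow> x \<in> {x. fst x \<in> UNIV \<and> fst (snd x) \<in> WM} \<and> norm (?f x - \<zeta>0) \<le> B * norm (x - (lam0, 0, 0))"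
    by (rule holo_on_lipschitz [OF f, of "(lam0, 0, 0)", unfolded f0]) (use M in auto)
  obtain C r0 where C: "0 < r0" "0 \<le> C" "\<And>r x. 0 < r \<Longrightarrow> r < r0 \<Longrightarrow> norm (x - \<zeta>0) \<le> r \<Longrightarrow> cmod (p x) \<le> C * r ^ (N + 2 * m)"
    by (rule vanishesE [OF van, folded \<zeta>0_def]) (rule that)
  obtain e where e: "e > 0" "ball \<zeta>0 e \<subseteq> Wp" using holo_on_open [OF p] lam openE unfolding \<zeta>0_def by blast
  define n where "n = 1 + 2 * real CARD('n)"
  define b where "b = B * n"
  have n: "n \<ge> 1" and b: "b > 0" using B by (auto simp: n_def b_def)
  define \<epsilon> where "\<epsilon> = min (d / n) (min r0 e / b)"
  have \<epsilon>: "\<epsilon> > 0" using B C e n b by (auto simp: \<epsilon>_def)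
  show ?thesis
  proof (rule vanishesI [OF \<epsilon>])
    fix r lam assume r: "0 < r" "r < \<epsilon>" "norm (lam - lam0) \<le> r"
    have nr: "n * r < d" "b * r < r0" "b * r < e"
      using r n b by (auto simp: \<epsilon>_def pos_less_divide_eq mult.commute)
    have box: "z \<in> WM \<and> ?f (lam, z, \<zeta>) \<in> Wp \<and> cmod (p (?f (lam, z, \<zeta>))) \<le> C * (b * r) ^ (N + 2 * m)"
      if z: "maxnorm z \<le> r" "maxnorm \<zeta> \<le> r" for z \<zeta>
    proof -
      have bz: "norm w \<le> real CARD('n) * r" if "maxnorm w \<le> r" for w :: "complex ^ 'n"
        using norm_le_maxnorm [of w] mult_left_mono [OF that, of "real CARD('n)"] by linarith
      have "norm ((lam, z, \<zeta>) - (lam0, 0, 0)) \<le> norm (lam - lam0) + norm (z, \<zeta>)"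
        using norm_Pair_le [of "lam - lam0" "(z, \<zeta>)"] by simp
      also have "\<dots> \<le> r + (norm z + norm \<zeta>)" using r(3) norm_Pair_le by (rule add_mono)
      also have "\<dots> \<le> n * r" using bz [OF z(1)] bz [OF z(2)] by (simp add: n_def algebra_simps)
      finally have x: "norm ((lam, z, \<zeta>) - (lam0, 0, 0)) \<le> n * r" .
      then have "z \<in> WM" and "norm (?f (lam, z, \<zeta>) - \<zeta>0) \<le> B * norm ((lam, z, \<zeta>) - (lam0, 0, 0))"
        using B(3) [of "(lam, z, \<zeta>)"] nr by auto
      moreover have "B * norm ((lam, z, \<zeta>) - (lam0, 0, 0)) \<le> b * r"
        using mult_left_mono [OF x, of B] B by (simp add: b_def mult.assoc)
      ultimately have "z \<in> WM" and le: "norm (?f (lam, z, \<zeta>) - \<zeta>0) \<le> b * r" by auto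
      moreover have "?f (lam, z, \<zeta>) \<in> ball \<zeta>0 e"
        using le nr by (simp add: dist_norm norm_minus_commute)
      ultimately show ?thesis using C(3) [OF _ _ le] e b r nr by auto
    qed
    have "cmod (transform M m p lam) \<le> (2 ^ CARD('n)) ^ m * fact m * (C * (b * r) ^ (N + 2 * m)) / (r * r) ^ m"
      unfolding transform_def
      by (rule contract_bound [OF shift_domain [OF M(1) p] r(1) r(1)]) (use box in auto)
    also have "\<dots> = ((2 ^ CARD('n)) ^ m * fact m * C * b ^ (N + 2 * m)) * r ^ N"
      using r(1) by (simp add: power_mult_distrib power_add power_mult power2_eq_square)
    finally show "cmod (transform M m p lam) \<le> ((2 ^ CARD('n)) ^ m * fact m * C * b ^ (N + 2 * m)) * r ^ N" .
  qed
qed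

lemma transform_exp:
  fixes M :: "complex ^ 'n::finite \<Rightarrow> complex ^ 'n ^ 'n"
  assumes M: "holo_on M WM" "0 \<in> WM"
  shows "transform M m (\<lambda>\<zeta>. exp (cdot a \<zeta>)) lam = (deriv ^^ m) (\<lambda>s. exp (cdot (M (s *\<^sub>C a) *v a) lam)) 0 / fact m"
proof -
  define g where "g z = exp (cdot (M z *v a) lam)" for z
  have op: "open WM" using M(1) by (rule holo_on_open)
  have g: "holo_on g WM"
    unfolding g_def by (intro holo_on_exp holo_on_cdot holo_on_matrix_vector_mult holo_on_const op M)
  have "multi_deriv \<alpha> (\<lambda>\<zeta>. multi_deriv \<alpha> (\<lambda>z. exp (cdot a (\<zeta> + transpose (M z) *v lam))) 0) 0
      = (\<Prod>i\<in>UNIV. (a $ i) ^ \<alpha> i) * multi_deriv \<alpha> g 0" for \<alpha>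
  proof -
    have "multi_deriv \<alpha> (\<lambda>z. exp (cdot a (\<zeta> + transpose (M z) *v lam))) 0 = multi_deriv \<alpha> g 0 * exp (cdot a \<zeta>)" for \<zeta>
    proof -
      have "(\<lambda>z. exp (cdot a (\<zeta> + transpose (M z) *v lam))) = (\<lambda>z. exp (cdot a \<zeta>) * g z)"
        by (simp only: g_def cdot_simps exp_add cdot_transpose)
      then show ?thesis
        by (simp add: multi_deriv_eq_fold_dir_deriv fold_dir_deriv_cmult_fun [OF g M(2)])
    qed
    then have "multi_deriv \<alpha> (\<lambda>\<zeta>. multi_deriv \<alpha> (\<lambda>z. exp (cdot a (\<zeta> + transpose (M z) *v lam))) 0) 0
      = multi_deriv \<alpha> g 0 * multi_deriv \<alpha> (\<lambda>\<zeta>. exp (cdot a \<zeta>)) 0"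
      by (simp add: multi_deriv_eq_fold_dir_deriv fold_dir_deriv_cmult_fun [OF holo_on_expoly [OF expoly_exp open_UNIV]])
    then show ?thesis by (simp add: multi_deriv_exp)
  qed
  then have "transform M m (\<lambda>\<zeta>. exp (cdot a \<zeta>)) lam
      = (\<Sum>\<alpha>\<in>mindex m. (\<Prod>i\<in>UNIV. (a $ i) ^ \<alpha> i) / (\<Prod>i\<in>UNIV. fact (\<alpha> i)) * multi_deriv \<alpha> g 0)"
    by (simp add: transform_def contract_def)
  also have "\<dots> = (deriv ^^ m) (\<lambda>s. g (s *\<^sub>C a)) 0 / fact m"
    by (rule directional_taylor [OF g M(2)])
  finally show ?thesis by (simp add: g_def)
qed

text \<open>The binomial theorem for two commuting directional derivatives.\<close>

lemma fold_dir_deriv_sum_directions: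
  fixes F :: "'a::cnormed \<Rightarrow> complex"
  assumes F: "holo_on F W" and x: "x \<in> W"
  shows "fold dir_deriv (replicate m (u + v)) F x / fact m
    = (\<Sum>j\<le>m. fold dir_deriv (replicate j u) (fold dir_deriv (replicate (m - j) v) F) x / (fact j * fact (m - j)))"
  using x
proof (induction m arbitrary: x)
  case 0
  then show ?case by simp
next
  case (Suc m)
  have op: "open W" using F by (rule holo_on_open)
  define A where "A j l = fold dir_deriv (replicate j u) (fold dir_deriv (replicate l v) F)" for j l
  have A: "holo_on (A j l) W" for j l unfolding A_def by (intro holo_on_fold_dir_deriv F)
  have Au: "dir_deriv u (A j l) = A (Suc j) l" for j l unfolding A_def by (simp only: fold_dir_deriv_replicate_Suc)
  have Av: "dir_deriv v (A j l) x = A j (Suc l) x" if "x \<in> W" for j l x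
  proof -
    have "dir_deriv v (A j l) x = fold dir_deriv (replicate j u) (dir_deriv v (fold dir_deriv (replicate l v) F)) x"
      unfolding A_def by (rule dir_deriv_fold_dir_deriv_commute [OF holo_on_fold_dir_deriv [OF F] that])
    then show ?thesis unfolding A_def by (simp only: fold_dir_deriv_replicate_Suc)
  qed
  define c where "c m x = (\<Sum>j\<le>m. (1 / (fact j * fact (m - j))) * A j (m - j) x)" for m x
  have IH: "fold dir_deriv (replicate m (u + v)) F y = fact m * c m y" if "y \<in> W" for y
    using Suc.IH [OF that] by (simp add: c_def A_def field_simps)
  have hc: "holo_on (c m) W" unfolding c_def
    by (intro holo_on_sum holo_on_mult holo_on_const A op) auto
  have l: "line_holo (c m) W" using hc by (simp add: line_holo_iff_holo)
  have ddc: "dir_deriv w (c m) x = (\<Sum>j\<le>m. (1 / (fact j * fact (m - j))) * dir_deriv w (A j (m - j)) x)" for w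
  proof -
    have "dir_deriv w (c m) x = (\<Sum>j\<le>m. dir_deriv w (\<lambda>x. (1 / (fact j * fact (m - j))) * A j (m - j) x) x)"
      unfolding c_def [abs_def]
      by (intro dir_deriv_sum_fun [OF finite_atMost _ op Suc.prems] holo_on_mult holo_on_const A op)
    then show ?thesis by (simp only: dir_deriv_cmult_fun [OF A Suc.prems])
  qed
  let ?B = "\<lambda>j. A j (Suc m - j) x / (fact j * fact (Suc m - j))"
  have 1: "dir_deriv u (c m) x = (\<Sum>j\<le>Suc m. of_nat j * ?B j)"
  proof -
    have "(\<Sum>j\<le>Suc m. of_nat j * ?B j) = (\<Sum>j\<le>m. of_nat (Suc j) * ?B (Suc j))"
      by (subst sum.atMost_Suc_shift) simp
    also have "\<dots> = (\<Sum>j\<le>m. (1 / (fact j * fact (m - j))) * A (Suc j) (m - j) x)"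
      by (rule sum.cong) (auto simp: field_simps simp del: of_nat_Suc)
    finally show ?thesis by (simp only: ddc Au)
  qed
  have 2: "dir_deriv v (c m) x = (\<Sum>j\<le>Suc m. of_nat (Suc m - j) * ?B j)"
  proof -
    have "(\<Sum>j\<le>Suc m. of_nat (Suc m - j) * ?B j) = (\<Sum>j\<le>m. of_nat (Suc m - j) * ?B j)"
      by simp
    also have "\<dots> = (\<Sum>j\<le>m. (1 / (fact j * fact (m - j))) * A j (Suc (m - j)) x)"
      by (rule sum.cong) (auto simp: field_simps Suc_diff_le simp del: of_nat_Suc)
    finally show ?thesis by (simp only: ddc Av [OF Suc.prems])
  qed
  have "fold dir_deriv (replicate (Suc m) (u + v)) F x = dir_deriv (u + v) (\<lambda>y. fact m * c m y) x"
    unfolding fold_dir_deriv_replicate_Suc by (rule dir_deriv_cong [OF op Suc.prems IH])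
  also have "\<dots> = fact m * (dir_deriv u (c m) x + dir_deriv v (c m) x)"
    by (simp add: dir_deriv_cmult_fun [OF hc Suc.prems] line_holo_dir_deriv_add [OF l Suc.prems])
  also have "dir_deriv u (c m) x + dir_deriv v (c m) x = (\<Sum>j\<le>Suc m. of_nat (Suc m) * ?B j)"
    unfolding 1 2 sum.distrib [symmetric]
  proof (rule sum.cong)
    fix j assume "j \<in> {..Suc m}"
    then have "j + (Suc m - j) = Suc m" by simp
    then show "of_nat j * ?B j + of_nat (Suc m - j) * ?B j = of_nat (Suc m) * ?B j"
      by (metis distrib_right of_nat_add)
  qed simp
  also have "\<dots> = of_nat (Suc m) * (\<Sum>j\<le>Suc m. ?B j)"
    by (rule sum_distrib_left [symmetric])
  also have "fact m * \<dots> = fact (Suc m) * (\<Sum>j\<le>Suc m. ?B j)"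
    by (simp add: algebra_simps del: sum.atMost_Suc)
  finally have "fold dir_deriv (replicate (Suc m) (u + v)) F x / fact (Suc m) = (\<Sum>j\<le>Suc m. ?B j)"
    by (simp del: sum.atMost_Suc fact_Suc replicate_Suc)
  then show ?case by (simp only: A_def)
qed

lemma deriv_funpow_transform:
  fixes P :: "complex \<times> (complex ^ 'n::finite) \<Rightarrow> complex"
  assumes M: "holo_on M WM" "0 \<in> WM" and P: "holo_on P WP" and S: "open S"
    and y: "\<And>y. y \<in> S \<Longrightarrow> (y, transpose (M 0) *v lam) \<in> WP" and s: "s \<in> S"
  shows "(deriv ^^ j) (\<lambda>y. transform M m (\<lambda>\<zeta>. P (y, \<zeta>)) lam) s = transform M m (\<lambda>\<zeta>. fold dir_deriv (replicate j (1, 0)) P (s, \<zeta>)) lam"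
  using P
proof (induction j arbitrary: P)
  case (Suc j)
  have dd1: "dir_deriv 1 f = deriv f" for f :: "complex \<Rightarrow> complex"
    by (rule ext) (simp add: dir_deriv_def deriv_shift_0 [symmetric] o_def, subst (2) deriv_shift_0, simp add: o_def)
  have "(deriv ^^ Suc j) (\<lambda>y. transform M m (\<lambda>\<zeta>. P (y, \<zeta>)) lam) s
      = fold dir_deriv (replicate j 1) (dir_deriv 1 (\<lambda>y. transform M m (\<lambda>\<zeta>. P (y, \<zeta>)) lam)) s"
    using deriv_funpow_line [where k = "Suc j" and f = "\<lambda>y. transform M m (\<lambda>\<zeta>. P (y, \<zeta>)) lam" and x = 0 and v = 1 and t = s]
    by simp
  also have "\<dots> = fold dir_deriv (replicate j 1) (\<lambda>y. transform M m (\<lambda>\<zeta>. dir_deriv (1, 0) P (y, \<zeta>)) lam) s"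
    by (rule fold_dir_deriv_cong [OF S s dir_deriv_transform [OF M Suc.prems y]])
  also have "\<dots> = (deriv ^^ j) (\<lambda>y. transform M m (\<lambda>\<zeta>. dir_deriv (1, 0) P (y, \<zeta>)) lam) s"
    using deriv_funpow_line [where k = j and f = "\<lambda>y. transform M m (\<lambda>\<zeta>. dir_deriv (1, 0) P (y, \<zeta>)) lam" and x = 0 and v = 1 and t = s]
    by simp
  also have "\<dots> = transform M m (\<lambda>\<zeta>. fold dir_deriv (replicate j (1, 0)) (dir_deriv (1, 0) P) (s, \<zeta>)) lam"
    by (rule Suc.IH [OF holo_on_dir_deriv [OF Suc.prems]])
  finally show ?case by simp
qed simp


lemma matrix_mult_scaleC: "A *v (c *\<^sub>C x) = c *\<^sub>C (A *v (x :: complex ^ 'n::finite))"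
  by (simp add: vec_eq_iff matrix_vector_mult_def sum_distrib_left mult_ac)

lemma dirs_eq_Nil_iff: "dirs \<alpha> = [] \<longleftrightarrow> (\<forall>i. \<alpha> i = 0)"
  using index_list(2) by (auto simp: dirs_def)

lemma transform_0: "transform M 0 p lam = p (transpose (M 0) *v lam)"
proof -
  have "mindex 0 = {\<lambda>_ :: 'a. 0}" by (auto simp: mindex_def)
  moreover have "dirs (\<lambda>_ :: 'a. 0) = []" by (simp add: dirs_eq_Nil_iff)
  ultimately show ?thesis
    by (simp add: transform_def contract_def multi_deriv_eq_fold_dir_deriv)
qed

lemma fold_dir_deriv_const: "fold dir_deriv vs (\<lambda>_. c) x = (if vs = [] then c else 0)"
proof -
  have c: "dir_deriv v (\<lambda>_. c) = (\<lambda>_. 0)" for v :: 'a and c by (rule ext) (simp add: dir_deriv_def)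
  then have "fold dir_deriv vs (\<lambda>_. 0) x = 0" for vs :: "'a list" by (induction vs) auto
  then show ?thesis by (cases vs) (auto simp: c)
qed

text \<open>For a constant matrix nothing depends on \<open>z\<close>, so only \<open>m = 0\<close> contributes.\<close>

lemma transform_const_matrix:
  assumes "0 < m"
  shows "transform (\<lambda>_. A) m p lam = 0"
  unfolding transform_def contract_def
proof (rule sum.neutral, rule ballI)
  fix \<alpha> :: "'a \<Rightarrow> nat" assume "\<alpha> \<in> mindex m"
  then have "dirs \<alpha> \<noteq> []" using assms unfolding mindex_def dirs_eq_Nil_iff
    by (metis (mono_tags, lifting) less_irrefl mem_Collect_eq sum.neutral)
  then show "1 / (\<Prod>i\<in>UNIV. fact (\<alpha> i)) *
      multi_deriv \<alpha> (\<lambda>\<zeta>. multi_deriv \<alpha> (\<lambda>z. p (\<zeta> + transpose A *v lam)) 0) 0 = 0"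
    by (simp add: multi_deriv_eq_fold_dir_deriv fold_dir_deriv_const)
qed

lemma deriv_funpow_cong:
  assumes "open S" "s \<in> S" "\<And>y. y \<in> S \<Longrightarrow> f y = g y"
  shows "(deriv ^^ m) f s = (deriv ^^ m) g (s :: complex)"
  using fold_dir_deriv_cong [OF assms, where vs = "replicate m 1"]
    deriv_funpow_line [where k = m and f = f and x = 0 and v = 1 and t = s]
    deriv_funpow_line [where k = m and f = g and x = 0 and v = 1 and t = s]
  by simp

text \<open>Let \<open>b(s) = J(s a) a\<close>. Up to the factorials, the summands are the mixed derivatives in \<open>s\<close> and \<open>t\<close> of
  \<open>F(s,t) = exp \<langle>K(t b(s)) b(s), \<kappa>\<rangle>\<close> at the origin, so their sum is a derivative of the restriction to
  the diagonal, where \<open>F(s,s) = exp \<langle>L(s a) a, \<kappa>\<rangle>\<close>.\<close>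

lemma transform_compose_exp:
  fixes J K L :: "complex ^ 'n::finite \<Rightarrow> complex ^ 'n ^ 'n"
  assumes J: "holo_on J WJ" "0 \<in> WJ" and K: "holo_on K WK" "0 \<in> WK" and L: "holo_on L WL" "0 \<in> WL"
    and S0: "open S0" "0 \<in> S0" "\<And>s. s \<in> S0 \<Longrightarrow>
      K (s *\<^sub>C (J (s *\<^sub>C a) *v a)) *v (J (s *\<^sub>C a) *v a) = L (s *\<^sub>C a) *v a"
  shows "(\<Sum>j\<le>m. transform K (m - j) (transform J j (\<lambda>\<zeta>. exp (cdot a \<zeta>))) \<kappa>) = transform L m (\<lambda>\<zeta>. exp (cdot a \<zeta>)) \<kappa>"
proof -
  define b where "b s = J (s *\<^sub>C a) *v a" for s
  define S where "S = {s. s *\<^sub>C a \<in> WJ}"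
  define P where "P = (\<lambda>(s, \<zeta>). exp (cdot (b s) \<zeta>))"
  define F where "F = (\<lambda>(s, t). exp (cdot (K (t *\<^sub>C b s) *v b s) \<kappa>))"
  have S: "open S" "0 \<in> S"
    using open_line [OF holo_on_open [OF J(1)], of 0 a] J(2) by (auto simp: S_def)
  have lin: "holo_on (\<lambda>s. s *\<^sub>C a) S"
    by (intro holo_on_scaleC holo_on_ident holo_on_const S)
  have "holo_on (\<lambda>s. J (s *\<^sub>C a)) S"
    by (rule holo_on_compose' [OF J(1) lin]) (auto simp: S_def)
  then have b: "holo_on b S"
    unfolding b_def by (intro holo_on_matrix_vector_mult holo_on_const S)
  have P: "holo_on P (S \<times> UNIV)"
    unfolding P_def case_prod_unfold
    by (intro holo_on_exp holo_on_cdot holo_on_compose' [OF b] holo_on_fst holo_on_snd holo_on_ident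
        open_Times S open_UNIV) auto
  define Q where "Q = {x \<in> S \<times> UNIV. snd x *\<^sub>C b (fst x) \<in> WK}"
  have bf: "holo_on (\<lambda>x :: complex \<times> complex. b (fst x)) (S \<times> UNIV)"
    by (intro holo_on_compose' [OF b] holo_on_fst holo_on_ident open_Times S open_UNIV) auto
  have "holo_on (\<lambda>x. K (snd x *\<^sub>C b (fst x))) Q"
    unfolding Q_def
    by (rule holo_on_compose [OF K(1)])
      (intro holo_on_scaleC bf holo_on_snd holo_on_ident open_Times S open_UNIV)
  note KQ = this
  have F: "holo_on F Q"
    unfolding F_def case_prod_unfold
    by (intro holo_on_exp holo_on_cdot holo_on_matrix_vector_mult KQ holo_on_const holo_on_open [OF KQ]
        holo_on_subset [OF bf]) (auto simp: Q_def)
  have Q0: "(s, 0) \<in> Q" if "s \<in> S" for s using that K by (simp add: Q_def)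
  have trm: "transform K l (transform J j (\<lambda>\<zeta>. exp (cdot a \<zeta>))) \<kappa>
      = fold dir_deriv (replicate j (1, 0)) (fold dir_deriv (replicate l (0, 1)) F) (0, 0) / (fact j * fact l)" for j l
  proof -
    have 1: "transform J j (\<lambda>\<zeta>. exp (cdot a \<zeta>)) = (\<lambda>lam. (1 / fact j) * fold dir_deriv (replicate j (1, 0)) P (0, lam))"
    proof
      fix lam
      have "(deriv ^^ j) (\<lambda>s. P ((0, lam) + s *\<^sub>C (1, 0))) 0 = fold dir_deriv (replicate j (1, 0)) P (0, lam)"
        unfolding deriv_funpow_line by simp
      then show "transform J j (\<lambda>\<zeta>. exp (cdot a \<zeta>)) lam = (1 / fact j) * fold dir_deriv (replicate j (1, 0)) P (0, lam)"
        unfolding transform_exp [OF J] by (simp add: P_def b_def Pair_scaleC del: fold_replicate)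
    qed
    have "holo_on (\<lambda>lam. fold dir_deriv (replicate j (1, 0)) P (0, lam)) UNIV"
      by (rule holo_on_compose' [OF holo_on_fold_dir_deriv [OF P]])
        (use S in \<open>auto intro!: holo_on_Pair holo_on_const holo_on_ident\<close>)
    then have "transform K l (transform J j (\<lambda>\<zeta>. exp (cdot a \<zeta>))) \<kappa>
        = (1 / fact j) * transform K l (\<lambda>lam. fold dir_deriv (replicate j (1, 0)) P (0, lam)) \<kappa>"
      unfolding 1 by (intro transform_cmult [OF K]) auto
    also have "transform K l (\<lambda>lam. fold dir_deriv (replicate j (1, 0)) P (0, lam)) \<kappa>
        = (deriv ^^ j) (\<lambda>s. transform K l (\<lambda>\<zeta>. P (s, \<zeta>)) \<kappa>) 0"
      by (rule deriv_funpow_transform [OF K P S(1) _ S(2), symmetric]) auto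
    also have "(\<lambda>s. transform K l (\<lambda>\<zeta>. P (s, \<zeta>)) \<kappa>)
        = (\<lambda>s. (\<lambda>x. (1 / fact l) * fold dir_deriv (replicate l (0, 1)) F x) ((0, 0) + s *\<^sub>C (1, 0)))"
    proof
      fix s
      have "(deriv ^^ l) (\<lambda>t. F ((s, 0) + t *\<^sub>C (0, 1))) 0 = fold dir_deriv (replicate l (0, 1)) F (s, 0)"
        unfolding deriv_funpow_line by simp
      then show "transform K l (\<lambda>\<zeta>. P (s, \<zeta>)) \<kappa> = (\<lambda>x. (1 / fact l) * fold dir_deriv (replicate l (0, 1)) F x) ((0, 0) + s *\<^sub>C (1, 0))"
        unfolding P_def case_prod_conv transform_exp [OF K] by (simp add: F_def Pair_scaleC del: fold_replicate)
    qed
    also have "(deriv ^^ j) \<dots> 0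
        = fold dir_deriv (replicate j (1, 0)) (\<lambda>x. (1 / fact l) * fold dir_deriv (replicate l (0, 1)) F x) (0, 0)"
      unfolding deriv_funpow_line [where f = "\<lambda>x. (1 / fact l) * fold dir_deriv (replicate l (0, 1)) F x"] by simp
    also have "\<dots> = (1 / fact l) * fold dir_deriv (replicate j (1, 0)) (fold dir_deriv (replicate l (0, 1)) F) (0, 0)"
      by (rule fold_dir_deriv_cmult_fun [OF holo_on_fold_dir_deriv [OF F] Q0 [OF S(2)]])
    finally show ?thesis by (simp del: fold_replicate)
  qed
  have "(\<Sum>j\<le>m. transform K (m - j) (transform J j (\<lambda>\<zeta>. exp (cdot a \<zeta>))) \<kappa>)
      = fold dir_deriv (replicate m ((1, 0) + (0, 1))) F (0, 0) / fact m"
    unfolding trm by (rule fold_dir_deriv_sum_directions [OF F Q0 [OF S(2)], symmetric])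
  also have "fold dir_deriv (replicate m ((1, 0) + (0, 1))) F (0, 0) = (deriv ^^ m) (\<lambda>s. F ((0, 0) + s *\<^sub>C ((1, 0) + (0, 1)))) 0"
    unfolding deriv_funpow_line by simp
  also have "\<dots> = (deriv ^^ m) (\<lambda>s. exp (cdot (L (s *\<^sub>C a) *v a) \<kappa>)) 0"
    by (rule deriv_funpow_cong [OF S0(1,2)]) (simp add: F_def Pair_scaleC b_def S0(3))
  also have "\<dots> / fact m = transform L m (\<lambda>\<zeta>. exp (cdot a \<zeta>)) \<kappa>"
    by (rule transform_exp [OF L, symmetric])
  finally show ?thesis .
qed

text \<open>On the line spanned by \<open>a\<close> a factor \<open>s\<close> can be cancelled from the relation, including at \<open>s = 0\<close>
  by continuity.\<close>

lemma compose_relation_line: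
  fixes J K L :: "complex ^ 'n::finite \<Rightarrow> complex ^ 'n ^ 'n"
  assumes J: "holo_on J WJ" "0 \<in> WJ" and K: "holo_on K WK" "0 \<in> WK" and L: "holo_on L WL" "0 \<in> WL"
    and W0: "open W0" "0 \<in> W0"
    and rel: "\<And>x. x \<in> W0 \<Longrightarrow> K (J x *v x) *v (J x *v x) = L x *v x"
  shows "\<exists>S0. open S0 \<and> 0 \<in> S0 \<and> (\<forall>s\<in>S0.
      K (s *\<^sub>C (J (s *\<^sub>C a) *v a)) *v (J (s *\<^sub>C a) *v a) = L (s *\<^sub>C a) *v a)"
proof -
  define S where "S = {s. s *\<^sub>C a \<in> WJ \<inter> WL \<inter> W0}"
  have S: "open S" "0 \<in> S"
    using open_line [of "WJ \<inter> WL \<inter> W0" 0 a] J L W0 holo_on_open [OF J(1)] holo_on_open [OF L(1)]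
    by (auto simp: S_def)
  have lin: "holo_on (\<lambda>s. s *\<^sub>C a) S"
    by (intro holo_on_scaleC holo_on_ident holo_on_const S)
  have b: "holo_on (\<lambda>s. J (s *\<^sub>C a) *v a) S"
    by (intro holo_on_matrix_vector_mult holo_on_const S holo_on_compose' [OF J(1) lin]) (auto simp: S_def)
  have La: "holo_on (\<lambda>s. L (s *\<^sub>C a) *v a) S"
    by (intro holo_on_matrix_vector_mult holo_on_const S holo_on_compose' [OF L(1) lin]) (auto simp: S_def)
  define T where "T = {s \<in> S. s *\<^sub>C (J (s *\<^sub>C a) *v a) \<in> WK}"
  have Ks: "holo_on (\<lambda>s. K (s *\<^sub>C (J (s *\<^sub>C a) *v a))) T"
    unfolding T_def by (rule holo_on_compose [OF K(1)]) (intro holo_on_scaleC holo_on_ident S b)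
  have T: "open T" "0 \<in> T" using holo_on_open [OF Ks] S K by (auto simp: T_def)
  have Kb: "holo_on (\<lambda>s. K (s *\<^sub>C (J (s *\<^sub>C a) *v a)) *v (J (s *\<^sub>C a) *v a)) T"
    by (intro holo_on_matrix_vector_mult Ks holo_on_subset [OF b] T) (auto simp: T_def)
  have eq: "K (s *\<^sub>C (J (s *\<^sub>C a) *v a)) *v (J (s *\<^sub>C a) *v a) = L (s *\<^sub>C a) *v a" if "s \<in> T" "s \<noteq> 0" for s
  proof -
    have "s *\<^sub>C a \<in> W0" using that by (auto simp: T_def S_def)
    from rel [OF this] have "s *\<^sub>C (K (s *\<^sub>C (J (s *\<^sub>C a) *v a)) *v (J (s *\<^sub>C a) *v a)) = s *\<^sub>C (L (s *\<^sub>C a) *v a)"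
      by (simp add: matrix_mult_scaleC)
    then have "(1 / s) *\<^sub>C s *\<^sub>C (K (s *\<^sub>C (J (s *\<^sub>C a) *v a)) *v (J (s *\<^sub>C a) *v a)) = (1 / s) *\<^sub>C s *\<^sub>C (L (s *\<^sub>C a) *v a)"
      by simp
    then show ?thesis using that(2) by (simp add: scaleC_scaleC)
  qed
  have lim1: "((\<lambda>s. K (s *\<^sub>C (J (s *\<^sub>C a) *v a)) *v (J (s *\<^sub>C a) *v a)) \<longlongrightarrow> K (0 *\<^sub>C (J (0 *\<^sub>C a) *v a)) *v (J (0 *\<^sub>C a) *v a)) (at 0)"
    using holo_on_isCont [OF Kb T(2)] by (simp only: isCont_def)
  have lim2: "((\<lambda>s. L (s *\<^sub>C a) *v a) \<longlongrightarrow> L (0 *\<^sub>C a) *v a) (at 0)"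
    using holo_on_isCont [OF La S(2)] by (simp only: isCont_def)
  have "\<forall>\<^sub>F s in at 0. L (s *\<^sub>C a) *v a = K (s *\<^sub>C (J (s *\<^sub>C a) *v a)) *v (J (s *\<^sub>C a) *v a)"
    using eventually_at_in_open [OF T] by eventually_elim (use eq in auto)
  with lim2 have "((\<lambda>s. K (s *\<^sub>C (J (s *\<^sub>C a) *v a)) *v (J (s *\<^sub>C a) *v a)) \<longlongrightarrow> L (0 *\<^sub>C a) *v a) (at 0)"
    by (rule Lim_transform_eventually)
  with lim1 have eq0: "K (0 *\<^sub>C (J (0 *\<^sub>C a) *v a)) *v (J (0 *\<^sub>C a) *v a) = L (0 *\<^sub>C a) *v a"
    by (rule tendsto_unique [OF at_neq_bot])
  have "K (s *\<^sub>C (J (s *\<^sub>C a) *v a)) *v (J (s *\<^sub>C a) *v a) = L (s *\<^sub>C a) *v a" if "s \<in> T" for s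
    by (cases "s = 0") (use eq0 eq [OF that] in simp_all)
  with T show ?thesis by blast
qed

lemma compose_at_0:
  fixes J K L :: "complex ^ 'n::finite \<Rightarrow> complex ^ 'n ^ 'n"
  assumes J: "holo_on J WJ" "0 \<in> WJ" and K: "holo_on K WK" "0 \<in> WK" and L: "holo_on L WL" "0 \<in> WL"
    and W0: "open W0" "0 \<in> W0"
    and rel: "\<And>x. x \<in> W0 \<Longrightarrow> K (J x *v x) *v (J x *v x) = L x *v x"
  shows "transpose (J 0) *v (transpose (K 0) *v \<kappa>) = transpose (L 0) *v \<kappa>"
proof -
  have "L 0 *v a = (K 0 ** J 0) *v a" for a
  proof -
    obtain S0 where "0 \<in> S0" "\<forall>s\<in>S0. K (s *\<^sub>C (J (s *\<^sub>C a) *v a)) *v (J (s *\<^sub>C a) *v a) = L (s *\<^sub>C a) *v a"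
      using compose_relation_line [OF J K L W0 rel, of a] by blast
    from bspec [OF this(2,1)] show ?thesis by (simp add: matrix_vector_mul_assoc)
  qed
  then have "L 0 = K 0 ** J 0" by (simp only: matrix_eq) simp
  then show ?thesis
    by (simp only: matrix_transpose_mul matrix_vector_mul_assoc)
qed

text \<open>If \<open>K (J(x) x) (J(x) x) = L(x) x\<close> near \<open>0\<close>, the operators compose.\<close>

theorem transform_compose:
  fixes J K L :: "complex ^ 'n::finite \<Rightarrow> complex ^ 'n ^ 'n"
  assumes J: "holo_on J WJ" "0 \<in> WJ" and K: "holo_on K WK" "0 \<in> WK" and L: "holo_on L WL" "0 \<in> WL"
    and W0: "open W0" "0 \<in> W0"
    and rel: "\<And>x. x \<in> W0 \<Longrightarrow> K (J x *v x) *v (J x *v x) = L x *v x"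
    and p: "holo_on p Wp" and \<kappa>: "transpose (L 0) *v \<kappa> \<in> Wp"
  shows "(\<Sum>j\<le>m. transform K (m - j) (transform J j p) \<kappa>) = transform L m p \<kappa>"
proof -
  note \<kappa>' = compose_at_0 [OF J K L W0 rel, of \<kappa>]
  define V where "V = {lam. transpose (J 0) *v lam \<in> Wp}"
  have K\<kappa>: "transpose (K 0) *v \<kappa> \<in> V" using \<kappa> by (simp only: V_def mem_Collect_eq \<kappa>')
  have T: "holo_on (transform J j q) V" if "holo_on q Wp" for j q
    unfolding V_def by (rule holo_on_transform [OF J that])
  define \<Lambda> where "\<Lambda> p = (\<Sum>j\<le>m. transform K (m - j) (transform J j p) \<kappa>) - transform L m p \<kappa>" for p
  have "\<Lambda> p = 0"
  \<comment> \<open>Each product of operators lowers the order of vanishing by at most \<open>2 (m - j) + 2 j = 2 m\<close>.\<close>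
  proof (rule jet_principle [where L = \<Lambda> and f = p and W = Wp and ?x0.0 = "transpose (L 0) *v \<kappa>" and N = "1 + 2 * m"])
    show "open Wp" using p by (rule holo_on_open)
    show "transpose (L 0) *v \<kappa> \<in> Wp" by (rule \<kappa>)
    show "\<Lambda> (\<lambda>x. f x + g x) = \<Lambda> f + \<Lambda> g" if f: "holo_on f Wp" and g: "holo_on g Wp" for f g
    proof -
      have "transform K l (transform J j (\<lambda>x. f x + g x)) \<kappa> = transform K l (transform J j f) \<kappa> + transform K l (transform J j g) \<kappa>" for j l
      proof -
        have "transform K l (transform J j (\<lambda>x. f x + g x)) \<kappa> = transform K l (\<lambda>lam. transform J j f lam + transform J j g lam) \<kappa>"
          by (rule transform_cong [OF K K\<kappa> holo_on_open [OF T [OF f]] transform_add [OF J _ f g]]) (simp only: V_def mem_Collect_eq)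
        then show ?thesis by (simp only: transform_add [OF K K\<kappa> T [OF f] T [OF g]])
      qed
      then show ?thesis
        by (simp add: \<Lambda>_def transform_add [OF L \<kappa> f g] sum.distrib)
    qed
    show "\<Lambda> (\<lambda>x. c * f x) = c * \<Lambda> f" if f: "holo_on f Wp" for c f
    proof -
      have "transform K l (transform J j (\<lambda>x. c * f x)) \<kappa> = c * transform K l (transform J j f) \<kappa>" for j l
      proof -
        have "transform K l (transform J j (\<lambda>x. c * f x)) \<kappa> = transform K l (\<lambda>lam. c * transform J j f lam) \<kappa>"
          by (rule transform_cong [OF K K\<kappa> holo_on_open [OF T [OF f]] transform_cmult [OF J _ f]]) (simp only: V_def mem_Collect_eq)
        then show ?thesis by (simp only: transform_cmult [OF K K\<kappa> T [OF f]])
      qed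
      then show ?thesis
        by (simp add: \<Lambda>_def transform_cmult [OF L \<kappa> f] sum_distrib_left right_diff_distrib)
    qed
    show "\<Lambda> (\<lambda>x. exp (cdot a x)) = 0" for a
    proof -
      obtain S0 where "open S0" "0 \<in> S0"
          "\<forall>s\<in>S0. K (s *\<^sub>C (J (s *\<^sub>C a) *v a)) *v (J (s *\<^sub>C a) *v a) = L (s *\<^sub>C a) *v a"
        using compose_relation_line [OF J K L W0 rel, of a] by blast
      then have "(\<Sum>j\<le>m. transform K (m - j) (transform J j (\<lambda>\<zeta>. exp (cdot a \<zeta>))) \<kappa>) = transform L m (\<lambda>\<zeta>. exp (cdot a \<zeta>)) \<kappa>"
        by (intro transform_compose_exp [OF J K L, of S0]) auto
      then show ?thesis by (simp add: \<Lambda>_def)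
    qed
    show "\<Lambda> f = 0" if f: "holo_on f Wp" and van: "vanishes (1 + 2 * m) f (transpose (L 0) *v \<kappa>)" for f
    proof -
      have "transform K (m - j) (transform J j f) \<kappa> = 0" if "j \<le> m" for j
      proof -
        have eq: "1 + 2 * m = (1 + 2 * (m - j)) + 2 * j" using that by simp
        \<comment> \<open>Two applications consume the orders \<open>2 j\<close> and \<open>2 (m - j)\<close> and leave order one.\<close>
        have "vanishes (1 + 2 * (m - j)) (transform J j f) (transpose (K 0) *v \<kappa>)"
          by (rule vanishes_transform [OF J f]) (use van \<kappa> in \<open>simp_all only: \<kappa>' eq\<close>)
        then have "vanishes 1 (transform K (m - j) (transform J j f)) \<kappa>"
          by (rule vanishes_transform [OF K T [OF f] K\<kappa>])
        then show ?thesis by (rule vanishes_zero) simp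
      qed
      moreover have "transform L m f \<kappa> = 0"
        by (rule vanishes_zero [OF vanishes_transform [OF L f \<kappa> van]]) simp
      ultimately show ?thesis by (simp add: \<Lambda>_def)
    qed
  qed (rule p)
  then show ?thesis by (simp add: \<Lambda>_def)
qed

text \<open>Composing with the operator of the constant unit matrix leaves \<open>p\<close> unchanged, so the
  operator of every \<open>M\<close> with \<open>M(x) x = x\<close> agrees with that of the unit matrix.\<close>

corollary transform_identity:
  fixes M :: "complex ^ 'n::finite \<Rightarrow> complex ^ 'n ^ 'n"
  assumes M: "holo_on M WM" "0 \<in> WM" and fixed: "\<And>x. x \<in> WM \<Longrightarrow> M x *v x = x"
    and p: "holo_on p Wp" and lam: "lam \<in> Wp"
  shows "transform M m p lam = (if m = 0 then p lam else 0)"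
proof -
  let ?I = "\<lambda>_ :: complex ^ 'n. mat 1 :: complex ^ 'n ^ 'n"
  have I: "holo_on ?I UNIV" by (rule holo_on_const) simp
  have one: "transform ?I k q lam = (if k = 0 then q lam else 0)" for k q
    by (cases "k = 0") (simp_all add: transform_0 transform_const_matrix transpose_mat)
  have "(\<Sum>j\<le>m. transform ?I (m - j) (transform M j p) lam) = transform ?I m p lam"
    by (rule transform_compose [OF M I _ I _ holo_on_open [OF M(1)] M(2) _ p])
      (use lam fixed in \<open>simp_all add: transpose_mat\<close>)
  moreover have "(\<Sum>j\<le>m. transform ?I (m - j) (transform M j p) lam) = (\<Sum>j\<le>m. if j = m then transform M m p lam else 0)"
    by (rule sum.cong) (auto simp: one)
  ultimately show ?thesis by (simp add: one)
qed


section \<open>Geometry of the coordinate change\<close>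

lemma maxnorm_triangle: "maxnorm (x + y) \<le> maxnorm x + maxnorm y"
  unfolding maxnorm_le_iff
  by (metis add_mono norm_nth_le_maxnorm norm_triangle_ineq order_trans vector_add_component)

lemma maxnorm_scaleR: "maxnorm (c *\<^sub>R x) = \<bar>c\<bar> * maxnorm x"
proof -
  have le: "maxnorm (c *\<^sub>R x) \<le> \<bar>c\<bar> * maxnorm x" for c and x :: "complex ^ 'a"
    by (simp add: maxnorm_le_iff mult_left_mono norm_nth_le_maxnorm)
  have "\<bar>c\<bar> * maxnorm x \<le> maxnorm (c *\<^sub>R x)"
  proof (cases "c = 0")
    case False
    have "maxnorm (inverse c *\<^sub>R c *\<^sub>R x) \<le> \<bar>inverse c\<bar> * maxnorm (c *\<^sub>R x)" by (rule le)
    then show ?thesis using False by (simp add: field_simps)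
  qed simp
  with le show ?thesis by (rule antisym)
qed

lemma maxnorm_minus: "maxnorm (- x) = maxnorm x"
  using maxnorm_scaleR [of "-1" x] by simp

lemma maxnorm_scale: "maxnorm (c *s x) = cmod c * maxnorm x"
proof -
  have le: "maxnorm (c *s x) \<le> cmod c * maxnorm x" for c and x :: "complex ^ 'a"
    by (simp add: maxnorm_le_iff norm_mult mult_left_mono norm_nth_le_maxnorm)
  have "cmod c * maxnorm x \<le> maxnorm (c *s x)"
  proof (cases "c = 0")
    case False
    have "maxnorm (inverse c *s (c *s x)) \<le> cmod (inverse c) * maxnorm (c *s x)" by (rule le)
    moreover have "inverse c *s (c *s x) = x" using False by (simp add: vec_eq_iff)
    ultimately have "maxnorm x \<le> inverse (cmod c) * maxnorm (c *s x)" by (simp only: norm_inverse)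
    then show ?thesis using False by (simp add: field_simps)
  qed simp
  with le show ?thesis by (rule antisym)
qed

lemma maxnorm_eq_0_iff: "maxnorm x = 0 \<longleftrightarrow> x = 0"
  by (metis maxnorm_zero norm_le_maxnorm norm_le_zero_iff mult_zero_right)

lemma maxnorm_diff_le: "\<bar>maxnorm x - maxnorm y\<bar> \<le> maxnorm (x - y)"
  using maxnorm_triangle [of "x - y" y] maxnorm_triangle [of "y - x" x] maxnorm_minus [of "x - y"] by simp

lemma continuous_on_maxnorm [continuous_intros]:
  assumes "continuous_on S f"
  shows "continuous_on S (\<lambda>x. maxnorm (f x))"
proof -
  have "continuous_on UNIV (maxnorm :: complex ^ 'n \<Rightarrow> real)"
  proof (rule continuous_on_iff [THEN iffD2], intro ballI allI impI)
    fix x :: "complex ^ 'n" and e :: real assume "0 < e"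
    moreover have "dist (maxnorm y) (maxnorm x) \<le> dist y x" for y
      using order_trans [OF maxnorm_diff_le maxnorm_le_norm] by (simp add: dist_norm)
    ultimately show "\<exists>d>0. \<forall>y\<in>UNIV. dist y x < d \<longrightarrow> dist (maxnorm y) (maxnorm x) < e"
      by (intro exI [of _ e]) (auto intro: le_less_trans)
  qed
  then show ?thesis using assms continuous_on_compose2 by blast
qed

text \<open>The product rule at a zero of the second factor, where the derivative of \<open>M\<close> does not enter.\<close>

lemma has_derivative_matrix_mult_zero:
  fixes M :: "'a::real_normed_vector \<Rightarrow> complex ^ 'n::finite ^ 'm::finite"
  assumes M: "(M has_derivative M') (at x)" and u: "(u has_derivative u') (at x)" and u0: "u x = 0"
  shows "((\<lambda>y. (M y *v u y) $ i) has_derivative (\<lambda>h. (M x *v u' h) $ i)) (at x)"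
proof -
  have m: "((\<lambda>y. M y $ i $ j) has_derivative (\<lambda>h. M' h $ i $ j)) (at x)" for j
    by (intro bounded_linear.has_derivative [OF bounded_linear_vec_nth] M)
  have v: "((\<lambda>y. u y $ j) has_derivative (\<lambda>h. u' h $ j)) (at x)" for j
    by (intro bounded_linear.has_derivative [OF bounded_linear_vec_nth] u)
  have "((\<lambda>y. \<Sum>j\<in>UNIV. M y $ i $ j * u y $ j) has_derivative
      (\<lambda>h. \<Sum>j\<in>UNIV. M x $ i $ j * u' h $ j + M' h $ i $ j * u x $ j)) (at x)"
    by (intro has_derivative_sum has_derivative_mult m v)
  then show ?thesis by (simp add: matrix_vector_mult_def u0)
qed

lemma complex_linear_matrix:
  fixes D :: "complex ^ 'n::finite \<Rightarrow> complex ^ 'm::finite"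
  assumes "linear D" "\<And>c v. D (c *\<^sub>C v) = c *\<^sub>C D v"
  shows "matrix D *v v = D v"
proof -
  have "D v = D (\<Sum>i\<in>UNIV. v $ i *\<^sub>C axis i 1)"
    by (subst axis_sum_nth [of v]) (intro arg_cong [where f = D] sum.cong refl axis_scaleC)
  also have "\<dots> = (\<Sum>i\<in>UNIV. v $ i *\<^sub>C D (axis i 1))"
    by (simp add: linear_sum [OF assms(1)] assms(2))
  finally show ?thesis
    by (simp add: vec_eq_iff matrix_vector_mult_def matrix_def mult.commute)
qed

lemma jacobian_works_complex:
  fixes f :: "complex ^ 'n::finite \<Rightarrow> complex ^ 'm::finite"
  assumes D: "(f has_derivative D) (at x)" "\<And>c v. D (c *\<^sub>C v) = c *\<^sub>C D v"
  shows "jacobian f (at x) *v v = D v"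
proof -
  have "frechet_derivative f (at x) = D" using frechet_derivative_at [OF D(1)] by simp
  then show ?thesis
    unfolding jacobian_def
    using complex_linear_matrix [OF has_derivative_linear [OF D(1)] D(2)] by simp
qed

type_synonym 'n sextuple =
  "(complex ^ 'n) \<times> (complex ^ 'n) \<times> (complex ^ 'n) \<times> (complex ^ 'n) \<times> (complex ^ 'n) \<times> (complex ^ 'n)"

text \<open>A change of coordinates \<open>z = \<Phi> w\<close> on \<open>U\<close> with a matrix \<open>J\<close> for it, holomorphic on a neighbourhood
  \<open>N\<close> of the diagonal. The relation is written with points of \<open>U\<close> in place of the inverse of \<open>\<Phi>\<close>.\<close>

locale coordinate_change =
  fixes U :: "(complex ^ 'n::finite) set"
    and zc wc \<Phi> :: "complex ^ 'n \<Rightarrow> complex ^ 'n"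
    and J :: "complex ^ 'n \<Rightarrow> complex ^ 'n \<Rightarrow> complex ^ 'n ^ 'n"
    and N :: "((complex ^ 'n) \<times> (complex ^ 'n)) set"
  assumes zc: "coordinates_on zc U" and wc: "coordinates_on wc U"
    and \<Phi>: "\<And>x. x \<in> U \<Longrightarrow> zc x = \<Phi> (wc x)"
    and N_sub: "N \<subseteq> zc ` U \<times> zc ` U" and N_diag: "\<And>x. x \<in> U \<Longrightarrow> (zc x, zc x) \<in> N"
    and N_holo: "holo_on (\<lambda>(z', z). J z' z) N"
    and N_rel: "\<And>x x'. x \<in> U \<Longrightarrow> x' \<in> U \<Longrightarrow> (zc x', zc x) \<in> N \<Longrightarrow> wc x' - wc x = J (zc x') (zc x) *v (zc x' - zc x)"
begin

lemma open_U: "open U" and open_wcU: "open (wc ` U)"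
  using zc wc by (auto simp: coordinates_on_def holo_on_def)

lemma inj_wc: "inj_on wc U"
  using wc by (auto simp: coordinates_on_def)

lemma holo_\<Phi>: "holo_on \<Phi> (wc ` U)"
proof -
  have "holo_on (\<lambda>w. zc (inv_into U wc w)) (wc ` U)"
  proof (rule holo_on_compose' [of zc U])
    show "holo_on zc U" "holo_on (inv_into U wc) (wc ` U)"
      using zc wc by (simp_all add: coordinates_on_def)
    show "inv_into U wc ` wc ` U \<subseteq> U" by (auto intro: inv_into_into)
  qed
  then show ?thesis
    by (rule holo_on_cong) (use inv_into_f_f [OF inj_wc] \<Phi> in force)
qed

text \<open>On the diagonal \<open>J\<close> is the derivative of the coordinates \<open>w\<close> with respect to \<open>z\<close>.\<close>

lemma J_diag_derivative:
  assumes x: "x \<in> U" and Dz: "(zc has_derivative Dz) (at x)" and Dw: "(wc has_derivative Dw) (at x)"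
  shows "Dw v = J (zc x) (zc x) *v Dz v"
proof -
  have Nx: "(zc x, zc x) \<in> N" by (rule N_diag [OF x])
  obtain DJ where DJ: "((\<lambda>(z', z). J z' z) has_derivative DJ) (at (zc x, zc x))"
    using N_holo Nx by (auto simp: holo_on_def)
  have pair: "((\<lambda>y. (zc y, zc x)) has_derivative (\<lambda>h. (Dz h, 0))) (at x)"
    by (intro has_derivative_Pair Dz has_derivative_const)
  from diff_chain_at [OF pair DJ]
  have DJ': "((\<lambda>y. J (zc y) (zc x)) has_derivative (\<lambda>h. DJ (Dz h, 0))) (at x)"
    by (simp add: o_def)
  have dz: "((\<lambda>y. zc y - zc x) has_derivative Dz) (at x)"
    using has_derivative_diff [OF Dz has_derivative_const [of "zc x"]] by simp
  have "Dw v $ i = (J (zc x) (zc x) *v Dz v) $ i" for i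
  proof -
    have 1: "((\<lambda>y. (J (zc y) (zc x) *v (zc y - zc x)) $ i) has_derivative (\<lambda>h. (J (zc x) (zc x) *v Dz h) $ i)) (at x)"
      by (rule has_derivative_matrix_mult_zero [OF DJ' dz]) simp
    have 2: "((\<lambda>y. (wc y - wc x) $ i) has_derivative (\<lambda>h. Dw h $ i)) (at x)"
      using bounded_linear.has_derivative [OF bounded_linear_vec_nth has_derivative_diff [OF Dw has_derivative_const [of "wc x"]]]
      by simp
    have "isCont (\<lambda>y. (zc y, zc x)) x" using pair by (rule has_derivative_continuous)
    then have "\<forall>\<^sub>F y in at x. (zc y, zc x) \<in> N"
      using Nx holo_on_open [OF N_holo] by (auto simp: isCont_def dest: topological_tendstoD)
    moreover have "\<forall>\<^sub>F y in at x. y \<in> U"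
      using eventually_at_in_open' [OF open_U x] .
    ultimately have "\<forall>\<^sub>F y in at x. (J (zc y) (zc x) *v (zc y - zc x)) $ i = (wc y - wc x) $ i"
      by eventually_elim (simp add: N_rel [OF x])
    from has_derivative_transform_eventually [OF 1 this]
    have "((\<lambda>y. (wc y - wc x) $ i) has_derivative (\<lambda>h. (J (zc x) (zc x) *v Dz h) $ i)) (at x)"
      by simp
    from has_derivative_unique [OF 2 this] show ?thesis by (rule fun_cong)
  qed
  then show ?thesis by (simp add: vec_eq_iff)
qed

lemma jacobian_J:
  assumes x: "x \<in> U"
  shows "transpose (jacobian zc (at x)) *v (transpose (J (zc x) (zc x)) *v lam) = transpose (jacobian wc (at x)) *v lam"
proof -
  obtain Dz where Dz: "(zc has_derivative Dz) (at x)" "\<And>c v. Dz (c *\<^sub>C v) = c *\<^sub>C Dz v"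
    using zc x by (auto simp: coordinates_on_def holo_on_def)
  obtain Dw where Dw: "(wc has_derivative Dw) (at x)" "\<And>c v. Dw (c *\<^sub>C v) = c *\<^sub>C Dw v"
    using wc x by (auto simp: coordinates_on_def holo_on_def)
  have "jacobian wc (at x) = J (zc x) (zc x) ** jacobian zc (at x)"
    by (simp only: matrix_eq matrix_vector_mul_assoc [symmetric] jacobian_works_complex [OF Dz] jacobian_works_complex [OF Dw]
        J_diag_derivative [OF x Dz(1) Dw(1)]) simp
  then show ?thesis
    by (simp only: matrix_transpose_mul matrix_vector_mul_assoc)
qed

text \<open>The fibre coordinates \<open>\<lambda>\<close> and \<open>\<zeta>\<close> of a covector are related by the transpose of \<open>J\<close> on the
  diagonal.\<close>

lemma in_coordinates_change:
  assumes "(w, lam) \<in> in_coordinates wc U V"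
  obtains x where "x \<in> U" "w = wc x" "(zc x, transpose (J (zc x) (zc x)) *v lam) \<in> in_coordinates zc U V"
    "x \<in> fst ` V"
proof -
  obtain x where x: "w = wc x" "x \<in> U" "(x, transpose (jacobian wc (at x)) *v lam) \<in> V"
    using assms by (auto simp: in_coordinates_def)
  have "(zc x, transpose (J (zc x) (zc x)) *v lam) \<in> in_coordinates zc U V"
    unfolding in_coordinates_def mem_Collect_eq
    by (rule exI [of _ x], rule exI [of _ "transpose (J (zc x) (zc x)) *v lam"])
      (simp only: jacobian_J [OF x(2)] x simp_thms)
  then show ?thesis using that [OF x(2,1)] x(3) by force
qed

lemma J_diag_nonsingular:
  assumes x: "x \<in> U" and 0: "transpose (J (zc x) (zc x)) *v lam = 0"
  shows "lam = 0"
proof -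
  obtain Dz where Dz: "(zc has_derivative Dz) (at x)"
    using zc x by (auto simp: coordinates_on_def holo_on_def)
  obtain Dw where Dw: "(wc has_derivative Dw) (at x)"
    using wc x by (auto simp: coordinates_on_def holo_on_def)
  obtain E where E: "(inv_into U wc has_derivative E) (at (wc x))"
    using wc x by (auto simp: coordinates_on_def holo_on_def)
  have "((wc \<circ> inv_into U wc) has_derivative Dw \<circ> E) (at (wc x))"
    by (rule diff_chain_at [OF E]) (simp add: inv_into_f_f [OF inj_wc x] Dw)
  moreover have "\<forall>\<^sub>F y in at (wc x). (wc \<circ> inv_into U wc) y = y"
    using eventually_at_in_open' [OF open_wcU, of "wc x"] x
    by (auto elim!: eventually_mono simp: f_inv_into_f)
  ultimately have "((\<lambda>y. y) has_derivative Dw \<circ> E) (at (wc x))"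
    by (rule has_derivative_transform_eventually) (use x in \<open>auto simp: f_inv_into_f\<close>)
  then have "Dw \<circ> E = (\<lambda>h. h)"
    using has_derivative_unique has_derivative_ident by blast
  then have DE: "Dw (E v) = v" for v by (metis comp_apply)
  have "cdot v lam = 0" for v
  proof -
    have "cdot v lam = cdot (J (zc x) (zc x) *v Dz (E v)) lam"
      using DE [of v] J_diag_derivative [OF x Dz Dw, of "E v"] by simp
    also have "\<dots> = cdot (Dz (E v)) (transpose (J (zc x) (zc x)) *v lam)"
      by (rule cdot_transpose [symmetric])
    finally show ?thesis by (simp only: 0 cdot_simps)
  qed
  from this [of "axis _ 1"] show ?thesis by (simp add: vec_eq_iff)
qed

text \<open>The covector substituted into the symbol, as a function of the point and of the auxiliary
  variables \<open>z'\<close> and \<open>\<zeta>'\<close>, and the pairs \<open>(w, z')\<close> for which it makes sense.\<close>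

definition fiber_map :: "complex ^ 'n \<Rightarrow> complex ^ 'n \<Rightarrow> complex ^ 'n \<Rightarrow> complex ^ 'n \<Rightarrow> complex ^ 'n"
  where "fiber_map w lam z' \<zeta>' = \<zeta>' + transpose (J (\<Phi> w + z') (\<Phi> w)) *v lam"

definition fiber_dom :: "((complex ^ 'n) \<times> (complex ^ 'n)) set"
  where "fiber_dom = {(w, z'). w \<in> wc ` U \<and> (\<Phi> w + z', \<Phi> w) \<in> N}"

lemma holo_J\<Phi>: "holo_on (\<lambda>(w, z'). J (\<Phi> w + z') (\<Phi> w)) fiber_dom"
proof -
  have op: "open (wc ` U \<times> (UNIV :: (complex ^ 'n) set))" by (intro open_Times open_wcU open_UNIV)
  have "holo_on (\<lambda>x. \<Phi> (fst x)) (wc ` U \<times> (UNIV :: (complex ^ 'n) set))"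
    by (rule holo_on_compose' [OF holo_\<Phi>]) (auto intro!: holo_on_fst holo_on_ident op)
  then have f: "holo_on (\<lambda>x. (\<Phi> (fst x) + snd x, \<Phi> (fst x))) (wc ` U \<times> (UNIV :: (complex ^ 'n) set))"
    by (intro holo_on_Pair holo_on_add holo_on_snd holo_on_ident op)
  have "{x \<in> wc ` U \<times> (UNIV :: (complex ^ 'n) set). (\<Phi> (fst x) + snd x, \<Phi> (fst x)) \<in> N} = fiber_dom"
    by (auto simp: fiber_dom_def)
  then show ?thesis
    using holo_on_compose [OF N_holo f] by (simp add: case_prod_unfold)
qed

lemma holo_fiber_map:
  fixes w lam z' \<zeta>' :: "'e::cnormed \<Rightarrow> complex ^ 'n"
  assumes "holo_on w W" "holo_on lam W" "holo_on z' W" "holo_on \<zeta>' W" "\<And>x. x \<in> W \<Longrightarrow> (w x, z' x) \<in> fiber_dom"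
  shows "holo_on (\<lambda>x. fiber_map (w x) (lam x) (z' x) (\<zeta>' x)) W"
proof -
  have "holo_on (\<lambda>x. J (\<Phi> (w x) + z' x) (\<Phi> (w x))) W"
    using holo_on_compose' [OF holo_J\<Phi> holo_on_Pair [OF assms(1,3)]] assms(5) by auto
  then show ?thesis unfolding fiber_map_def
    by (intro holo_on_add holo_on_matrix_vector_mult holo_on_transpose assms)
qed

lemma fiber_map_scaleR: "t \<noteq> 0 \<Longrightarrow> fiber_map w lam z' \<zeta>' = t *\<^sub>R fiber_map w (inverse t *\<^sub>R lam) z' (inverse t *\<^sub>R \<zeta>')"
proof -
  assume t: "t \<noteq> 0"
  have "A *v (of_real s *\<^sub>C y) = of_real s *\<^sub>C (A *v y)" for A :: "complex ^ 'n ^ 'n" and y and s :: real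
    by (rule matrix_mult_scaleC)
  then show ?thesis using t unfolding fiber_map_def by (simp only: scaleC_of_real) (simp add: scaleR_add_right)
qed

text \<open>Uniform control over a compact set of base points. All conclusions are open conditions that hold
  on the compact set \<open>w = wc x, \<lambda> = \<lambda>0, z' = \<zeta>' = 0, \<bar>\<lambda>0\<bar> = 1\<close>, and they are invariant under a
  common positive factor on \<open>\<lambda>0\<close>, \<open>\<lambda>\<close> and \<open>\<zeta>'\<close>.\<close>

lemma compact_control:
  assumes X: "compact X" "X \<subseteq> U" and \<rho>: "0 < \<rho>"
  obtains \<delta> c C where "0 < \<delta>" "0 < c" "0 < C"
    "\<And>x lam0 w lam z' \<zeta>'. x \<in> X \<Longrightarrow> lam0 \<noteq> 0 \<Longrightarrow> maxnorm (w - wc x) \<le> \<delta> \<Longrightarrow> maxnorm (lam - lam0) \<le> \<delta> * maxnorm lam0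
      \<Longrightarrow> maxnorm z' \<le> \<delta> \<Longrightarrow> maxnorm \<zeta>' \<le> \<delta> * maxnorm lam0 \<Longrightarrow>
      (w, z') \<in> fiber_dom \<and> maxnorm (\<Phi> w - zc x) < \<rho> \<and>
      maxnorm (fiber_map w lam z' \<zeta>' - fiber_map (wc x) lam0 0 0) < \<rho> * maxnorm (fiber_map (wc x) lam0 0 0) \<and>
      c * maxnorm lam0 < maxnorm (fiber_map w lam z' \<zeta>') \<and> maxnorm (fiber_map w lam z' \<zeta>') < C * maxnorm lam0"
proof -
  let ?S = "{lam :: complex ^ 'n. maxnorm lam = 1}"
  have "closed ?S"
    by (rule closed_Collect_eq) (auto intro!: continuous_intros)
  moreover have "bounded ?S"
  proof (rule boundedI)
    show "norm z \<le> real CARD('n)" if "z \<in> ?S" for z :: "complex ^ 'n"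
      using norm_le_maxnorm [of z] that by simp
  qed
  ultimately have S: "compact ?S" by (simp add: compact_eq_bounded_closed)
  have dom0: "(wc x, 0) \<in> fiber_dom" if "x \<in> U" for x
    using that N_diag [OF that] by (auto simp: fiber_dom_def \<Phi> [symmetric])
  have cwc: "continuous_on X wc"
    by (rule continuous_on_subset [OF holo_on_continuous X(2)]) (use wc in \<open>auto simp: coordinates_on_def\<close>)
  \<comment> \<open>Sextuples stand for \<open>(w0, \<lambda>0, w, \<lambda>, z', \<zeta>')\<close>, where \<open>(w0, \<lambda>0)\<close> is the centre of the control.\<close>
  define D :: "'n sextuple set"
    where "D = {(w0, lam0, w, lam, z', \<zeta>'). (w0, 0) \<in> fiber_dom \<and> (w, z') \<in> fiber_dom}"
  have opD: "open D"
  proof -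
    have "D = (\<lambda>y. (fst y, 0)) -` fiber_dom \<inter> (\<lambda>y. (fst (snd (snd y)), fst (snd (snd (snd (snd y)))))) -` fiber_dom"
      by (auto simp: D_def)
    then show ?thesis using holo_on_open [OF holo_J\<Phi>]
      by (auto intro!: open_Int open_vimage continuous_intros)
  qed
  define w0 lam0 w lam z' \<zeta>' where "w0 = (\<lambda>y :: 'n sextuple. fst y)"
    and "lam0 = (\<lambda>y :: 'n sextuple. fst (snd y))"
    and "w = (\<lambda>y :: 'n sextuple. fst (snd (snd y)))"
    and "lam = (\<lambda>y :: 'n sextuple. fst (snd (snd (snd y))))"
    and "z' = (\<lambda>y :: 'n sextuple. fst (snd (snd (snd (snd y)))))"
    and "\<zeta>' = (\<lambda>y :: 'n sextuple. snd (snd (snd (snd (snd y)))))"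
  note projs = w0_def lam0_def w_def lam_def z'_def \<zeta>'_def
  have hprojs: "holo_on w0 D" "holo_on lam0 D" "holo_on w D" "holo_on lam D" "holo_on z' D" "holo_on \<zeta>' D"
    unfolding projs by (intro holo_on_fst holo_on_snd holo_on_ident opD)+
  define T T0 where "T y = fiber_map (w y) (lam y) (z' y) (\<zeta>' y)" and "T0 y = fiber_map (w0 y) (lam0 y) 0 0" for y
  have T: "continuous_on D T" unfolding T_def
    by (intro holo_on_continuous holo_fiber_map hprojs) (auto simp: D_def projs)
  have T0: "continuous_on D T0" unfolding T0_def
    by (intro holo_on_continuous holo_fiber_map hprojs holo_on_const opD) (auto simp: D_def projs)
  have \<Phi>w: "continuous_on D (\<lambda>y. \<Phi> (w y))"
    by (intro holo_on_continuous holo_on_compose' [OF holo_\<Phi>] hprojs) (auto simp: D_def projs fiber_dom_def)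
  have \<Phi>w0: "continuous_on D (\<lambda>y. \<Phi> (w0 y))"
    by (intro holo_on_continuous holo_on_compose' [OF holo_\<Phi>] hprojs) (auto simp: D_def projs fiber_dom_def)
  define K where "K = (\<lambda>(x, l). (wc x, l, wc x, l, 0 :: complex ^ 'n, 0 :: complex ^ 'n)) ` (X \<times> ?S)"
  have K: "compact K"
    unfolding K_def case_prod_unfold
    by (intro compact_continuous_image compact_Times X S continuous_intros continuous_on_compose2 [OF cwc]) auto
  have KD: "K \<subseteq> D" using X dom0 by (auto simp: K_def D_def)
  have T0K: "T0 y \<noteq> 0" if "y \<in> K" for y
  proof -
    obtain x l where "x \<in> U" "maxnorm l = 1" "y = (wc x, l, wc x, l, 0, 0)"
      using \<open>y \<in> K\<close> X by (auto simp: K_def)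
    then show ?thesis
      using J_diag_nonsingular [of x l] by (auto simp: T0_def fiber_map_def projs \<Phi> [symmetric])
  qed
  have "compact ((\<lambda>y. maxnorm (T0 y)) ` K)"
    by (intro compact_continuous_image K continuous_intros continuous_on_subset [OF T0 KD])
  then have "closed ((\<lambda>y. maxnorm (T0 y)) ` K)" "bounded ((\<lambda>y. maxnorm (T0 y)) ` K)"
    by (auto simp: compact_eq_bounded_closed)
  moreover have "0 \<notin> (\<lambda>y. maxnorm (T0 y)) ` K"
  proof
    assume "0 \<in> (\<lambda>y. maxnorm (T0 y)) ` K"
    then obtain y where y: "0 = maxnorm (T0 y)" "y \<in> K" by (rule imageE)
    have "T0 y = 0" using y(1) by (simp only: maxnorm_eq_0_iff [symmetric])
    with T0K [OF y(2)] show False by contradiction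
  qed
  ultimately obtain c' C' where c': "c' > 0" "\<forall>s\<in>(\<lambda>y. maxnorm (T0 y)) ` K. c' \<le> dist 0 s"
    and C': "C' > 0" "\<forall>s\<in>(\<lambda>y. maxnorm (T0 y)) ` K. norm s \<le> C'"
    using separate_point_closed [of "(\<lambda>y. maxnorm (T0 y)) ` K" 0] bounded_pos [of "(\<lambda>y. maxnorm (T0 y)) ` K"]
    by meson
  define c C where "c = c'" and "C = C'"
  have c: "c > 0" "c \<le> maxnorm (T0 y)" and C: "C > 0" "maxnorm (T0 y) \<le> C" if "y \<in> K" for y
    using c'(1) C'(1) bspec [OF c'(2) imageI [OF that]] bspec [OF C'(2) imageI [OF that]]
    by (simp_all add: c_def C_def)
  have c0: "c > 0" and C0: "C > 0" using c' C' by (simp_all add: c_def C_def)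
  define G where "G = {y \<in> D. maxnorm (\<Phi> (w y) - \<Phi> (w0 y)) < \<rho> \<and> maxnorm (T y - T0 y) < \<rho> * maxnorm (T0 y)
    \<and> c / 2 < maxnorm (T y) \<and> maxnorm (T y) < 2 * C}"
  have "open G"
  proof -
    have "G = (D \<inter> (\<lambda>y. maxnorm (\<Phi> (w y) - \<Phi> (w0 y)) - \<rho>) -` {..<0}) \<inter> (D \<inter> (\<lambda>y. maxnorm (T y - T0 y) - \<rho> * maxnorm (T0 y)) -` {..<0})
      \<inter> (D \<inter> (\<lambda>y. maxnorm (T y)) -` {c/2<..<2 * C})"
      by (auto simp: G_def)
    also have "open \<dots>"
    proof (rule open_Int, rule open_Int)
      show "open (D \<inter> (\<lambda>y. maxnorm (\<Phi> (w y) - \<Phi> (w0 y)) - \<rho>) -` {..<0})"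
        by (rule continuous_open_preimage [OF _ opD open_lessThan]) (intro continuous_intros \<Phi>w \<Phi>w0)
      show "open (D \<inter> (\<lambda>y. maxnorm (T y - T0 y) - \<rho> * maxnorm (T0 y)) -` {..<0})"
        by (rule continuous_open_preimage [OF _ opD open_lessThan]) (intro continuous_intros T T0)
      show "open (D \<inter> (\<lambda>y. maxnorm (T y)) -` {c/2<..<2 * C})"
        by (rule continuous_open_preimage [OF _ opD open_greaterThanLessThan]) (intro continuous_intros T)
    qed
    finally show ?thesis .
  qed
  moreover have "K \<subseteq> G"
  proof
    fix y assume y: "y \<in> K"
    then have "T y = T0 y" "w y = w0 y" by (auto simp: K_def T_def T0_def projs)
    moreover have "0 < maxnorm (T0 y)" using c(2) [OF y] c0 by linarith
    ultimately show "y \<in> G" using y KD c0 c(2) [OF y] C0 C(2) [OF y] \<rho> by (auto simp: G_def)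
  qed
  ultimately obtain \<epsilon> where \<epsilon>: "\<epsilon> > 0" "(\<Union>y\<in>K. ball y \<epsilon>) \<subseteq> G"
    using compact_subset_open_imp_ball_epsilon_subset [OF K] by metis
  \<comment> \<open>Four vectors of max norm at most \<open>\<delta>\<close> have Euclidean norms adding up to less than \<open>\<epsilon>\<close>.\<close>
  define \<delta> where "\<delta> = \<epsilon> / (5 * real CARD('n))"
  have \<delta>: "\<delta> > 0" using \<epsilon> by (simp add: \<delta>_def)
  have main: "(w, z') \<in> fiber_dom \<and> maxnorm (\<Phi> w - zc x) < \<rho> \<and>
      maxnorm (fiber_map w lam z' \<zeta>' - fiber_map (wc x) lam0 0 0) < \<rho> * maxnorm (fiber_map (wc x) lam0 0 0) \<and>
      c/2 < maxnorm (fiber_map w lam z' \<zeta>') \<and> maxnorm (fiber_map w lam z' \<zeta>') < 2 * C"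
    if "x \<in> X" "maxnorm lam0 = 1" "maxnorm (w - wc x) \<le> \<delta>" "maxnorm (lam - lam0) \<le> \<delta>" "maxnorm z' \<le> \<delta>" "maxnorm \<zeta>' \<le> \<delta>"
    for x lam0 w lam z' \<zeta>'
  proof -
    have nb: "norm v \<le> \<epsilon> / 5" if "maxnorm v \<le> \<delta>" for v :: "complex ^ 'n"
      using norm_le_maxnorm [of v] mult_left_mono [OF that, of "real CARD('n)"] by (simp add: \<delta>_def)
    let ?y = "(wc x, lam0, w, lam, z', \<zeta>')" and ?ctr = "(wc x, lam0, wc x, lam0, 0, 0)"
    have "norm (?y - ?ctr) \<le> norm (wc x - wc x) + (norm (lam0 - lam0) + (norm (w - wc x) + (norm (lam - lam0) + (norm z' + norm \<zeta>'))))"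
      unfolding diff_Pair diff_zero
      by (intro order_trans [OF norm_Pair_le add_left_mono] order_refl)
    also have "\<dots> < \<epsilon>" using nb [OF that(3)] nb [OF that(4)] nb [OF that(5)] nb [OF that(6)] \<epsilon> by simp
    finally have "?y \<in> ball ?ctr \<epsilon>"
      unfolding mem_ball by (subst dist_commute) (simp only: dist_norm)
    moreover have "?ctr \<in> K" using that by (auto simp: K_def)
    ultimately have "?y \<in> G" using \<epsilon> by blast
    moreover have "\<Phi> (wc x) = zc x" using that X \<Phi> by auto
    ultimately show ?thesis by (auto simp: G_def D_def T_def T0_def projs)
  qed
  show ?thesis
  proof (rule that [of \<delta> "c/2" "2 * C"])
    fix x lam0 w lam z' \<zeta>' :: "complex ^ 'n"
    assume a: "x \<in> X" "lam0 \<noteq> 0" "maxnorm (w - wc x) \<le> \<delta>" "maxnorm (lam - lam0) \<le> \<delta> * maxnorm lam0"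
      "maxnorm z' \<le> \<delta>" "maxnorm \<zeta>' \<le> \<delta> * maxnorm lam0"
    define t where "t = maxnorm lam0"
    have t: "t > 0" using a(2) maxnorm_eq_0_iff maxnorm_nonneg unfolding t_def by (metis less_eq_real_def)
    let ?s = "\<lambda>v :: complex ^ 'n. inverse t *\<^sub>R v"
    have m: "maxnorm (?s v) = maxnorm v / t" for v using t by (simp add: maxnorm_scaleR field_simps)
    have "(w, z') \<in> fiber_dom \<and> maxnorm (\<Phi> w - zc x) < \<rho> \<and>
      maxnorm (fiber_map w (?s lam) z' (?s \<zeta>') - fiber_map (wc x) (?s lam0) 0 0) < \<rho> * maxnorm (fiber_map (wc x) (?s lam0) 0 0) \<and>
      c/2 < maxnorm (fiber_map w (?s lam) z' (?s \<zeta>')) \<and> maxnorm (fiber_map w (?s lam) z' (?s \<zeta>')) < 2 * C"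
    proof (rule main [OF a(1) _ a(3) _ a(5)])
      show "maxnorm (?s lam0) = 1" using t by (simp add: m, simp add: t_def)
      have "maxnorm (?s (lam - lam0)) \<le> \<delta>" unfolding m using a(4) t by (simp add: pos_divide_le_eq t_def)
      then show "maxnorm (?s lam - ?s lam0) \<le> \<delta>" by (simp add: scaleR_diff_right)
      show "maxnorm (?s \<zeta>') \<le> \<delta>" unfolding m using a(6) t by (simp add: pos_divide_le_eq t_def)
    qed
    moreover have "fiber_map w lam z' \<zeta>' = t *\<^sub>R fiber_map w (?s lam) z' (?s \<zeta>')" "fiber_map (wc x) lam0 0 0 = t *\<^sub>R fiber_map (wc x) (?s lam0) 0 0"
      using fiber_map_scaleR [of t w lam z' \<zeta>'] fiber_map_scaleR [of t "wc x" lam0 0 0] t by auto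
    ultimately show "(w, z') \<in> fiber_dom \<and> maxnorm (\<Phi> w - zc x) < \<rho> \<and>
      maxnorm (fiber_map w lam z' \<zeta>' - fiber_map (wc x) lam0 0 0) < \<rho> * maxnorm (fiber_map (wc x) lam0 0 0) \<and>
      c / 2 * maxnorm lam0 < maxnorm (fiber_map w lam z' \<zeta>') \<and> maxnorm (fiber_map w lam z' \<zeta>') < 2 * C * maxnorm lam0"
      using t by (simp only: scaleR_diff_right [symmetric] maxnorm_scaleR t_def [symmetric])
        (simp add: mult.commute [of t] mult.left_commute [of t])
  qed (use \<delta> c0 C0 in auto)
qed

end


section \<open>Symbol domains\<close>

lemma symbol_domain_mono:
  assumes "0 < d1" "d1 \<le> d2" "0 < \<rho>2" "\<rho>2 \<le> \<rho>1" "\<rho>1 < 1"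
  shows "symbol_domain V d2 \<rho>2 \<subseteq> symbol_domain V d1 \<rho>1"
proof -
  have "maxnorm \<zeta>' \<le> \<rho>1 * maxnorm \<zeta>" if "maxnorm \<zeta>' \<le> \<rho>2 * maxnorm \<zeta>" for \<zeta> \<zeta>' :: "complex ^ 'n"
    using that mult_right_mono [OF assms(4) maxnorm_nonneg [of \<zeta>]] by linarith
  then have "fatten \<rho>2 V \<subseteq> fatten \<rho>1 V"
    unfolding fatten_def using assms by (intro closure_mono UN_mono) fastforce+
  moreover have "d1 * (1 - \<rho>1) \<le> d2 * (1 - \<rho>2)"
    using assms by (intro mult_mono) auto
  ultimately show ?thesis
    by (auto simp: symbol_domain_def truncated_def)
qed

lemma symbol_domain_pos:
  assumes "(z, \<zeta>) \<in> symbol_domain V d \<rho>" "0 < d" "\<rho> < 1"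
  shows "0 < maxnorm \<zeta>"
proof -
  have "0 < d * (1 - \<rho>)" using assms by simp
  then show ?thesis using assms(1) by (auto simp: symbol_domain_def truncated_def)
qed

lemma interior_symbol_domainI:
  assumes V: "(z0, \<zeta>0) \<in> V" and z: "maxnorm (z - z0) < \<rho>" and \<zeta>: "maxnorm (\<zeta> - \<zeta>0) < \<rho> * maxnorm \<zeta>0"
    and d: "d * (1 - \<rho>) < maxnorm \<zeta>"
  shows "(z, \<zeta>) \<in> interior (symbol_domain V d \<rho>)"
proof (rule interiorI)
  let ?O = "{(z, \<zeta>). maxnorm (z - z0) < \<rho> \<and> maxnorm (\<zeta> - \<zeta>0) < \<rho> * maxnorm \<zeta>0 \<and> d * (1 - \<rho>) < maxnorm \<zeta>}"
  show "open ?O"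
    unfolding case_prod_unfold by (intro open_Collect_conj open_Collect_less continuous_intros)
  show "(z, \<zeta>) \<in> ?O" using assms by simp
  show "?O \<subseteq> symbol_domain V d \<rho>"
  proof
    fix p assume "p \<in> ?O"
    then obtain z \<zeta> where p: "p = (z, \<zeta>)" "maxnorm (z - z0) < \<rho>" "maxnorm (\<zeta> - \<zeta>0) < \<rho> * maxnorm \<zeta>0" "d * (1 - \<rho>) < maxnorm \<zeta>"
      by auto
    have "(z, \<zeta>) \<in> (\<Union>(z, \<zeta>)\<in>V. {(z + z', \<zeta> + \<zeta>') |z' \<zeta>'. maxnorm z' \<le> \<rho> \<and> maxnorm \<zeta>' \<le> \<rho> * maxnorm \<zeta>})"
    proof (rule UN_I [OF V], unfold case_prod_conv mem_Collect_eq, intro exI conjI)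
      show "(z, \<zeta>) = (z0 + (z - z0), \<zeta>0 + (\<zeta> - \<zeta>0))" by simp
    qed (use p in auto)
    then have "(z, \<zeta>) \<in> fatten \<rho> V"
      unfolding fatten_def by (rule subsetD [OF closure_subset])
    then show "p \<in> symbol_domain V d \<rho>"
      using p by (simp add: symbol_domain_def truncated_def)
  qed
qed

context coordinate_change
begin

text \<open>The same control on a symbol domain in the coordinates \<open>w\<close>, with values in the interior of the
  given symbol domain in the coordinates \<open>z\<close>.\<close>

lemma symbol_control:
  assumes X: "compact X" "X \<subseteq> U" "fst ` V \<subseteq> X" and d: "0 < d" and \<rho>: "0 < \<rho>" "\<rho> < 1"
  obtains d' \<rho>' \<delta> c C where "0 < d'" "0 < \<rho>'" "\<rho>' < 1" "0 < \<delta>" "0 < c" "0 < C"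
    "\<And>w lam z' \<zeta>'. (w, lam) \<in> symbol_domain (in_coordinates wc U V) d' \<rho>' \<Longrightarrow> maxnorm z' \<le> \<delta> \<Longrightarrow>
      maxnorm \<zeta>' \<le> \<delta> * maxnorm lam \<Longrightarrow>
      (w, z') \<in> fiber_dom \<and> (\<Phi> w, fiber_map w lam z' \<zeta>') \<in> interior (symbol_domain (in_coordinates zc U V) d \<rho>) \<and>
      c * maxnorm lam \<le> maxnorm (fiber_map w lam z' \<zeta>') \<and> maxnorm (fiber_map w lam z' \<zeta>') \<le> C * maxnorm lam"
proof -
  obtain \<delta>0 c0 C0 where pos: "0 < \<delta>0" "0 < c0" "0 < C0" and control:
    "\<And>x lam0 w lam z' \<zeta>'. x \<in> X \<Longrightarrow> lam0 \<noteq> 0 \<Longrightarrow> maxnorm (w - wc x) \<le> \<delta>0 \<Longrightarrow> maxnorm (lam - lam0) \<le> \<delta>0 * maxnorm lam0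
      \<Longrightarrow> maxnorm z' \<le> \<delta>0 \<Longrightarrow> maxnorm \<zeta>' \<le> \<delta>0 * maxnorm lam0 \<Longrightarrow>
      (w, z') \<in> fiber_dom \<and> maxnorm (\<Phi> w - zc x) < \<rho> \<and>
      maxnorm (fiber_map w lam z' \<zeta>' - fiber_map (wc x) lam0 0 0) < \<rho> * maxnorm (fiber_map (wc x) lam0 0 0) \<and>
      c0 * maxnorm lam0 < maxnorm (fiber_map w lam z' \<zeta>') \<and> maxnorm (fiber_map w lam z' \<zeta>') < C0 * maxnorm lam0"
    by (rule compact_control [OF X(1,2) \<rho>(1)]) (rule that)
  define \<rho>' where "\<rho>' = min (\<delta>0 / 2) (1/4)"
  \<comment> \<open>The factor 4 absorbs \<open>1 - \<rho>'\<close> and the ratio of \<open>\<bar>\<lambda>\<bar>\<close> to \<open>\<bar>\<lambda>0\<bar>\<close>.\<close>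
  define d' where "d' = 4 * d / c0"
  have \<rho>': "0 < \<rho>'" "\<rho>' \<le> 1/4" "2 * \<rho>' \<le> \<delta>0" and d': "0 < d'" using pos d by (auto simp: \<rho>'_def d'_def)
  show ?thesis
  proof (rule that [of d' \<rho>' "\<delta>0 / 2" "c0 / 2" "2 * C0"])
    fix w lam z' \<zeta>' :: "complex ^ 'n"
    assume wl: "(w, lam) \<in> symbol_domain (in_coordinates wc U V) d' \<rho>'"
      and z': "maxnorm z' \<le> \<delta>0 / 2" and \<zeta>': "maxnorm \<zeta>' \<le> \<delta>0 / 2 * maxnorm lam"
    define l where "l = maxnorm lam"
    have l_ge: "d' * (1 - \<rho>') \<le> l" using wl by (simp add: symbol_domain_def truncated_def l_def)
    have l: "0 < l" unfolding l_def by (rule symbol_domain_pos [OF wl d']) (use \<rho>' in simp)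
    \<comment> \<open>How closely the point of the closure is approximated by the union of polydiscs.\<close>
    define e where "e = \<rho>' * min 1 (l / 4)"
    have e: "0 < e" "e \<le> \<rho>'" "e \<le> \<rho>' * l / 4" using \<rho>'(1) l by (auto simp: e_def min_def)
    have "(w, lam) \<in> closure (\<Union>(z, \<zeta>)\<in>in_coordinates wc U V.
        {(z + z', \<zeta> + \<zeta>') |z' \<zeta>'. maxnorm z' \<le> \<rho>' \<and> maxnorm \<zeta>' \<le> \<rho>' * maxnorm \<zeta>})"
      using wl by (simp add: symbol_domain_def truncated_def fatten_def)
    then obtain y where y: "y \<in> (\<Union>(z, \<zeta>)\<in>in_coordinates wc U V.
        {(z + z', \<zeta> + \<zeta>') |z' \<zeta>'. maxnorm z' \<le> \<rho>' \<and> maxnorm \<zeta>' \<le> \<rho>' * maxnorm \<zeta>})" "dist y (w, lam) < e"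
      using e(1) closure_approachable by meson
    then obtain w0 lam0 a b where V0: "(w0, lam0) \<in> in_coordinates wc U V" and y_eq: "y = (w0 + a, lam0 + b)"
      and ab: "maxnorm a \<le> \<rho>'" "maxnorm b \<le> \<rho>' * maxnorm lam0"
      by auto
    define l0 where "l0 = maxnorm lam0"
    obtain x where x: "x \<in> U" "w0 = wc x" "(zc x, transpose (J (zc x) (zc x)) *v lam0) \<in> in_coordinates zc U V" "x \<in> X"
      by (rule in_coordinates_change [OF V0]) (use X in blast)
    have dw: "maxnorm (w - (w0 + a)) \<le> e" and dl: "maxnorm (lam - (lam0 + b)) \<le> e"
    proof -
      have "norm (w0 + a - w) \<le> dist y (w, lam)" "norm (lam0 + b - lam) \<le> dist y (w, lam)"
        using dist_fst_le [of y "(w, lam)"] dist_snd_le [of y "(w, lam)"] by (simp_all add: y_eq dist_norm)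
      then have "norm (w - (w0 + a)) \<le> e" "norm (lam - (lam0 + b)) \<le> e"
        using y(2) by (simp_all add: norm_minus_commute)
      then show "maxnorm (w - (w0 + a)) \<le> e" "maxnorm (lam - (lam0 + b)) \<le> e"
        using maxnorm_le_norm order_trans by blast+
    qed
    have "maxnorm (w - wc x) \<le> maxnorm (w - (w0 + a)) + maxnorm a"
      using maxnorm_triangle [of "w - (w0 + a)" a] x(2) by simp
    then have w: "maxnorm (w - wc x) \<le> \<delta>0" using dw ab(1) e(2) \<rho>'(3) by linarith
    have dlam: "maxnorm (lam - lam0) \<le> e + \<rho>' * l0"
      using maxnorm_triangle [of "lam - (lam0 + b)" b] dl ab(2) by (simp add: l0_def)
    have l_le: "l \<le> 4/3 * l0"
    proof -
      have "l \<le> l0 + (e + \<rho>' * l0)" using dlam maxnorm_diff_le [of lam lam0] by (simp add: l_def l0_def)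
      moreover have "\<rho>' * l0 \<le> 1/4 * l0" using \<rho>' by (intro mult_right_mono) (auto simp: l0_def)
      moreover have "\<rho>' * l / 4 \<le> (1/4) * l / 4" using \<rho>' l by (intro divide_right_mono mult_right_mono) auto
      ultimately show ?thesis using e(3) by linarith
    qed
    have e0: "e \<le> \<rho>' * l0"
    proof -
      have "\<rho>' * l / 4 \<le> \<rho>' * (4/3 * l0) / 4" using l_le \<rho>' by (intro divide_right_mono mult_left_mono) auto
      moreover have "0 \<le> \<rho>' * l0" using \<rho>' by (simp add: l0_def)
      ultimately show ?thesis using e(3) by simp
    qed
    have dlam': "maxnorm (lam - lam0) \<le> 2 * \<rho>' * l0" using dlam e0 by simp
    then have lam: "maxnorm (lam - lam0) \<le> \<delta>0 * maxnorm lam0"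
      using mult_right_mono [OF \<rho>'(3), of l0] by (simp add: l0_def)
    have l0_le: "l0 \<le> 2 * l"
    proof -
      have "2 * \<rho>' * l0 \<le> (1/2) * l0" using \<rho>' by (intro mult_right_mono) (auto simp: l0_def)
      moreover have "l0 \<le> l + maxnorm (lam - lam0)" using maxnorm_diff_le [of lam lam0] by (simp add: l_def l0_def)
      ultimately show ?thesis using dlam' by linarith
    qed
    have l0: "0 < l0" using l l_le by linarith
    have \<zeta>0: "fiber_map (wc x) lam0 0 0 = transpose (J (zc x) (zc x)) *v lam0"
      by (simp add: fiber_map_def \<Phi> [symmetric] x(1))
    have "maxnorm \<zeta>' \<le> \<delta>0 * maxnorm lam0"
    proof -
      have "\<delta>0 / 2 * l \<le> \<delta>0 / 2 * (4/3 * l0)" using l_le pos by (intro mult_left_mono) auto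
      also have "\<dots> \<le> \<delta>0 * l0" using pos l0 by simp
      finally show ?thesis using \<zeta>' by (simp add: l_def l0_def)
    qed
    moreover have "maxnorm z' \<le> \<delta>0" using z' pos by linarith
    moreover have "lam0 \<noteq> 0" using l0 by (auto simp: l0_def)
    ultimately have ctl: "(w, z') \<in> fiber_dom" "maxnorm (\<Phi> w - zc x) < \<rho>"
      "maxnorm (fiber_map w lam z' \<zeta>' - fiber_map (wc x) lam0 0 0) < \<rho> * maxnorm (fiber_map (wc x) lam0 0 0)"
      "c0 * l0 < maxnorm (fiber_map w lam z' \<zeta>')" "maxnorm (fiber_map w lam z' \<zeta>') < C0 * l0"
      using control [OF x(4) _ w lam, of z' \<zeta>'] by (auto simp: l0_def)
    have "d * (1 - \<rho>) < maxnorm (fiber_map w lam z' \<zeta>')"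
    proof -
      have "d' * (3/4) \<le> d' * (1 - \<rho>')" using d' \<rho>' by (intro mult_left_mono) auto
      then have "d' * (3/4) \<le> 4/3 * l0" using l_ge l_le by linarith
      then have "c0 * (d' * (3/4)) \<le> c0 * (4/3 * l0)" using pos by (intro mult_left_mono) auto
      moreover have "c0 * d' = 4 * d" using pos by (simp add: d'_def)
      ultimately have "d < c0 * l0" using d by (simp add: algebra_simps)
      moreover have "d * (1 - \<rho>) \<le> d" using d \<rho> by (simp add: algebra_simps)
      ultimately show ?thesis using ctl(4) by linarith
    qed
    then have "(\<Phi> w, fiber_map w lam z' \<zeta>') \<in> interior (symbol_domain (in_coordinates zc U V) d \<rho>)"
      using interior_symbol_domainI [OF x(3) ctl(2)] ctl(3) by (simp only: \<zeta>0)
    moreover have "c0 / 2 * l \<le> maxnorm (fiber_map w lam z' \<zeta>')"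
    proof -
      have "c0 / 2 * l \<le> c0 / 2 * (4/3 * l0)" using l_le pos by (intro mult_left_mono) auto
      also have "\<dots> \<le> c0 * l0" using pos l0 by simp
      finally show ?thesis using ctl(4) by linarith
    qed
    moreover have "maxnorm (fiber_map w lam z' \<zeta>') \<le> 2 * C0 * l"
      using ctl(5) mult_left_mono [OF l0_le, of C0] pos by linarith
    ultimately show "(w, z') \<in> fiber_dom \<and> (\<Phi> w, fiber_map w lam z' \<zeta>') \<in> interior (symbol_domain (in_coordinates zc U V) d \<rho>) \<and>
      c0 / 2 * maxnorm lam \<le> maxnorm (fiber_map w lam z' \<zeta>') \<and> maxnorm (fiber_map w lam z' \<zeta>') \<le> 2 * C0 * maxnorm lam"
      using ctl(1) by (simp add: l_def)
  qed (use pos \<rho>' d' in auto)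
qed

end

section \<open>The pullback\<close>

lemma deriv_eq_dir_deriv:
  fixes F :: "'e::cnormed \<times> complex \<Rightarrow> complex"
  shows "deriv (\<lambda>\<eta>. F (y, \<eta>)) \<eta> = dir_deriv (0, 1) F (y, \<eta>)"
proof -
  have "deriv (\<lambda>\<eta>. F (y, \<eta>)) \<eta> = deriv (\<lambda>s. F (y, \<eta> + s)) 0"
    by (subst deriv_shift_0) (simp add: o_def)
  then show ?thesis by (simp add: dir_deriv_def Pair_scaleC)
qed

lemma holo_on_deriv_param:
  fixes Q :: "'a::cnormed \<Rightarrow> 'b::cnormed \<Rightarrow> complex \<Rightarrow> complex"
  assumes "holo_on (\<lambda>((z, \<zeta>), \<eta>). Q z \<zeta> \<eta>) W"
  shows "holo_on (\<lambda>((z, \<zeta>), \<eta>). deriv (Q z \<zeta>) \<eta>) W"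
proof -
  have "deriv (Q z \<zeta>) \<eta> = dir_deriv (0, 1) (\<lambda>((z, \<zeta>), \<eta>). Q z \<zeta> \<eta>) ((z, \<zeta>), \<eta>)" for z \<zeta> \<eta>
    using deriv_eq_dir_deriv [of "\<lambda>((z, \<zeta>), \<eta>). Q z \<zeta> \<eta>" "(z, \<zeta>)" \<eta>] by simp
  then have "(\<lambda>((z, \<zeta>), \<eta>). deriv (Q z \<zeta>) \<eta>) = dir_deriv (0, 1) (\<lambda>((z, \<zeta>), \<eta>). Q z \<zeta> \<eta>)"
    by (auto simp: fun_eq_iff)
  then show ?thesis using holo_on_dir_deriv [OF assms] by simp
qed

text \<open>Collecting the terms of the pullback by the index of the coefficient of \<open>P\<close>.\<close>

lemma pullback_eq_transform:
  "pullback \<Phi> J P \<nu> w lam \<eta> = (\<Sum>k\<le>\<nu>. transform (\<lambda>z'. J (\<Phi> w + z') (\<Phi> w)) (\<nu> - k) (\<lambda>\<zeta>. P k (\<Phi> w) \<zeta> \<eta>) lam)"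
proof -
  have "{(k, \<alpha> :: 'a \<Rightarrow> nat). k + (\<Sum>i\<in>UNIV. \<alpha> i) = \<nu>} = Sigma {..\<nu>} (\<lambda>k. mindex (\<nu> - k))"
    by (auto simp: mindex_def)
  then show ?thesis
    by (simp add: pullback_def transform_def contract_def sum.Sigma)
qed

text \<open>All coefficients are holomorphic on the open set \<open>D \<times> S\<close>.\<close>

definition lifted :: "'n::finite cotangent set \<Rightarrow> complex set \<Rightarrow> 'n formal_symbol \<Rightarrow> bool"
  where "lifted D S P \<longleftrightarrow> open D \<and> open S \<and> (\<forall>k. holo_on (\<lambda>((z, \<zeta>), \<eta>). P k z \<zeta> \<eta>) (D \<times> S))"

text \<open>The sequence of partial sums, by which the null class is defined.\<close>

definition partial_sums :: "'n formal_symbol \<Rightarrow> 'n::finite formal_symbol"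
  where "partial_sums P m z \<zeta> \<eta> = (\<Sum>\<nu><m. P \<nu> z \<zeta> \<eta>)"

context coordinate_change
begin

text \<open>The points where the pullback of a symbol on \<open>D \<times> S\<close> is defined.\<close>

definition pull_dom :: "'n cotangent set \<Rightarrow> complex set \<Rightarrow> ('n cotangent \<times> complex) set"
  where "pull_dom D S = {((w, lam), \<eta>). (w, 0) \<in> fiber_dom \<and> (\<Phi> w, fiber_map w lam 0 0) \<in> D \<and> \<eta> \<in> S}"

text \<open>The coefficient after the substitution, as a function of the parameters \<open>((w, \<lambda>), \<eta>)\<close> and of
  \<open>(z', \<zeta>')\<close>, and its domain.\<close>

definition subst_symbol :: "'n formal_symbol \<Rightarrow> nat \<Rightarrow> ('n cotangent \<times> complex) \<times> (complex ^ 'n) \<times> (complex ^ 'n) \<Rightarrow> complex"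
  where "subst_symbol P k = (\<lambda>(((w, lam), \<eta>), z', \<zeta>'). P k (\<Phi> w) (fiber_map w lam z' \<zeta>') \<eta>)"

definition subst_dom :: "'n cotangent set \<Rightarrow> complex set \<Rightarrow> (('n cotangent \<times> complex) \<times> (complex ^ 'n) \<times> (complex ^ 'n)) set"
  where "subst_dom D S = {(((w, lam), \<eta>), z', \<zeta>'). (w, z') \<in> fiber_dom \<and> (\<Phi> w, fiber_map w lam z' \<zeta>') \<in> D \<and> \<eta> \<in> S}"

lemma holo_subst_symbol_arg:
  shows "holo_on (\<lambda>(((w, lam), \<eta> :: complex), z', \<zeta>'). ((\<Phi> w, fiber_map w lam z' \<zeta>'), \<eta>)) {(((w, lam), \<eta>), z', \<zeta>'). (w, z') \<in> fiber_dom}"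
    (is "holo_on ?f ?W")
proof -
  have W: "?W = (\<lambda>x. (fst (fst (fst x)), fst (snd x))) -` fiber_dom" by auto
  have op: "open ?W"
    unfolding W using holo_on_open [OF holo_J\<Phi>] by (intro open_vimage continuous_intros)
  have dom: "fst (fst (fst x)) \<in> wc ` U" if "x \<in> ?W" for x using that by (auto simp: fiber_dom_def)
  have c: "holo_on (\<lambda>x. fst (fst (fst x))) ?W" "holo_on (\<lambda>x. snd (fst (fst x))) ?W"
    "holo_on (\<lambda>x. fst (snd x)) ?W" "holo_on (\<lambda>x. snd (snd x)) ?W" "holo_on (\<lambda>x. snd (fst x)) ?W"
    by (intro holo_on_fst holo_on_snd holo_on_ident op)+
  have 1: "holo_on (\<lambda>x. \<Phi> (fst (fst (fst x)))) ?W"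
    by (rule holo_on_compose' [OF holo_\<Phi> c(1)]) (use dom in blast)
  have 2: "holo_on (\<lambda>x. fiber_map (fst (fst (fst x))) (snd (fst (fst x))) (fst (snd x)) (snd (snd x))) ?W"
    by (rule holo_fiber_map [OF c(1-4)]) auto
  have "holo_on (\<lambda>x. ((\<Phi> (fst (fst (fst x))), fiber_map (fst (fst (fst x))) (snd (fst (fst x))) (fst (snd x)) (snd (snd x))), snd (fst x))) ?W"
    by (rule holo_on_Pair [OF holo_on_Pair [OF 1 2] c(5)])
  then show ?thesis by (simp add: case_prod_unfold)
qed

lemma holo_subst_symbol:
  assumes P: "lifted D S P"
  shows "holo_on (subst_symbol P k) (subst_dom D S)"
proof -
  have Pk: "holo_on (\<lambda>((z, \<zeta>), \<eta>). P k z \<zeta> \<eta>) (D \<times> S)"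
    using P by (auto simp: lifted_def)
  have "{x \<in> {(((w, lam), \<eta>), z', \<zeta>'). (w, z') \<in> fiber_dom}. (\<lambda>(((w, lam), \<eta>), z', \<zeta>'). ((\<Phi> w, fiber_map w lam z' \<zeta>'), \<eta>)) x \<in> D \<times> S} = subst_dom D S"
    by (auto simp: subst_dom_def)
  then show ?thesis
    using holo_on_compose [OF Pk holo_subst_symbol_arg] by (simp add: subst_symbol_def case_prod_unfold)
qed

lemma open_pull_dom:
  assumes "open D" "open S"
  shows "open (pull_dom D S)"
proof -
  have "holo_on (subst_symbol (\<lambda>_ _ _ _. 0) 0) (subst_dom D S)"
    by (rule holo_subst_symbol) (use assms in \<open>auto simp: lifted_def case_prod_unfold intro!: holo_on_const open_Times\<close>)
  then have "open (subst_dom D S)" by (rule holo_on_open)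
  then have "open ((\<lambda>y. (y, 0, 0)) -` subst_dom D S)" by (intro open_vimage continuous_intros)
  moreover have "(\<lambda>y. (y, 0, 0)) -` subst_dom D S = pull_dom D S" by (auto simp: subst_dom_def pull_dom_def)
  ultimately show ?thesis by simp
qed

lemma pullback_eq_contract:
  "pullback \<Phi> J P \<nu> w lam \<eta> = (\<Sum>k\<le>\<nu>. contract (\<nu> - k) (\<lambda>z' \<zeta>'. subst_symbol P k (((w, lam), \<eta>), z', \<zeta>')))"
  by (simp add: pullback_eq_transform transform_def subst_symbol_def fiber_map_def)

lemma holo_subst_symbol_contract:
  assumes P: "lifted D S P"
  shows "holo_on (\<lambda>y. contract m (\<lambda>z' \<zeta>'. subst_symbol P k (y, z', \<zeta>'))) (pull_dom D S)"
  by (rule holo_on_contract [OF holo_subst_symbol [OF P] open_pull_dom])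
    (use P in \<open>auto simp: lifted_def pull_dom_def subst_dom_def\<close>)

lemma pullback_eq_contract':
  "(\<lambda>((w, lam), \<eta>). pullback \<Phi> J P \<nu> w lam \<eta>) = (\<lambda>y. \<Sum>k\<le>\<nu>. contract (\<nu> - k) (\<lambda>z' \<zeta>'. subst_symbol P k (y, z', \<zeta>')))"
  by (rule ext) (simp add: case_prod_unfold pullback_eq_contract)

lemma holo_pullback:
  assumes P: "lifted D S P"
  shows "holo_on (\<lambda>((w, lam), \<eta>). pullback \<Phi> J P \<nu> w lam \<eta>) (pull_dom D S)"
  unfolding pullback_eq_contract'
  using P by (intro holo_on_sum holo_subst_symbol_contract [OF P] open_pull_dom) (auto simp: lifted_def)

lemma pullback_deriv:
  assumes P: "lifted D S P" and y: "((w, lam), \<eta>) \<in> pull_dom D S"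
  shows "pullback \<Phi> J (\<lambda>\<nu> z \<zeta>. deriv (P \<nu> z \<zeta>)) \<nu> w lam \<eta> = deriv (pullback \<Phi> J P \<nu> w lam) \<eta>"
proof -
  let ?y = "((w, lam), \<eta>)"
  have y0: "(?y, 0, 0) \<in> subst_dom D S" using y by (simp add: pull_dom_def subst_dom_def)
  have op: "open (pull_dom D S)" using P by (intro open_pull_dom) (auto simp: lifted_def)
  have "deriv (pullback \<Phi> J P \<nu> w lam) \<eta> = deriv (\<lambda>\<eta>. (\<lambda>((w, lam), \<eta>). pullback \<Phi> J P \<nu> w lam \<eta>) ((w, lam), \<eta>)) \<eta>"
    by simp
  also have "\<dots> = dir_deriv (0, 1) (\<lambda>((w, lam), \<eta>). pullback \<Phi> J P \<nu> w lam \<eta>) ?y"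
    by (rule deriv_eq_dir_deriv)
  also have "\<dots> = (\<Sum>k\<le>\<nu>. dir_deriv (0, 1) (\<lambda>y. contract (\<nu> - k) (\<lambda>z' \<zeta>'. subst_symbol P k (y, z', \<zeta>'))) ?y)"
    unfolding pullback_eq_contract' by (rule dir_deriv_sum_fun [OF _ holo_subst_symbol_contract [OF P] op y]) simp
  also have "\<dots> = (\<Sum>k\<le>\<nu>. contract (\<nu> - k) (\<lambda>z' \<zeta>'. dir_deriv ((0, 1), 0, 0) (subst_symbol P k) (?y, z', \<zeta>')))"
    by (rule sum.cong [OF refl dir_deriv_contract [OF holo_subst_symbol [OF P] y0]])
  also have "\<dots> = (\<Sum>k\<le>\<nu>. contract (\<nu> - k) (\<lambda>z' \<zeta>'. subst_symbol (\<lambda>\<nu> z \<zeta>. deriv (P \<nu> z \<zeta>)) k (?y, z', \<zeta>')))"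
  proof -
    have "dir_deriv ((0, 1), 0, 0) (subst_symbol P k) (?y, z', \<zeta>') = subst_symbol (\<lambda>\<nu> z \<zeta>. deriv (P \<nu> z \<zeta>)) k (?y, z', \<zeta>')" for k z' \<zeta>'
    proof -
      have "deriv (P k (\<Phi> w) (fiber_map w lam z' \<zeta>')) \<eta> = deriv (\<lambda>s. P k (\<Phi> w) (fiber_map w lam z' \<zeta>') (\<eta> + s)) 0"
        by (subst deriv_shift_0) (simp add: o_def)
      then show ?thesis by (simp add: dir_deriv_def subst_symbol_def Pair_scaleC)
    qed
    then show ?thesis by simp
  qed
  finally show ?thesis by (simp add: pullback_eq_contract)
qed

lemma subst_symbol_slice:
  assumes P: "lifted D S P" and \<eta>: "\<eta> \<in> S"
  shows "holo_on (\<lambda>(z', \<zeta>'). subst_symbol P k (((w, lam), \<eta>), z', \<zeta>')) {(z', \<zeta>'). (w, z') \<in> fiber_dom \<and> (\<Phi> w, fiber_map w lam z' \<zeta>') \<in> D}"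
    (is "holo_on _ ?W")
proof -
  have W: "?W = (\<lambda>x. (((w, lam), \<eta>), x)) -` subst_dom D S" using \<eta> by (auto simp: subst_dom_def)
  have op: "open ?W"
    unfolding W by (intro open_vimage continuous_intros holo_on_open [OF holo_subst_symbol [OF P]])
  have "holo_on (\<lambda>x. subst_symbol P k (((w, lam), \<eta>), x)) ?W"
    by (rule holo_on_compose' [OF holo_subst_symbol [OF P]])
      (use \<eta> in \<open>auto simp: subst_dom_def intro!: holo_on_Pair holo_on_const holo_on_ident op\<close>)
  then show ?thesis by (simp add: case_prod_unfold)
qed

text \<open>The partial sums form the product of \<open>P\<close> with the series \<open>t + t\<^sup>2 + \<dots>\<close>, and the pullback is linear
  over power series in \<open>t\<close>.\<close>

lemma pullback_partial_sums:
  assumes P: "lifted D S P" and y: "((w, lam), \<eta>) \<in> pull_dom D S"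
  shows "pullback \<Phi> J (partial_sums P) m w lam \<eta> = (\<Sum>\<nu><m. pullback \<Phi> J P \<nu> w lam \<eta>)"
proof -
  define T where "T l j = contract l (\<lambda>z' \<zeta>'. subst_symbol P j (((w, lam), \<eta>), z', \<zeta>'))" for l j
  have \<eta>: "\<eta> \<in> S" and 0: "(0, 0) \<in> {(z', \<zeta>'). (w, z') \<in> fiber_dom \<and> (\<Phi> w, fiber_map w lam z' \<zeta>') \<in> D}"
    using y by (auto simp: pull_dom_def)
  have "contract l (\<lambda>z' \<zeta>'. subst_symbol (partial_sums P) k (((w, lam), \<eta>), z', \<zeta>')) = (\<Sum>j<k. T l j)" for l k
  proof -
    have "contract l (\<lambda>z' \<zeta>'. \<Sum>j<k. subst_symbol P j (((w, lam), \<eta>), z', \<zeta>')) = (\<Sum>j<k. T l j)"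
      unfolding T_def
      by (rule contract_sum [OF _ holo_on_open [OF subst_symbol_slice [OF P \<eta>]] 0 subst_symbol_slice [OF P \<eta>]]) simp
    then show ?thesis by (simp add: subst_symbol_def partial_sums_def)
  qed
  then have "pullback \<Phi> J (partial_sums P) m w lam \<eta> = (\<Sum>k\<le>m. \<Sum>j<k. T (m - k) j)"
    by (simp add: pullback_eq_contract)
  also have "\<dots> = (\<Sum>(k, j)\<in>Sigma {..m} (\<lambda>k. {..<k}). T (m - k) j)"
    by (rule sum.Sigma) auto
  \<comment> \<open>The substitution is \<open>\<nu> = m - k + j\<close>.\<close>
  also have "\<dots> = (\<Sum>(\<nu>, j)\<in>Sigma {..<m} (\<lambda>\<nu>. {..\<nu>}). T (\<nu> - j) j)"
    by (rule sum.reindex_bij_witness [where i = "\<lambda>(\<nu>, j). (m - (\<nu> - j), j)" and j = "\<lambda>(k, j). (m - k + j, j)"]) auto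
  also have "\<dots> = (\<Sum>\<nu><m. \<Sum>j\<le>\<nu>. T (\<nu> - j) j)"
    by (rule sum.Sigma [symmetric]) auto
  also have "\<dots> = (\<Sum>\<nu><m. pullback \<Phi> J P \<nu> w lam \<eta>)"
    by (simp add: pullback_eq_contract T_def)
  finally show ?thesis .
qed

lemma pullback_bound:
  fixes P :: "'n formal_symbol"
  assumes P: "lifted D S P" and \<eta>: "\<eta> \<in> S" "0 < cmod \<eta>" "cmod \<eta> \<le> 1" and pos: "0 < \<delta>" "0 < c" "0 < A" "0 \<le> K" "0 < h"
    and lam: "0 < maxnorm lam"
    and box: "\<And>z' \<zeta>'. maxnorm z' \<le> \<delta> \<Longrightarrow> maxnorm \<zeta>' \<le> \<delta> * maxnorm lam \<Longrightarrow>
      (w, z') \<in> fiber_dom \<and> (\<Phi> w, fiber_map w lam z' \<zeta>') \<in> D \<and>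
      c * maxnorm lam \<le> maxnorm (fiber_map w lam z' \<zeta>') \<and> maxnorm (fiber_map w lam z' \<zeta>') \<le> C * maxnorm lam"
    and bound: "\<And>k z \<zeta>. (z, \<zeta>) \<in> D \<Longrightarrow> cmod (P k z \<zeta> \<eta>) \<le> K * fact k * A ^ k * exp (h * maxnorm \<zeta>) / maxnorm (\<eta> *s \<zeta>) ^ k"
  shows "cmod (pullback \<Phi> J P \<nu> w lam \<eta>)
    \<le> K * fact \<nu> * (2 * max (A / c) (2 ^ CARD('n) / \<delta>\<^sup>2)) ^ \<nu> * exp (h * C * maxnorm lam) / maxnorm (\<eta> *s lam) ^ \<nu>"
proof -
  define l where "l = maxnorm lam"
  \<comment> \<open>The base of the geometric growth: \<open>A / c\<close> from each order of \<open>P\<close>, the rest from each order of differentiation.\<close>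
  define B where "B = max (A / c) (2 ^ CARD('n) / \<delta>\<^sup>2)"
  define E where "E = exp (h * C * l)"
  define q where "q = cmod \<eta> * l"
  have B: "A / c \<le> B" "2 ^ CARD('n) / \<delta>\<^sup>2 \<le> B" "0 < B"
    using pos by (auto simp: B_def less_max_iff_disj)
  have l: "0 < l" using lam by (simp add: l_def)
  have q: "0 < q" "q \<le> l" using \<eta> l by (auto simp: q_def mult_left_le_one_le)
  have E: "0 < E" by (simp add: E_def)
  have trm: "cmod (contract (\<nu> - k) (\<lambda>z' \<zeta>'. subst_symbol P k (((w, lam), \<eta>), z', \<zeta>'))) \<le> K * fact \<nu> * B ^ \<nu> * E / q ^ \<nu>"
    if k: "k \<le> \<nu>" for k
  proof -
    define m where "m = \<nu> - k"
    have \<nu>: "\<nu> = k + m" using k by (simp add: m_def)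
    define M where "M = K * fact k * (A / c) ^ k * E / q ^ k"
    have M0: "0 \<le> M" using pos E q by (simp add: M_def)
    have "cmod (contract m (\<lambda>z' \<zeta>'. subst_symbol P k (((w, lam), \<eta>), z', \<zeta>'))) \<le> (2 ^ CARD('n)) ^ m * fact m * M / (\<delta> * (\<delta> * l)) ^ m"
    proof (rule contract_bound [OF subst_symbol_slice [OF P \<eta>(1)] pos(1)])
      show "0 < \<delta> * l" using pos l by simp
      fix z' \<zeta>' :: "complex ^ 'n" assume b: "maxnorm z' \<le> \<delta>" "maxnorm \<zeta>' \<le> \<delta> * l"
      define t where "t = maxnorm (fiber_map w lam z' \<zeta>')"
      have bx: "(w, z') \<in> fiber_dom" "(\<Phi> w, fiber_map w lam z' \<zeta>') \<in> D" "c * l \<le> t" "t \<le> C * l"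
        using box [OF b(1), of \<zeta>'] b(2) by (auto simp: l_def t_def)
      have "cmod (P k (\<Phi> w) (fiber_map w lam z' \<zeta>') \<eta>) \<le> K * fact k * A ^ k * exp (h * t) / (cmod \<eta> * t) ^ k"
        using bound [OF bx(2), of k] by (simp only: maxnorm_scale t_def)
      also have "\<dots> \<le> K * fact k * A ^ k * E / (c * q) ^ k"
      proof (rule frac_le)
        show "0 \<le> K * fact k * A ^ k * E" using pos E by simp
        have "h * t \<le> h * (C * l)" using bx(4) pos by (intro mult_left_mono) auto
        then show "K * fact k * A ^ k * exp (h * t) \<le> K * fact k * A ^ k * E"
          using pos by (intro mult_left_mono) (auto simp: E_def mult.assoc)
        show "0 < (c * q) ^ k" using pos q by simp
        have "c * q \<le> cmod \<eta> * t" using mult_left_mono [OF bx(3), of "cmod \<eta>"] by (simp add: q_def mult_ac)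
        then show "(c * q) ^ k \<le> (cmod \<eta> * t) ^ k" using pos q by (intro power_mono) auto
      qed
      also have "\<dots> = M" by (simp add: M_def power_divide power_mult_distrib)
      finally show "(z', \<zeta>') \<in> {(z', \<zeta>'). (w, z') \<in> fiber_dom \<and> (\<Phi> w, fiber_map w lam z' \<zeta>') \<in> D} \<and>
          cmod (subst_symbol P k (((w, lam), \<eta>), z', \<zeta>')) \<le> M"
        using bx by (simp add: subst_symbol_def)
    qed
    also have "\<dots> = fact m * M * ((2 ^ CARD('n) / \<delta>\<^sup>2) ^ m / l ^ m)"
      by (simp add: power_divide power_mult_distrib power2_eq_square mult_ac)
    also have "\<dots> \<le> fact m * M * (B ^ m / q ^ m)"
      using B q M0 pos by (intro mult_left_mono frac_le power_mono) auto
    also have "\<dots> = (fact m * fact k) * (K * (A / c) ^ k * B ^ m * E / q ^ \<nu>)"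
      by (simp add: M_def \<nu> power_add)
    also have "\<dots> \<le> fact \<nu> * (K * B ^ k * B ^ m * E / q ^ \<nu>)"
    proof (intro mult_mono divide_right_mono mult_right_mono mult_left_mono power_mono)
      have "real (fact m * fact k) \<le> real (fact (m + k))"
        unfolding of_nat_le_iff by (rule dvd_imp_le [OF fact_fact_dvd_fact]) simp
      then show "fact m * fact k \<le> (fact \<nu> :: real)" by (simp add: \<nu> add.commute)
    qed (use B pos q E in auto)
    also have "\<dots> = K * fact \<nu> * B ^ \<nu> * E / q ^ \<nu>" by (simp add: \<nu> power_add)
    finally show ?thesis by (simp add: m_def)
  qed
  have "cmod (pullback \<Phi> J P \<nu> w lam \<eta>) \<le> (\<Sum>k\<le>\<nu>. K * fact \<nu> * B ^ \<nu> * E / q ^ \<nu>)"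
    unfolding pullback_eq_contract by (intro sum_norm_le trm) auto
  also have "\<dots> = real (Suc \<nu>) * (K * fact \<nu> * B ^ \<nu> * E / q ^ \<nu>)" by simp
  also have "\<dots> \<le> 2 ^ \<nu> * (K * fact \<nu> * B ^ \<nu> * E / q ^ \<nu>)"
  proof (rule mult_right_mono)
    have "real (Suc \<nu>) \<le> real (2 ^ \<nu>)" unfolding of_nat_le_iff by (rule Suc_leI) (rule less_exp)
    then show "real (Suc \<nu>) \<le> 2 ^ \<nu>" by simp
  qed (use B pos q E in simp)
  also have "\<dots> = K * fact \<nu> * (2 * B) ^ \<nu> * E / q ^ \<nu>" by (simp add: power_mult_distrib)
  finally show ?thesis by (simp add: B_def E_def q_def l_def maxnorm_scale)
qed

end


section \<open>Symbol classes under pullback\<close>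

text \<open>The growth condition common to both symbol classes.\<close>

definition growth :: "'n::finite cotangent set \<Rightarrow> complex set \<Rightarrow> real \<Rightarrow> real \<Rightarrow> 'n formal_symbol \<Rightarrow> bool"
  where "growth V S d \<rho> P \<longleftrightarrow> (\<exists>A>0. \<forall>Z h. relatively_compact_in Z S \<and> 0 < h \<longrightarrow>
      (\<exists>C>0. \<forall>m. \<forall>(z, \<zeta>) \<in> symbol_domain V d \<rho>. \<forall>\<eta>\<in>Z.
        cmod (P m z \<zeta> \<eta>)
          \<le> C * fact m * A ^ m * exp (h * maxnorm \<zeta>) / maxnorm (\<eta> *s \<zeta>) ^ m))"

lemma N_cl_iff: "P \<in> N_cl V S \<longleftrightarrow> (\<exists>d>0. \<exists>\<rho>\<in>{0<..<1}. coefficients_holo V S d \<rho> P \<and> growth V S d \<rho> (partial_sums P))"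
  by (simp add: N_cl_def growth_def partial_sums_def)

lemma N_clI:
  assumes "0 < d" "0 < \<rho>" "\<rho> < 1" "coefficients_holo V S d \<rho> P" "growth V S d \<rho> (partial_sums P)"
  shows "P \<in> N_cl V S"
  unfolding N_cl_iff using assms by (intro exI [of _ d] conjI bexI [of _ \<rho>]) auto

lemma S_cl_iff: "P \<in> S_cl V S \<longleftrightarrow> (\<exists>d>0. \<exists>\<rho>\<in>{0<..<1}. coefficients_holo V S d \<rho> P \<and> growth V S d \<rho> P) \<and>
    (\<lambda>\<nu> z \<zeta>. deriv (P \<nu> z \<zeta>)) \<in> N_cl V S"
  by (simp add: S_cl_def growth_def)

lemma S_clI:
  assumes "0 < d" "0 < \<rho>" "\<rho> < 1" "coefficients_holo V S d \<rho> P" "growth V S d \<rho> P"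
    and "(\<lambda>\<nu> z \<zeta>. deriv (P \<nu> z \<zeta>)) \<in> N_cl V S"
  shows "P \<in> S_cl V S"
  unfolding S_cl_iff using assms by (intro conjI exI [of _ d] bexI [of _ \<rho>]) auto

text \<open>Growth passes to smaller domains and depends only on the values there. A relatively compact
  subset of \<open>S\<close> is contained in \<open>S\<close>.\<close>

lemma growth_transfer:
  assumes g: "growth V S d1 \<rho>1 P" and sub: "symbol_domain V d2 \<rho>2 \<subseteq> symbol_domain V d1 \<rho>1"
    and eq: "\<And>m z \<zeta> \<eta>. (z, \<zeta>) \<in> symbol_domain V d2 \<rho>2 \<Longrightarrow> \<eta> \<in> S \<Longrightarrow> Q m z \<zeta> \<eta> = P m z \<zeta> \<eta>"
  shows "growth V S d2 \<rho>2 Q"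
proof -
  obtain A where A: "A > 0" and bd: "\<And>Z h. relatively_compact_in Z S \<Longrightarrow> 0 < h \<Longrightarrow>
      \<exists>C>0. \<forall>m. \<forall>(z, \<zeta>) \<in> symbol_domain V d1 \<rho>1. \<forall>\<eta>\<in>Z.
        cmod (P m z \<zeta> \<eta>) \<le> C * fact m * A ^ m * exp (h * maxnorm \<zeta>) / maxnorm (\<eta> *s \<zeta>) ^ m"
    using g unfolding growth_def by blast
  show ?thesis
    unfolding growth_def
  proof (rule exI [of _ A], intro conjI A allI impI)
    fix Z h assume Z: "relatively_compact_in Z S \<and> 0 < (h::real)"
    then have ZS: "Z \<subseteq> S" using closure_subset by (auto simp: relatively_compact_in_def)
    obtain C where C: "C > 0" "\<And>m z \<zeta> \<eta>. (z, \<zeta>) \<in> symbol_domain V d1 \<rho>1 \<Longrightarrow> \<eta> \<in> Z \<Longrightarrow>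
        cmod (P m z \<zeta> \<eta>) \<le> C * fact m * A ^ m * exp (h * maxnorm \<zeta>) / maxnorm (\<eta> *s \<zeta>) ^ m"
      using bd [of Z h] Z by blast
    have "cmod (Q m z \<zeta> \<eta>) \<le> C * fact m * A ^ m * exp (h * maxnorm \<zeta>) / maxnorm (\<eta> *s \<zeta>) ^ m"
      if z: "(z, \<zeta>) \<in> symbol_domain V d2 \<rho>2" and \<eta>: "\<eta> \<in> Z" for m z \<zeta> \<eta>
      unfolding eq [OF z subsetD [OF ZS \<eta>]] by (rule C(2) [OF subsetD [OF sub z] \<eta>])
    with C(1) show "\<exists>C>0. \<forall>m. \<forall>(z, \<zeta>) \<in> symbol_domain V d2 \<rho>2. \<forall>\<eta>\<in>Z.
        cmod (Q m z \<zeta> \<eta>) \<le> C * fact m * A ^ m * exp (h * maxnorm \<zeta>) / maxnorm (\<eta> *s \<zeta>) ^ m"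
      by blast
  qed
qed

lemma open_sector:
  assumes "0 < \<theta>" "\<theta> < 1/2"
  shows "open (sector r \<theta>)"
proof -
  let ?W = "UNIV - \<real>\<^sub>\<le>\<^sub>0"
  have cont: "continuous_on ?W Arg"
    by (rule continuous_at_imp_continuous_on) (auto intro: continuous_at_Arg)
  have neg: "\<eta> \<notin> \<real>\<^sub>\<le>\<^sub>0" if "\<eta> \<in> sector r \<theta>" for \<eta>
  proof
    assume "\<eta> \<in> \<real>\<^sub>\<le>\<^sub>0"
    moreover have "\<eta> \<noteq> 0" using that by (auto simp: sector_def)
    ultimately have "\<eta> \<in> \<real>" "Re \<eta> < 0"
      by (auto simp: complex_nonpos_Reals_iff complex_is_Real_iff complex_eq_iff)
    then have "Arg \<eta> = pi" by (simp add: Arg_eq_pi complex_is_Real_iff)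
    then show False using that assms pi_gt3 by (auto simp: sector_def)
  qed
  have "open (?W \<inter> Arg -` {-\<theta>/4<..<\<theta>/4})"
    by (intro continuous_open_preimage cont) (auto simp: open_Diff closed_nonpos_Reals_complex)
  moreover have "open {\<eta>. 0 < cmod \<eta> \<and> cmod \<eta> < r}"
    by (intro open_Collect_conj open_Collect_less continuous_intros)
  ultimately have "open ((?W \<inter> Arg -` {-\<theta>/4<..<\<theta>/4}) \<inter> {\<eta>. 0 < cmod \<eta> \<and> cmod \<eta> < r})"
    by (rule open_Int)
  moreover have "sector r \<theta> = (?W \<inter> Arg -` {-\<theta>/4<..<\<theta>/4}) \<inter> {\<eta>. 0 < cmod \<eta> \<and> cmod \<eta> < r}"
    using neg by (auto simp: sector_def abs_less_iff)
  ultimately show ?thesis by simp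
qed

lemma coordinate_change_exists:
  assumes zc: "coordinates_on zc U" and wc: "coordinates_on wc U" and \<Phi>: "\<forall>x\<in>U. zc x = \<Phi> (wc x)"
    and J: "is_Jstar \<Phi> (wc ` U) J"
  shows "\<exists>N. coordinate_change U zc wc \<Phi> J N"
proof -
  have im: "\<Phi> ` wc ` U = zc ` U" using \<Phi> by force
  have inj: "inj_on \<Phi> (wc ` U)"
    using zc \<Phi> by (auto simp: coordinates_on_def inj_on_def)
  have inv: "inv_into (wc ` U) \<Phi> (zc x) = wc x" if "x \<in> U" for x
    using inv_into_f_f [OF inj, of "wc x"] \<Phi> that by simp
  obtain N where N: "N \<subseteq> zc ` U \<times> zc ` U" "\<forall>z \<in> zc ` U. (z, z) \<in> N" "holo_on (\<lambda>(z', z). J z' z) N"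
    "\<forall>(z', z) \<in> N. inv_into (wc ` U) \<Phi> z' - inv_into (wc ` U) \<Phi> z = J z' z *v (z' - z)"
    using J unfolding is_Jstar_def im by blast
  have "coordinate_change U zc wc \<Phi> J N"
  proof
    show "wc x' - wc x = J (zc x') (zc x) *v (zc x' - zc x)" if "x \<in> U" "x' \<in> U" "(zc x', zc x) \<in> N" for x x'
      using bspec [OF N(4) that(3)] by (simp add: inv that)
  qed (use assms N in auto)
  then show ?thesis ..
qed

lemma lifted_interior:
  assumes "coefficients_holo V S d \<rho> P" "open S"
  shows "lifted (interior (symbol_domain V d \<rho>)) S P"
proof -
  have "holo_on (\<lambda>((z, \<zeta>), \<eta>). P k z \<zeta> \<eta>) (interior (symbol_domain V d \<rho>) \<times> S)" for k
  proof -
    obtain W where W: "symbol_domain V d \<rho> \<times> S \<subseteq> W" "holo_on (\<lambda>((z, \<zeta>), \<eta>). P k z \<zeta> \<eta>) W"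
      using assms by (auto simp: coefficients_holo_def holo_near_def)
    show ?thesis
    proof (rule holo_on_subset [OF W(2)])
      show "interior (symbol_domain V d \<rho>) \<times> S \<subseteq> W"
        using W(1) interior_subset by blast
    qed (intro open_Times open_interior assms)
  qed
  then show ?thesis using assms by (simp add: lifted_def)
qed

lemma lifted_partial_sums:
  assumes "lifted D S P"
  shows "lifted D S (partial_sums P)"
proof -
  have "holo_on (\<lambda>x. \<Sum>\<nu><k. (\<lambda>((z, \<zeta>), \<eta>). P \<nu> z \<zeta> \<eta>) x) (D \<times> S)" for k
    using assms by (intro holo_on_sum) (auto simp: lifted_def intro: open_Times)
  then show ?thesis using assms by (simp add: lifted_def partial_sums_def case_prod_unfold)
qed

context coordinate_change
begin

lemma pullback_growth:
  assumes X: "compact X" "X \<subseteq> U" "fst ` V \<subseteq> X" and d: "0 < d" and \<rho>: "0 < \<rho>" "\<rho> < 1"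
    and S: "open S" "\<forall>\<eta>\<in>S. 0 < cmod \<eta> \<and> cmod \<eta> \<le> 1"
  obtains d' \<rho>' where "0 < d'" "0 < \<rho>'" "\<rho>' < 1"
    "symbol_domain (in_coordinates wc U V) d' \<rho>' \<times> S \<subseteq> pull_dom (interior (symbol_domain (in_coordinates zc U V) d \<rho>)) S"
    "\<And>P. lifted (interior (symbol_domain (in_coordinates zc U V) d \<rho>)) S P \<Longrightarrow> growth (in_coordinates zc U V) S d \<rho> P
      \<Longrightarrow> growth (in_coordinates wc U V) S d' \<rho>' (pullback \<Phi> J P)"
proof -
  let ?Vz = "in_coordinates zc U V" and ?Vw = "in_coordinates wc U V"
  let ?D = "interior (symbol_domain ?Vz d \<rho>)"
  obtain d' \<rho>' \<delta> c C where pos: "0 < d'" "0 < \<rho>'" "\<rho>' < 1" "0 < \<delta>" "0 < c" "0 < C" and ctl: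
    "\<And>w lam z' \<zeta>'. (w, lam) \<in> symbol_domain ?Vw d' \<rho>' \<Longrightarrow> maxnorm z' \<le> \<delta> \<Longrightarrow>
      maxnorm \<zeta>' \<le> \<delta> * maxnorm lam \<Longrightarrow>
      (w, z') \<in> fiber_dom \<and> (\<Phi> w, fiber_map w lam z' \<zeta>') \<in> ?D \<and>
      c * maxnorm lam \<le> maxnorm (fiber_map w lam z' \<zeta>') \<and> maxnorm (fiber_map w lam z' \<zeta>') \<le> C * maxnorm lam"
    by (rule symbol_control [OF X d \<rho>]) (rule that)
  show ?thesis
  proof (rule that [OF pos(1-3)])
    show "symbol_domain ?Vw d' \<rho>' \<times> S \<subseteq> pull_dom ?D S"
      using ctl [of _ _ 0 0] pos by (auto simp: pull_dom_def)
    fix P assume P: "lifted ?D S P" and g: "growth ?Vz S d \<rho> P"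
    obtain A where A: "A > 0" and bd: "\<And>Z h. relatively_compact_in Z S \<Longrightarrow> 0 < h \<Longrightarrow>
        \<exists>C>0. \<forall>m. \<forall>(z, \<zeta>) \<in> symbol_domain ?Vz d \<rho>. \<forall>\<eta>\<in>Z.
          cmod (P m z \<zeta> \<eta>) \<le> C * fact m * A ^ m * exp (h * maxnorm \<zeta>) / maxnorm (\<eta> *s \<zeta>) ^ m"
      using g unfolding growth_def by blast
    define B where "B = 2 * max (A / c) (2 ^ CARD('n) / \<delta>\<^sup>2)"
    have B: "B > 0" using A pos by (auto simp: B_def less_max_iff_disj)
    show "growth ?Vw S d' \<rho>' (pullback \<Phi> J P)"
      unfolding growth_def
    proof (rule exI [of _ B], intro conjI B allI impI)
      fix Z h assume Z: "relatively_compact_in Z S \<and> 0 < (h::real)"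
      then have ZS: "Z \<subseteq> S" using closure_subset by (auto simp: relatively_compact_in_def)
      obtain K where K: "K > 0" "\<And>m z \<zeta> \<eta>. (z, \<zeta>) \<in> symbol_domain ?Vz d \<rho> \<Longrightarrow> \<eta> \<in> Z \<Longrightarrow>
          cmod (P m z \<zeta> \<eta>) \<le> K * fact m * A ^ m * exp (h / C * maxnorm \<zeta>) / maxnorm (\<eta> *s \<zeta>) ^ m"
        using bd [of Z "h / C"] Z pos by auto blast
      have "cmod (pullback \<Phi> J P m w lam \<eta>) \<le> K * fact m * B ^ m * exp (h * maxnorm lam) / maxnorm (\<eta> *s lam) ^ m"
        if wl: "(w, lam) \<in> symbol_domain ?Vw d' \<rho>'" and \<eta>: "\<eta> \<in> Z" for m w lam \<eta>
      proof -
        have \<eta>S: "\<eta> \<in> S" using \<eta> ZS by auto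
        have "cmod (pullback \<Phi> J P m w lam \<eta>)
            \<le> K * fact m * (2 * max (A / c) (2 ^ CARD('n) / \<delta>\<^sup>2)) ^ m * exp (h / C * C * maxnorm lam) / maxnorm (\<eta> *s lam) ^ m"
        proof (rule pullback_bound [OF P \<eta>S])
          show "0 < maxnorm lam" by (rule symbol_domain_pos [OF wl pos(1,3)])
          show "cmod (P k z \<zeta> \<eta>) \<le> K * fact k * A ^ k * exp (h / C * maxnorm \<zeta>) / maxnorm (\<eta> *s \<zeta>) ^ k"
            if "(z, \<zeta>) \<in> ?D" for k z \<zeta>
            by (rule K(2)) (use that interior_subset \<eta> in auto)
        qed (use bspec [OF S(2) \<eta>S] pos A K Z ctl [OF wl] in auto)
        then show ?thesis using pos by (simp add: B_def)
      qed
      with K(1) show "\<exists>K>0. \<forall>m. \<forall>(w, lam) \<in> symbol_domain ?Vw d' \<rho>'. \<forall>\<eta>\<in>Z.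
          cmod (pullback \<Phi> J P m w lam \<eta>) \<le> K * fact m * B ^ m * exp (h * maxnorm lam) / maxnorm (\<eta> *s lam) ^ m"
        by blast
    qed
  qed
qed

lemma coefficients_holo_pullback:
  assumes "lifted D S P" "symbol_domain V d \<rho> \<times> S \<subseteq> pull_dom D S"
  shows "coefficients_holo V S d \<rho> (pullback \<Phi> J P)"
  unfolding coefficients_holo_def holo_near_def using holo_pullback [OF assms(1)] assms(2) by blast

lemma N_cl_pullback:
  assumes X: "compact X" "X \<subseteq> U" "fst ` V \<subseteq> X" and S: "open S" "\<forall>\<eta>\<in>S. 0 < cmod \<eta> \<and> cmod \<eta> \<le> 1"
    and P: "P \<in> N_cl (in_coordinates zc U V) S"
  shows "pullback \<Phi> J P \<in> N_cl (in_coordinates wc U V) S"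
proof -
  obtain d \<rho> where d: "d > 0" "0 < \<rho>" "\<rho> < 1" and ch: "coefficients_holo (in_coordinates zc U V) S d \<rho> P"
    and g: "growth (in_coordinates zc U V) S d \<rho> (partial_sums P)"
    using P by (auto simp: N_cl_iff)
  let ?D = "interior (symbol_domain (in_coordinates zc U V) d \<rho>)"
  have L: "lifted ?D S P" by (rule lifted_interior [OF ch S(1)])
  obtain d' \<rho>' where d': "0 < d'" "0 < \<rho>'" "\<rho>' < 1"
    and sub: "symbol_domain (in_coordinates wc U V) d' \<rho>' \<times> S \<subseteq> pull_dom ?D S"
    and g': "\<And>P. lifted ?D S P \<Longrightarrow> growth (in_coordinates zc U V) S d \<rho> P \<Longrightarrow> growth (in_coordinates wc U V) S d' \<rho>' (pullback \<Phi> J P)"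
    by (rule pullback_growth [OF X d S]) (rule that)
  have "growth (in_coordinates wc U V) S d' \<rho>' (partial_sums (pullback \<Phi> J P))"
  proof (rule growth_transfer [OF g' [OF lifted_partial_sums [OF L] g] subset_refl])
    fix m w lam \<eta> assume "(w, lam) \<in> symbol_domain (in_coordinates wc U V) d' \<rho>'" "\<eta> \<in> S"
    then have "((w, lam), \<eta>) \<in> pull_dom ?D S" using sub by auto
    from pullback_partial_sums [OF L this]
    show "partial_sums (pullback \<Phi> J P) m w lam \<eta> = pullback \<Phi> J (partial_sums P) m w lam \<eta>"
      by (simp add: partial_sums_def)
  qed
  then show ?thesis
    by (rule N_clI [OF d' coefficients_holo_pullback [OF L sub]])
qed

lemma S_cl_pullback:
  assumes X: "compact X" "X \<subseteq> U" "fst ` V \<subseteq> X" and S: "open S" "\<forall>\<eta>\<in>S. 0 < cmod \<eta> \<and> cmod \<eta> \<le> 1"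
    and P: "P \<in> S_cl (in_coordinates zc U V) S"
  shows "pullback \<Phi> J P \<in> S_cl (in_coordinates wc U V) S"
proof -
  let ?Vw = "in_coordinates wc U V"
  obtain d \<rho> where d: "d > 0" "0 < \<rho>" "\<rho> < 1" and ch: "coefficients_holo (in_coordinates zc U V) S d \<rho> P"
    and g: "growth (in_coordinates zc U V) S d \<rho> P"
    using P by (auto simp: S_cl_iff)
  have PN: "(\<lambda>\<nu> z \<zeta>. deriv (P \<nu> z \<zeta>)) \<in> N_cl (in_coordinates zc U V) S" using P by (auto simp: S_cl_iff)
  let ?D = "interior (symbol_domain (in_coordinates zc U V) d \<rho>)"
  have L: "lifted ?D S P" by (rule lifted_interior [OF ch S(1)])
  obtain d' \<rho>' where d': "0 < d'" "0 < \<rho>'" "\<rho>' < 1"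
    and sub: "symbol_domain ?Vw d' \<rho>' \<times> S \<subseteq> pull_dom ?D S"
    and g': "\<And>P. lifted ?D S P \<Longrightarrow> growth (in_coordinates zc U V) S d \<rho> P \<Longrightarrow> growth ?Vw S d' \<rho>' (pullback \<Phi> J P)"
    by (rule pullback_growth [OF X d S]) (rule that)
  define R where "R = pullback \<Phi> J (\<lambda>\<nu> z \<zeta>. deriv (P \<nu> z \<zeta>))"
  define Q where "Q = (\<lambda>\<nu> w lam. deriv (pullback \<Phi> J P \<nu> w lam))"
  have "R \<in> N_cl ?Vw S" unfolding R_def by (rule N_cl_pullback [OF X S PN])
  then obtain d1 \<rho>1 where d1: "0 < d1" "0 < \<rho>1" "\<rho>1 < 1" and g1: "growth ?Vw S d1 \<rho>1 (partial_sums R)"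
    by (auto simp: N_cl_iff)
  define d2 \<rho>2 where "d2 = max d' d1" and "\<rho>2 = min \<rho>' \<rho>1"
  have d2: "0 < d2" "0 < \<rho>2" "\<rho>2 < 1" using d' d1 by (auto simp: d2_def \<rho>2_def)
  have sub1: "symbol_domain ?Vw d2 \<rho>2 \<subseteq> symbol_domain ?Vw d1 \<rho>1"
    and sub2: "symbol_domain ?Vw d2 \<rho>2 \<subseteq> symbol_domain ?Vw d' \<rho>'"
    by (rule symbol_domain_mono; use d' d1 d2 in \<open>simp add: d2_def \<rho>2_def\<close>)+
  have QR: "Q \<nu> w lam \<eta> = R \<nu> w lam \<eta>" if "(w, lam) \<in> symbol_domain ?Vw d2 \<rho>2" "\<eta> \<in> S" for \<nu> w lam \<eta>
    unfolding Q_def R_def by (rule pullback_deriv [OF L, symmetric]) (use that sub sub2 in auto)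
  have "growth ?Vw S d2 \<rho>2 (partial_sums Q)"
    by (rule growth_transfer [OF g1 sub1]) (simp add: partial_sums_def QR)
  moreover have "coefficients_holo ?Vw S d2 \<rho>2 Q"
    unfolding coefficients_holo_def holo_near_def
  proof (intro allI exI conjI)
    show "symbol_domain ?Vw d2 \<rho>2 \<times> S \<subseteq> pull_dom ?D S" using sub sub2 by blast
    show "holo_on (\<lambda>((w, lam), \<eta>). Q \<nu> w lam \<eta>) (pull_dom ?D S)" for \<nu>
      unfolding Q_def by (rule holo_on_deriv_param [OF holo_pullback [OF L]])
  qed
  ultimately have "Q \<in> N_cl ?Vw S" by (intro N_clI [OF d2])
  then show ?thesis
    unfolding Q_def by (rule S_clI [OF d' coefficients_holo_pullback [OF L sub] g' [OF L g]])
qed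

lemma holo_J_slice: "holo_on (\<lambda>z'. J (\<Phi> w + z') (\<Phi> w)) {z'. (w, z') \<in> fiber_dom}"
proof -
  have eq: "{z'. (w, z') \<in> fiber_dom} = (\<lambda>z'. (w, z')) -` fiber_dom" by auto
  have op: "open {z'. (w, z') \<in> fiber_dom}"
    unfolding eq using holo_on_open [OF holo_J\<Phi>] by (intro open_vimage continuous_intros)
  have "holo_on (\<lambda>z'. (w, z')) {z'. (w, z') \<in> fiber_dom}"
    by (intro holo_on_Pair holo_on_const holo_on_ident op)
  from holo_on_compose' [OF holo_J\<Phi> this] show ?thesis by auto
qed

end

lemma lifted_slice:
  assumes "lifted D S P" "\<eta> \<in> S"
  shows "holo_on (\<lambda>\<zeta>. P k z \<zeta> \<eta>) {\<zeta>. (z, \<zeta>) \<in> D}"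
proof -
  have eq: "{\<zeta>. (z, \<zeta>) \<in> D} = (\<lambda>\<zeta>. (z, \<zeta>)) -` D" by auto
  have op: "open {\<zeta>. (z, \<zeta>) \<in> D}"
    unfolding eq using assms by (intro open_vimage continuous_intros) (auto simp: lifted_def)
  have 1: "holo_on (\<lambda>\<zeta>. ((z, \<zeta>), \<eta>)) {\<zeta>. (z, \<zeta>) \<in> D}"
    by (intro holo_on_Pair holo_on_const holo_on_ident op)
  have 2: "holo_on (\<lambda>((z, \<zeta>), \<eta>). P k z \<zeta> \<eta>) (D \<times> S)" using assms by (simp add: lifted_def)
  have "holo_on (\<lambda>\<zeta>. (\<lambda>((z, \<zeta>), \<eta>). P k z \<zeta> \<eta>) ((z, \<zeta>), \<eta>)) {\<zeta>. (z, \<zeta>) \<in> D}"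
    by (rule holo_on_compose' [OF 2 1]) (use assms in auto)
  then show ?thesis by simp
qed

section \<open>Identity and composition\<close>

lemma transform_sum:
  assumes M: "holo_on M WM" "0 \<in> WM" and lam: "transpose (M 0) *v lam \<in> Wp" and op: "open Wp"
    and "finite I" "\<And>i. i \<in> I \<Longrightarrow> holo_on (p i) Wp"
  shows "transform M m (\<lambda>x. \<Sum>i\<in>I. p i x) lam = (\<Sum>i\<in>I. transform M m (p i) lam)"
  using assms(5,6)
proof (induction I rule: finite_induct)
  case empty
  then show ?case by (simp add: transform_def)
next
  case (insert i I)
  then have "transform M m (\<lambda>x. p i x + (\<Sum>i\<in>I. p i x)) lam = transform M m (p i) lam + transform M m (\<lambda>x. \<Sum>i\<in>I. p i x) lam"
    by (intro transform_add [OF M lam] holo_on_sum op) auto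
  then show ?case using insert by simp
qed

text \<open>The derivative at the origin of \<open>x \<mapsto> M(x) x\<close> is \<open>M 0\<close>.\<close>

lemma identity_at_0:
  fixes M :: "complex ^ 'n::finite \<Rightarrow> complex ^ 'n ^ 'n"
  assumes M: "holo_on M WM" "0 \<in> WM" and fixed: "\<And>x. x \<in> WM \<Longrightarrow> M x *v x = x"
  shows "M 0 = mat 1"
proof -
  have "M 0 *v h = h" for h
  proof -
    have "(M 0 *v h) $ i = h $ i" for i
    proof -
      obtain M' where M': "(M has_derivative M') (at 0)" using M by (auto simp: holo_on_def)
      have 1: "((\<lambda>y. (M y *v y) $ i) has_derivative (\<lambda>h. (M 0 *v h) $ i)) (at 0)"
        by (rule has_derivative_matrix_mult_zero [OF M' has_derivative_ident]) simp
      have 2: "((\<lambda>y. (M y *v y) $ i) has_derivative (\<lambda>h. h $ i)) (at 0)"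
        by (rule has_derivative_transform_within_open
            [OF bounded_linear.has_derivative [OF bounded_linear_vec_nth has_derivative_ident] holo_on_open [OF M(1)] M(2)])
          (simp add: fixed)
      from has_derivative_unique [OF 1 2] show ?thesis by (rule fun_cong)
    qed
    then show ?thesis by (simp add: vec_eq_iff)
  qed
  then show ?thesis by (simp only: matrix_eq) simp
qed

lemma pullback_identity:
  assumes C: "coordinate_change U zc zc id J N" and P: "lifted D S P"
    and y: "((z, \<zeta>), \<eta>) \<in> coordinate_change.pull_dom U zc id J N D S"
  shows "pullback id J P \<nu> z \<zeta> \<eta> = P \<nu> z \<zeta> \<eta>"
proof -
  interpret coordinate_change U zc zc id J N by (rule C)
  let ?M = "\<lambda>z'. J (z + z') z" and ?WM = "{z'. (z, z') \<in> fiber_dom}"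
  have M: "holo_on ?M ?WM" using holo_J_slice [of z] by simp
  have M0: "0 \<in> ?WM" and \<eta>: "\<eta> \<in> S" and \<zeta>: "transpose (?M 0) *v \<zeta> \<in> {\<zeta>. (z, \<zeta>) \<in> D}"
    using y by (auto simp: pull_dom_def fiber_map_def)
  have fixed: "?M x *v x = x" if "x \<in> ?WM" for x
  proof -
    have "z \<in> zc ` U" "(z + x, z) \<in> N" using that by (auto simp: fiber_dom_def)
    moreover then obtain a b where "a \<in> U" "z = zc a" "b \<in> U" "z + x = zc b" using N_sub by blast
    moreover from this have "x = zc b - zc a" by (metis add_diff_cancel_left')
    ultimately show ?thesis using N_rel [of a b] by simp
  qed
  have "?M 0 = mat 1" by (rule identity_at_0 [OF M M0 fixed])
  then have \<zeta>': "\<zeta> \<in> {\<zeta>. (z, \<zeta>) \<in> D}" using \<zeta> by (simp add: transpose_mat)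
  have tr_id: "transform ?M m (\<lambda>\<zeta>. P k z \<zeta> \<eta>) \<zeta> = (if m = 0 then P k z \<zeta> \<eta> else 0)" for m k
    by (rule transform_identity [OF M M0 fixed lifted_slice [OF P \<eta>] \<zeta>'])
  have "pullback id J P \<nu> z \<zeta> \<eta> = (\<Sum>k\<le>\<nu>. if k = \<nu> then P \<nu> z \<zeta> \<eta> else 0)"
    unfolding pullback_eq_transform id_apply by (rule sum.cong [OF refl]) (auto simp: tr_id)
  then show ?thesis by simp
qed

lemma pullback_compose:
  assumes C1: "coordinate_change U zc wc \<Phi> J\<Phi> N1" and C2: "coordinate_change U wc vc \<Psi> J\<Psi> N2"
    and C3: "coordinate_change U zc vc (\<Phi> \<circ> \<Psi>) JC N3" and P: "lifted D S P"
    and y: "((v, \<kappa>), \<eta>) \<in> coordinate_change.pull_dom U vc (\<Phi> \<circ> \<Psi>) JC N3 D S"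
  shows "pullback \<Psi> J\<Psi> (pullback \<Phi> J\<Phi> P) \<nu> v \<kappa> \<eta> = pullback (\<Phi> \<circ> \<Psi>) JC P \<nu> v \<kappa> \<eta>"
proof -
  interpret C1: coordinate_change U zc wc \<Phi> J\<Phi> N1 by (rule C1)
  interpret C2: coordinate_change U wc vc \<Psi> J\<Psi> N2 by (rule C2)
  interpret C3: coordinate_change U zc vc "\<Phi> \<circ> \<Psi>" JC N3 by (rule C3)
  define w z where "w = \<Psi> v" and "z = \<Phi> w"
  have "v \<in> vc ` U" and \<eta>: "\<eta> \<in> S" and v3: "(v, 0) \<in> C3.fiber_dom" and D3: "(z, C3.fiber_map v \<kappa> 0 0) \<in> D"
    using y by (auto simp: C3.pull_dom_def C3.fiber_dom_def w_def z_def)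
  then obtain x where x: "x \<in> U" "v = vc x" by auto
  have wx: "w = wc x" and zx: "z = zc x"
    using x C2.\<Phi> C1.\<Phi> by (auto simp: w_def z_def)
  define J K L where "J = (\<lambda>z'. J\<Phi> (z + z') z)" and "K = (\<lambda>w'. J\<Psi> (w + w') w)" and "L = (\<lambda>z'. JC (z + z') z)"
  define WJ WK WL where "WJ = {z'. (w, z') \<in> C1.fiber_dom}" and "WK = {w'. (v, w') \<in> C2.fiber_dom}" and "WL = {z'. (v, z') \<in> C3.fiber_dom}"
  have J: "holo_on J WJ" "0 \<in> WJ"
    using C1.holo_J_slice [of w] C1.N_diag [OF x(1)] x(1) C1.\<Phi> [OF x(1)]
    by (auto simp: J_def WJ_def z_def C1.fiber_dom_def wx)
  have K: "holo_on K WK" "0 \<in> WK"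
    using C2.holo_J_slice [of v] C2.N_diag [OF x(1)] x(1) C2.\<Phi> [OF x(1)]
    by (auto simp: K_def WK_def w_def C2.fiber_dom_def x(2))
  have L: "holo_on L WL" "0 \<in> WL"
    using C3.holo_J_slice [of v] v3 by (auto simp: L_def WL_def z_def w_def)
  define W0 where "W0 = {x \<in> WJ \<inter> WL. J x *v x \<in> WK}"
  have "holo_on (\<lambda>x. J x *v x) (WJ \<inter> WL)"
    by (intro holo_on_matrix_vector_mult holo_on_ident open_Int holo_on_open [OF J(1)] holo_on_open [OF L(1)] holo_on_subset [OF J(1)]) auto
  from holo_on_open [OF holo_on_compose [OF K(1) this]]
  have W0: "open W0" "0 \<in> W0" using J K L by (auto simp: W0_def)
  have rel: "K (J a *v a) *v (J a *v a) = L a *v a" if "a \<in> W0" for a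
  proof -
    have N: "(z + a, z) \<in> N1" "(z + a, z) \<in> N3" "(w + J a *v a, w) \<in> N2"
      using that by (auto simp: W0_def WJ_def WK_def WL_def C1.fiber_dom_def C2.fiber_dom_def C3.fiber_dom_def z_def w_def)
    obtain b where b: "b \<in> U" "z + a = zc b" using N(1) C1.N_sub by blast
    have b': "zc x + a = zc b" using b(2) by (simp only: zx)
    then have a: "a = zc b - zc x" by (metis add_diff_cancel_left')
    have "J a *v a = J\<Phi> (zc b) (zc x) *v (zc b - zc x)"
      unfolding J_def zx b' by (simp only: a)
    also have "\<dots> = wc b - wc x"
      by (rule C1.N_rel [OF x(1) b(1), symmetric]) (use N(1) in \<open>simp only: zx b'\<close>)
    finally have Ja: "J a *v a = wc b - wc x" .
    have w_b: "w + (wc b - wc x) = wc b" by (simp add: wx)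
    have "K (J a *v a) *v (J a *v a) = J\<Psi> (wc b) (wc x) *v (wc b - wc x)"
      unfolding Ja K_def w_b by (simp only: wx)
    also have "\<dots> = vc b - vc x"
      by (rule C2.N_rel [OF x(1) b(1), symmetric]) (use N(3) in \<open>simp add: Ja wx\<close>)
    also have "\<dots> = JC (zc b) (zc x) *v (zc b - zc x)"
      by (rule C3.N_rel [OF x(1) b(1)]) (use N(2) in \<open>simp only: zx b'\<close>)
    also have "\<dots> = L a *v a"
      unfolding L_def zx b' by (simp only: a)
    finally show ?thesis .
  qed
  define p where "p k = (\<lambda>\<zeta>. P k z \<zeta> \<eta>)" for k
  define Wp where "Wp = {\<zeta>. (z, \<zeta>) \<in> D}"
  have p: "holo_on (p k) Wp" for k unfolding p_def Wp_def by (rule lifted_slice [OF P \<eta>])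
  have \<kappa>: "transpose (L 0) *v \<kappa> \<in> Wp"
    using D3 by (simp add: Wp_def L_def C3.fiber_map_def z_def w_def)
  define V where "V = {lam. transpose (J 0) *v lam \<in> Wp}"
  have \<kappa>V: "transpose (K 0) *v \<kappa> \<in> V"
  proof -
    have "transpose (J 0) *v (transpose (K 0) *v \<kappa>) = transpose (L 0) *v \<kappa>"
      by (rule compose_at_0 [OF J K L W0 rel])
    with \<kappa> show ?thesis by (simp only: V_def mem_Collect_eq)
  qed
  have T: "holo_on (transform J j (p k)) V" for j k
    unfolding V_def by (rule holo_on_transform [OF J p])
  have "pullback \<Psi> J\<Psi> (pullback \<Phi> J\<Phi> P) \<nu> v \<kappa> \<eta> = (\<Sum>m\<le>\<nu>. transform K (\<nu> - m) (\<lambda>lam. \<Sum>k\<le>m. transform J (m - k) (p k) lam) \<kappa>)"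
    by (simp add: pullback_eq_transform K_def J_def w_def z_def p_def)
  also have "\<dots> = (\<Sum>m\<le>\<nu>. \<Sum>k\<le>m. transform K (\<nu> - m) (transform J (m - k) (p k)) \<kappa>)"
    by (rule sum.cong [OF refl transform_sum [OF K \<kappa>V holo_on_open [OF T] finite_atMost T]])
  also have "\<dots> = (\<Sum>(m, k)\<in>Sigma {..\<nu>} (\<lambda>m. {..m}). transform K (\<nu> - m) (transform J (m - k) (p k)) \<kappa>)"
    by (rule sum.Sigma) auto
  also have "\<dots> = (\<Sum>(k, j)\<in>Sigma {..\<nu>} (\<lambda>k. {..\<nu> - k}). transform K (\<nu> - k - j) (transform J j (p k)) \<kappa>)"
    by (rule sum.reindex_bij_witness [where i = "\<lambda>(k, j). (k + j, k)" and j = "\<lambda>(m, k). (k, m - k)"]) auto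
  also have "\<dots> = (\<Sum>k\<le>\<nu>. \<Sum>j\<le>\<nu> - k. transform K (\<nu> - k - j) (transform J j (p k)) \<kappa>)"
    by (rule sum.Sigma [symmetric]) auto
  also have "\<dots> = (\<Sum>k\<le>\<nu>. transform L (\<nu> - k) (p k) \<kappa>)"
    by (rule sum.cong [OF refl transform_compose [OF J K L W0 rel p \<kappa>]])
  also have "\<dots> = pullback (\<Phi> \<circ> \<Psi>) JC P \<nu> v \<kappa> \<eta>"
    by (simp add: pullback_eq_transform L_def p_def z_def w_def)
  finally show ?thesis .
qed

theorem theorem6p11:
  fixes \<Omega> :: "'n::finite cotangent set"
    and U :: "(complex ^ 'n) set"
    and zc wc \<Phi> :: "complex ^ 'n \<Rightarrow> complex ^ 'n"
    and J\<Phi> :: "complex ^ 'n \<Rightarrow> complex ^ 'n \<Rightarrow> complex ^ 'n ^ 'n"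
    and r \<theta> :: real
  assumes "0 < r" "r < 1/2" "0 < \<theta>" "\<theta> < 1/2"
    and "open \<Omega>" "fiber_conic \<Omega>" "conically_compact_in \<Omega> UNIV"
    and "closure (fst ` \<Omega>) \<subseteq> U"
    and "coordinates_on zc U" "coordinates_on wc U"
    and "\<forall>x\<in>U. zc x = \<Phi> (wc x)"
    and "is_Jstar \<Phi> (wc ` U) J\<Phi>"
  shows
    "(\<forall>P \<in> S_cl (in_coordinates zc U \<Omega>) (sector r \<theta>).
        pullback \<Phi> J\<Phi> P \<in> S_cl (in_coordinates wc U \<Omega>) (sector r \<theta>)) \<and>
     (\<forall>P \<in> N_cl (in_coordinates zc U \<Omega>) (sector r \<theta>).
        pullback \<Phi> J\<Phi> P \<in> N_cl (in_coordinates wc U \<Omega>) (sector r \<theta>)) \<and>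
     (\<forall>J1. is_Jstar id (zc ` U) J1 \<longrightarrow>
        (\<forall>P \<in> S_cl (in_coordinates zc U \<Omega>) (sector r \<theta>).
          symbol_eq (in_coordinates zc U \<Omega>) (sector r \<theta>) (pullback id J1 P) P)) \<and>
     (\<forall>vc \<Psi> J\<Psi> J\<Phi>\<Psi>.
        coordinates_on vc U \<and> (\<forall>x\<in>U. wc x = \<Psi> (vc x)) \<and>
        is_Jstar \<Psi> (vc ` U) J\<Psi> \<and> is_Jstar (\<Phi> \<circ> \<Psi>) (vc ` U) J\<Phi>\<Psi> \<longrightarrow>
        (\<forall>P \<in> S_cl (in_coordinates zc U \<Omega>) (sector r \<theta>).
          symbol_eq (in_coordinates vc U \<Omega>) (sector r \<theta>)
            (pullback \<Psi> J\<Psi> (pullback \<Phi> J\<Phi> P)) (pullback (\<Phi> \<circ> \<Psi>) J\<Phi>\<Psi> P)))"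
proof -
  let ?S = "sector r \<theta>"
  have S: "open ?S" "\<forall>\<eta>\<in>?S. 0 < cmod \<eta> \<and> cmod \<eta> \<le> 1"
    using open_sector assms(1-4) by (auto simp: sector_def)
  define X where "X = closure (fst ` \<Omega>)"
  have X: "compact X" "X \<subseteq> U" "fst ` \<Omega> \<subseteq> X"
  proof -
    obtain K where K: "compact K" "\<Omega> \<subseteq> {(x, t *\<^sub>R \<xi>) |x \<xi> t. 0 < t \<and> (x, \<xi>) \<in> K}"
      using assms(7) by (auto simp: conically_compact_in_def)
    have "fst ` \<Omega> \<subseteq> fst ` K" using K(2) by force
    moreover have "bounded (fst ` K)"
      by (intro compact_imp_bounded compact_continuous_image continuous_intros K)
    ultimately show "compact X"
      unfolding X_def using bounded_subset compact_closure by blast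
    show "X \<subseteq> U" using assms(8) by (simp add: X_def)
    show "fst ` \<Omega> \<subseteq> X" unfolding X_def by (rule closure_subset)
  qed
  obtain N where C: "coordinate_change U zc wc \<Phi> J\<Phi> N"
    using coordinate_change_exists [OF assms(9-12)] ..
  have dom: "\<exists>d>0. \<exists>\<rho>\<in>{0<..<1}. \<exists>D. lifted D ?S P \<and>
      symbol_domain (in_coordinates uc U \<Omega>) d \<rho> \<times> ?S \<subseteq> coordinate_change.pull_dom U uc F JF M D ?S"
    if P: "P \<in> S_cl (in_coordinates zc U \<Omega>) ?S" and C': "coordinate_change U zc uc F JF M" for P uc F JF M
  proof -
    interpret C': coordinate_change U zc uc F JF M by (rule C')
    obtain d \<rho> where d: "d > 0" "0 < \<rho>" "\<rho> < 1" and ch: "coefficients_holo (in_coordinates zc U \<Omega>) ?S d \<rho> P"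
      using P by (auto simp: S_cl_iff)
    have L: "lifted (interior (symbol_domain (in_coordinates zc U \<Omega>) d \<rho>)) ?S P"
      by (rule lifted_interior [OF ch S(1)])
    obtain d' \<rho>' where "0 < d'" "0 < \<rho>'" "\<rho>' < 1"
      "symbol_domain (in_coordinates uc U \<Omega>) d' \<rho>' \<times> ?S
        \<subseteq> C'.pull_dom (interior (symbol_domain (in_coordinates zc U \<Omega>) d \<rho>)) ?S"
      by (rule C'.pullback_growth [OF X d S]) (rule that)
    with L show ?thesis by (intro exI [of _ d'] conjI bexI [of _ \<rho>'] exI) auto
  qed
  show ?thesis
  proof (intro conjI ballI allI impI)
    fix P assume "P \<in> S_cl (in_coordinates zc U \<Omega>) ?S"
    then show "pullback \<Phi> J\<Phi> P \<in> S_cl (in_coordinates wc U \<Omega>) ?S"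
      by (rule coordinate_change.S_cl_pullback [OF C X S])
  next
    fix P assume "P \<in> N_cl (in_coordinates zc U \<Omega>) ?S"
    then show "pullback \<Phi> J\<Phi> P \<in> N_cl (in_coordinates wc U \<Omega>) ?S"
      by (rule coordinate_change.N_cl_pullback [OF C X S])
  next
    fix J1 P assume J1: "is_Jstar id (zc ` U) J1" and P: "P \<in> S_cl (in_coordinates zc U \<Omega>) ?S"
    obtain N1 where C1: "coordinate_change U zc zc id J1 N1"
      using coordinate_change_exists [OF assms(9,9) _ J1] by auto
    obtain d \<rho> D where "d > 0" "\<rho> \<in> {0<..<1}" and L: "lifted D ?S P"
      and sub: "symbol_domain (in_coordinates zc U \<Omega>) d \<rho> \<times> ?S \<subseteq> coordinate_change.pull_dom U zc id J1 N1 D ?S"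
      using dom [OF P C1] by blast
    then show "symbol_eq (in_coordinates zc U \<Omega>) ?S (pullback id J1 P) P"
      unfolding symbol_eq_def using pullback_identity [OF C1 L subsetD [OF sub]] by blast
  next
    fix vc \<Psi> J\<Psi> J\<Phi>\<Psi> P
    assume a: "coordinates_on vc U \<and> (\<forall>x\<in>U. wc x = \<Psi> (vc x)) \<and>
        is_Jstar \<Psi> (vc ` U) J\<Psi> \<and> is_Jstar (\<Phi> \<circ> \<Psi>) (vc ` U) J\<Phi>\<Psi>"
      and P: "P \<in> S_cl (in_coordinates zc U \<Omega>) ?S"
    obtain N2 where C2: "coordinate_change U wc vc \<Psi> J\<Psi> N2"
      using coordinate_change_exists [OF assms(10)] a by blast
    have "\<forall>x\<in>U. zc x = (\<Phi> \<circ> \<Psi>) (vc x)" using a assms(11) by simp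
    then obtain N3 where C3: "coordinate_change U zc vc (\<Phi> \<circ> \<Psi>) J\<Phi>\<Psi> N3"
      using coordinate_change_exists [OF assms(9)] a by blast
    obtain d \<rho> D where "d > 0" "\<rho> \<in> {0<..<1}" and L: "lifted D ?S P"
      and sub: "symbol_domain (in_coordinates vc U \<Omega>) d \<rho> \<times> ?S \<subseteq> coordinate_change.pull_dom U vc (\<Phi> \<circ> \<Psi>) J\<Phi>\<Psi> N3 D ?S"
      using dom [OF P C3] by blast
    then show "symbol_eq (in_coordinates vc U \<Omega>) ?S (pullback \<Psi> J\<Psi> (pullback \<Phi> J\<Phi> P)) (pullback (\<Phi> \<circ> \<Psi>) J\<Phi>\<Psi> P)"
      unfolding symbol_eq_def using pullback_compose [OF C C2 C3 L subsetD [OF sub]] by blast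
  qed
qed

end
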